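(* For each $n\ge 1$ let $\{x_i=x_{i,n};\,0\le i\le n-1\}$ be independent real random variables, and suppose that the array satisfies Assumption A (stated in the context) with truncation levels $t_n$ and limit functions $g_{2k}$. Let $RC_n$ be the $n\times n$ reverse circulant matrix whose $(i,j)$-th entry ($1\le i,j\le n$) is $x_{(i+j-2)\bmod n}$, and let $Z_n$ be the $n\times n$ reverse circulant matrix built in the same way from the variables $y_i=x_i\mathbf 1_{\{|x_i|\le t_n\}}$. Then: (a) The EESD of $Z_n$ converges weakly, as $n\to\infty$, to a symmetric probability measure $\mu$ on $\mathbb R$, whose moments are $$\beta_k(\mu)=\begin{cases}\displaystyle\sum_{\sigma\in S(k)}C_\sigma & \text{if } k \text{ is even},\\ 0&\text{if } k\text{ is odd},\end{cases}$$ where $C_{2m}=\int_0^1 g_{2m}(t)\,dt$ for $m\ge1$. In particular, if for every $n$ the variables $\{x_{i,n};\,0\le i\le n-1\}$ are i.i.d., then the EESD of $Z_n$ converges weakly to a symmetric probability measure $\mu$ on $\mathbb R$ with moments $\beta_k(\mu)=\sum_{\sigma\in S(k)}C_\sigma$ for $k$ even and $\beta_k(\mu)=0$ for $k$ odd, where $C_{2m}=\lim_{n\to\infty} g_{2m,n}$ for $m\ge1$ (the $g_{2m,n}$ being constant functions in that case). (b) If, in addition, $$\sum_{i=0}^{n-1}\mathbb E\big[x_i^2\mathbf 1_{\{|x_i|>t_n\}}\big]\to 0\quad (n\to\infty),$$ then the EESD of $RC_n$ converges weakly to $\mu$.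
   Context: **EESD.** For an $n\times n$ real symmetric random matrix $A$ with eigenvalues $\lambda_1,\dots,\lambda_n$, the empirical spectral distribution (ESD) is the distribution of the random measure $\mu_A=\frac1n\sum_{i=1}^n\delta_{\lambda_i}$; the expected empirical spectral distribution (EESD) is the non-random probability distribution with measure $\mathbb E\mu_A$. **Partitions.** $[k]=\{1,\dots,k\}$ and $\mathcal P(k)$ is the set of all partitions of $[k]$. For a real sequence $\{c_n\}_{n\ge1}$, its multiplicative extension is $c_\sigma=\prod_{V\in\sigma}c_{|V|}$, the product being over the blocks $V$ of $\sigma\in\mathcal P(k)$. $S(k)$ denotes the set of symmetric partitions of $[k]$: those in which every block contains the same number of odd and even integers (so every block has even size, and only even-indexed $C_{2m}$ enter $C_\sigma$). **Assumption A.** For $k,n\ge1$, $g_{2k,n}$ are bounded Riemann integrable functions on $[0,1]$, and there is a sequence $t_n\in[0,\infty]$ such that: (i) for each $k\in\mathbb N=\{1,2,\dots\}$, $$n\,\mathbb E\big[x_i^{2k}\mathbf 1_{\{|x_i|\le t_n\}}\big]=g_{2k,n}\big(\tfrac in\big)\quad\text{for }0\le i\le n-1,$$ $$\lim_{n\to\infty}n^{\alpha}\sup_{0\le i\le n-1}\Big|\mathbb E\big[x_i^{2k-1}\mathbf 1_{\{|x_i|\le t_n\}}\big]\Big|=0\quad\text{for every }\alpha<1;$$ (ii) for every $k\ge1$, $g_{2k,n}$ converges uniformly on $[0,1]$ to a function $g_{2k}$ as $n\to\infty$; (iii) with $M_{2k}=\|g_{2k}\|$ (sup norm) and $M_{2k-1}=0$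 for $k\ge1$, the numbers $\alpha_{2k}=\sum_{\sigma\in\mathcal P(2k)}M_\sigma$ satisfy Carleman's condition $\sum_{k=1}^\infty\alpha_{2k}^{-1/(2k)}=\infty$ (with $0^{-1/(2k)}=+\infty$). *)

theory Defs
  imports "HOL-Probability.Probability" "Jordan_Normal_Form.Char_Poly"
begin

(* Matrices are indexed from 0 here, so the 1-based index i + j - 2 becomes i + j. *)
definition reverse_circulant :: "nat \<Rightarrow> (nat \<Rightarrow> real) \<Rightarrow> real mat" where
  "reverse_circulant n x = mat n n (\<lambda>(i, j). x ((i + j) mod n))"

(* Eigenvalues are the roots of the characteristic polynomial, counted with multiplicity.
   proots collects the real ones, which are all of them when A is symmetric. *)
definition esd :: "real mat \<Rightarrow> real measure" where
  "esd A = measure_of UNIV (sets borel)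
     (\<lambda>B. (\<Sum>r\<in>#proots (char_poly A). indicator B r) / of_nat (dim_row A))"

definition eesd :: "'a measure \<Rightarrow> ('a \<Rightarrow> real mat) \<Rightarrow> real measure" where
  "eesd M A = measure_of UNIV (sets borel) (\<lambda>B. \<integral>\<^sup>+\<omega>. emeasure (esd (A \<omega>)) B \<partial>M)"

definition partitions :: "nat \<Rightarrow> nat set set set" where
  "partitions k = {\<sigma>. partition_on {1..k} \<sigma>}"

definition sym_partitions :: "nat \<Rightarrow> nat set set set" where
  "sym_partitions k = {\<sigma> \<in> partitions k. \<forall>V\<in>\<sigma>. card {v \<in> V. odd v} = card {v \<in> V. even v}}"

definition mult_ext :: "(nat \<Rightarrow> real) \<Rightarrow> nat set set \<Rightarrow> real" where
  "mult_ext c \<sigma> = (\<Prod>V\<in>\<sigma>. c (card V))"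

definition limit_moment :: "(nat \<Rightarrow> real) \<Rightarrow> nat \<Rightarrow> real" where
  "limit_moment C k = (if even k then \<Sum>\<sigma>\<in>sym_partitions k. mult_ext C \<sigma> else 0)"

definition has_moments :: "real measure \<Rightarrow> (nat \<Rightarrow> real) \<Rightarrow> bool" where
  "has_moments \<mu> \<beta> \<longleftrightarrow> (\<forall>k. integrable \<mu> (\<lambda>x. x ^ k) \<and> (\<integral>x. x ^ k \<partial>\<mu>) = \<beta> k)"

definition symmetric_measure :: "real measure \<Rightarrow> bool" where
  "symmetric_measure \<mu> \<longleftrightarrow> distr \<mu> borel uminus = \<mu>"

(* integrable_on is the Henstock-Kurzweil notion, which is weaker: Riemann integrability requires
   a bound on the mesh that is uniform over the interval. *)
definition riemann_integrable_on :: "(real \<Rightarrow> real) \<Rightarrow> real \<Rightarrow> real \<Rightarrow> bool" where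
  "riemann_integrable_on f a b \<longleftrightarrow>
     (\<exists>I. \<forall>e>0. \<exists>d>0. \<forall>p. p tagged_division_of {a..b} \<and> (\<forall>(x, K)\<in>p. measure lborel K < d) \<longrightarrow>
        \<bar>(\<Sum>(x, K)\<in>p. measure lborel K * f x) - I\<bar> < e)"

definition trunc :: "ennreal \<Rightarrow> real \<Rightarrow> real" where
  "trunc t x = x * indicator {a. ennreal \<bar>a\<bar> \<le> t} x"

(* M_(2k) is the sup norm of h (2k) on [0,1], and M_(2k-1) = 0. *)
definition sup_seq :: "(nat \<Rightarrow> real \<Rightarrow> real) \<Rightarrow> nat \<Rightarrow> real" where
  "sup_seq h m = (if even m then (SUP s\<in>{0..1}. \<bar>h m s\<bar>) else 0)"

definition carleman :: "(nat \<Rightarrow> real) \<Rightarrow> bool" where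
  "carleman a \<longleftrightarrow>
     (\<Sum>j. let k = Suc j in
        if a (2 * k) = 0 then \<infinity> else ennreal (a (2 * k) powr (- 1 / real (2 * k)))) = \<infinity>"

(* x n i is x_(i,n), defined on the probability space M n; g (2k) n is g_(2k,n) and h (2k) is its
   limit g_(2k). Only even positive first indices and n >= 1 matter. Integrability is explicit
   because the expectations are meant to exist, while the Bochner integral of a non-integrable
   function is 0 (this is relevant only for t n = infinity); it also covers the odd powers. *)
definition assumption_A ::
  "(nat \<Rightarrow> 'a measure) \<Rightarrow> (nat \<Rightarrow> nat \<Rightarrow> 'a \<Rightarrow> real) \<Rightarrow> (nat \<Rightarrow> ennreal) \<Rightarrow>
   (nat \<Rightarrow> nat \<Rightarrow> real \<Rightarrow> real) \<Rightarrow> (nat \<Rightarrow> real \<Rightarrow> real) \<Rightarrow> bool" where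
  "assumption_A M x t g h \<longleftrightarrow>
     (\<forall>k\<ge>1. \<forall>n\<ge>1. bounded (g (2 * k) n ` {0..1}) \<and> riemann_integrable_on (g (2 * k) n) 0 1) \<and>
     (\<forall>k\<ge>1. \<forall>n\<ge>1. \<forall>i<n.
        integrable (M n) (\<lambda>\<omega>. x n i \<omega> ^ (2 * k) * indicator {a. ennreal \<bar>a\<bar> \<le> t n} (x n i \<omega>)) \<and>
        real n * (\<integral>\<omega>. x n i \<omega> ^ (2 * k) * indicator {a. ennreal \<bar>a\<bar> \<le> t n} (x n i \<omega>) \<partial>M n)
          = g (2 * k) n (real i / real n)) \<and>
     (\<forall>k\<ge>1. \<forall>\<alpha><1. (\<lambda>n. real n powr \<alpha> *
        (SUP i\<in>{..<n}.
           \<bar>\<integral>\<omega>. x n i \<omega> ^ (2 * k - 1) * indicator {a. ennreal \<bar>a\<bar> \<le> t n} (x n i \<omega>) \<partial>M n\<bar>))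
        \<longlonglongrightarrow> 0) \<and>
     (\<forall>k\<ge>1. uniform_limit {0..1} (g (2 * k)) (h (2 * k)) sequentially) \<and>
     carleman (\<lambda>m. \<Sum>\<sigma>\<in>partitions m. mult_ext (sup_seq h) \<sigma>)"

definition identically_distributed :: "'a measure \<Rightarrow> nat \<Rightarrow> (nat \<Rightarrow> 'a \<Rightarrow> real) \<Rightarrow> bool" where
  "identically_distributed M n x \<longleftrightarrow> (\<forall>i<n. \<forall>j<n. distr M borel (x i) = distr M borel (x j))"

end

theory Submission
  imports Defs "HOL-Real_Asymp.Real_Asymp" "HOL-Number_Theory.Cong"
begin

text \<open>The proof is the method of moments, made possible by the fact that a reverse circulant matrix is
diagonalised explicitly. Let \<open>F\<^sub>m\<close> be the discrete Fourier transform of the first row.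
The matrix sends the Fourier vector of frequency \<open>m\<close> to \<open>F\<^sub>m\<close> times that of frequency
\<open>- m\<close>, so its eigenvalues are \<open>\<plusminus> |F\<^sub>m|\<close>, except for one or two real \<open>F\<^sub>m\<close>
(\<open>proots_reverse_circulant\<close>). Three consequences are used.

For even \<open>k\<close>, summing \<open>|F\<^sub>m|^k\<close> over \<open>m\<close> leaves, by orthogonality of characters, the
products \<open>y(s\<^sub>1) \<cdots> y(s\<^sub>k)\<close> over index tuples with alternating sum divisible by \<open>n\<close>
(\<open>rc_eig_even_power_sum\<close>). For odd \<open>k\<close> the pairs \<open>\<plusminus> |F\<^sub>m|\<close> cancel and at most two
powers of weighted sums of the entries remain (\<open>rc_eig_odd_power_sum\<close>). Finally, for two rows \<open>x\<close>
and \<open>y\<close> the eigenvalues can be matched so that they differ by at most the transform of \<open>x - y\<close>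
(\<open>rc_eig_lipschitz\<close>), which Parseval's identity controls.

In the expectation the tuples are sorted by the partition of the positions into level sets. A block
\<open>V\<close> contributes a moment of order \<open>|V|\<close>, which is at most a constant times
\<open>n powr - \<alpha>\<close> for any \<open>\<alpha> < 1\<close>, while its value ranges over \<open>n\<close> indices; hence every
partition contributes almost a bounded quantity, and any further linear constraint on the block values
makes it vanish in the limit. The congruence on the alternating sum is such a constraint unless each block
has as many odd as even positions, and so is the coincidence of two block values. Only the symmetric
partitions survive, and for them the sum factorises into Riemann sums of the \<open>g(2m)\<close>, whose limits
are the numbers \<open>C(2m)\<close> (\<open>constrained_tuple_sum\<close>, \<open>uniform_limit_riemann_sums\<close>,
\<open>eesd_moments_converge\<close>). Odd moments tend to zero because of the factor \<open>1 / n\<close>.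

The limit moments are dominated by the sums over all partitions in Carleman's condition, so they determine
a measure. This is Carleman's theorem (\<open>carleman_uniqueness\<close>), proved here through the
quasi-analyticity of the characteristic function with Bang's propagation argument
(\<open>quasianalytic_vanishing\<close>) and Carleman's inequality (\<open>summable_geometric_mean\<close>). Together
with tightness it yields weak convergence (\<open>method_of_moments\<close>), and applied to the reflected
measure it yields symmetry.

Replacing the truncated entries by the full ones moves the eigenvalues, in mean square, by at most the
quantity that is assumed to vanish; so the characteristic functions have the same limit
(\<open>eesd_char_perturbation\<close>) and Levy's continuity theorem concludes.\<close>

section \<open>Carleman's inequality\<close>

lemma exp_ge_partial_sum:
  fixes u :: real
  assumes "0 \<le> u" "finite I"
  shows "(\<Sum>j\<in>I. u ^ j / fact j) \<le> exp u"
proof -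
  have s: "(\<lambda>j. u ^ j / fact j) sums exp u"
    using exp_converges[of u] by (simp add: divide_inverse mult.commute scaleR_conv_of_real)
  have "(\<Sum>j\<in>I. u ^ j / fact j) \<le> (\<Sum>j. u ^ j / fact j)"
    using s assms by (intro sum_le_suminf) (auto simp: sums_iff)
  then show ?thesis using s by (simp add: sums_iff)
qed

lemma power_div_exp_le_fact: "(real n / exp 1) ^ n \<le> fact n"
proof -
  have "(\<Sum>j\<in>{n}. real n ^ j / fact j) \<le> exp (real n)"
    by (rule exp_ge_partial_sum) auto
  then have "real n ^ n \<le> exp (real n) * fact n"
    by (simp add: field_simps)
  moreover have "exp (real n) = exp 1 ^ n"
    by (simp add: exp_of_nat_mult[symmetric])
  ultimately show ?thesis
    by (simp add: power_divide field_simps)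
qed

text \<open>This is the qualitative form of Carleman's inequality. The weights \<open>j + 1\<close> turn the geometric mean of the \<open>a j\<close> into that
of the \<open>b j = (j + 1) * a j\<close> divided by the geometric mean of \<open>1, \<dots>, n + 1\<close>, which is at least
\<open>(n + 1) / e\<close>. After the inequality of arithmetic and geometric means it remains to sum the averages
of the \<open>b j\<close> over \<open>(n + 1)\<^sup>2\<close>.\<close>

lemma summable_geometric_mean:
  fixes a :: "nat \<Rightarrow> real"
  assumes pos: "\<And>n. 0 < a n" and sa: "summable a"
  shows "summable (\<lambda>n. (\<Prod>j\<le>n. a j) powr (1 / real (Suc n)))"
proof (rule summable_comparison_test')
  define b where "b j = real (Suc j) * a j" for j
  define c where "c n = (\<Sum>j\<le>n. b j) / (real (Suc n))\<^sup>2" for n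
  have bpos: "0 < b j" for j unfolding b_def using pos by simp
  \<comment> \<open>The extra term on the left is what makes the induction close: \<open>1 / N\<close> bounds
    the tail of the series of \<open>1 / (n + 1)\<^sup>2\<close> from \<open>n = N\<close> on.\<close>
  have partial: "(\<Sum>n<N. c n) + (\<Sum>j<N. b j) / real N \<le> 2 * (\<Sum>j<N. a j)" for N
  proof (induction N)
    case (Suc N)
    have B0: "0 \<le> (\<Sum>j<N. b j)" using bpos by (intro sum_nonneg) (auto intro: less_imp_le)
    have w: "(\<Sum>j<N. b j) * (1 / (real (Suc N))\<^sup>2 + 1 / real (Suc N)) \<le> (\<Sum>j<N. b j) / real N"
    proof (cases "N = 0")
      case False
      then have "1 / (real (Suc N))\<^sup>2 + 1 / real (Suc N) \<le> 1 / real N"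
        by (simp add: divide_simps power2_eq_square) (simp add: algebra_simps)
      then show ?thesis using mult_left_mono[OF _ B0] by fastforce
    qed simp
    have v: "b N * (1 / (real (Suc N))\<^sup>2 + 1 / real (Suc N)) \<le> 2 * a N"
    proof -
      have "b N * (1 / (real (Suc N))\<^sup>2 + 1 / real (Suc N)) = a N * (1 / real (Suc N) + 1)"
        unfolding b_def by (simp add: divide_simps power2_eq_square del: of_nat_Suc)
      also have "\<dots> \<le> a N * 2" using pos[of N] by (intro mult_left_mono) auto
      finally show ?thesis by simp
    qed
    have "(\<Sum>n<Suc N. c n) + (\<Sum>j<Suc N. b j) / real (Suc N)
      = (\<Sum>n<N. c n) + (\<Sum>j<N. b j) * (1 / (real (Suc N))\<^sup>2 + 1 / real (Suc N))
        + b N * (1 / (real (Suc N))\<^sup>2 + 1 / real (Suc N))"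
      unfolding c_def by (simp add: lessThan_Suc_atMost[symmetric] algebra_simps add_divide_distrib del: of_nat_Suc)
    also have "\<dots> \<le> (\<Sum>n<N. c n) + (\<Sum>j<N. b j) / real N + 2 * a N"
      using w v by linarith
    also have "\<dots> \<le> 2 * (\<Sum>j<Suc N. a j)" using Suc.IH by simp
    finally show ?case .
  qed simp
  have c0: "0 \<le> c n" for n unfolding c_def using bpos by (intro divide_nonneg_nonneg sum_nonneg) (auto intro: less_imp_le)
  have "(\<Sum>n<N. c n) \<le> 2 * suminf a" for N
  proof -
    have "0 \<le> (\<Sum>j<N. b j) / real N" using bpos by (intro divide_nonneg_nonneg sum_nonneg) (auto intro: less_imp_le)
    moreover have "(\<Sum>j<N. a j) \<le> suminf a" using sa pos by (intro sum_le_suminf) (auto intro: less_imp_le)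
    ultimately show ?thesis using partial[of N] by linarith
  qed
  then have "summable c" using c0 by (intro summableI_nonneg_bounded) auto
  then show "summable (\<lambda>n. exp 1 * c n)" by (rule summable_mult)
  show "norm ((\<Prod>j\<le>n. a j) powr (1 / real (Suc n))) \<le> exp 1 * c n" if "n \<ge> 0" for n
  proof -
    let ?p = "1 / real (Suc n)"
    have bf: "(\<Prod>j\<le>n. b j) = fact (Suc n) * (\<Prod>j\<le>n. a j)"
      unfolding b_def prod.distrib
      by (simp add: fact_prod_Suc atLeast0AtMost atLeast0LessThan lessThan_Suc_atMost del: fact_Suc of_nat_Suc)
    have ap: "0 < (\<Prod>j\<le>n. a j)" using pos by (intro prod_pos) auto
    have bp: "0 \<le> (\<Prod>j\<le>n. b j)" using bpos by (intro prod_nonneg) (auto intro: less_imp_le)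
    have "(real (Suc n) / exp 1) = ((real (Suc n) / exp 1) ^ Suc n) powr ?p"
      by (subst powr_realpow[symmetric]) (simp_all add: powr_powr del: of_nat_Suc power_Suc)
    also have "\<dots> \<le> fact (Suc n) powr ?p"
      using power_div_exp_le_fact[of "Suc n"] by (intro powr_mono2) (auto simp del: fact_Suc power_Suc of_nat_Suc)
    finally have f: "real (Suc n) / exp 1 \<le> fact (Suc n) powr ?p" .
    have "(real (Suc n) / exp 1) * (\<Prod>j\<le>n. a j) powr ?p \<le> fact (Suc n) powr ?p * (\<Prod>j\<le>n. a j) powr ?p"
      using f by (intro mult_right_mono) auto
    also have "\<dots> = (\<Prod>j\<le>n. b j) powr ?p"
      unfolding bf using ap by (simp add: powr_mult del: fact_Suc of_nat_Suc)
    also have "\<dots> \<le> (\<Sum>j\<le>n. b j / real (Suc n))"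
      using arith_geom_mean[of "{..n}" b] bpos by (simp add: less_imp_le)
    finally have "(\<Prod>j\<le>n. a j) powr ?p \<le> (\<Sum>j\<le>n. b j) / real (Suc n) * (exp 1 / real (Suc n))"
      by (simp add: field_simps sum_divide_distrib[symmetric] del: of_nat_Suc)
    then show ?thesis unfolding c_def by (simp add: power2_eq_square field_simps del: of_nat_Suc)
  qed
qed

section \<open>Quasi-analyticity and Carleman's uniqueness theorem\<close>

text \<open>Here \<open>d n\<close> stands for the modulus of the \<open>n\<close>-th derivative of a smooth function, of which only the
Taylor inequality is used. Bang's observation is that smallness of the first \<open>m + 1\<close> derivatives relative to
\<open>exp (n - m - 1) * M n\<close> degrades, over a step of length \<open>1 / (e * r m)\<close> with
\<open>r m = M (m + 1) / M m\<close>, only by a factor \<open>e\<close>; the loss is absorbed by giving up one derivative.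
Flatness at \<open>0\<close> allows one to start with arbitrarily many derivatives, and divergence of the series of
the step lengths allows one to reach any point with as many derivatives left as desired.\<close>

lemma quasianalytic_vanishing:
  fixes d :: "nat \<Rightarrow> real \<Rightarrow> real" and M :: "nat \<Rightarrow> real"
  assumes Mpos: "\<And>n. 0 < M n"
    and logconv: "\<And>n. (M (Suc n))\<^sup>2 \<le> M n * M (Suc (Suc n))"
    and bound: "\<And>n x. d n x \<le> M n"
    and taylor: "\<And>n J x h. 0 \<le> h \<Longrightarrow>
      d n (x + h) \<le> (\<Sum>j\<le>J. d (n + j) x * h ^ j / fact j) + M (n + Suc J) * h ^ Suc J / fact (Suc J)"
    and flat: "\<And>n. d n 0 = 0"
    and diverge: "\<not> summable (\<lambda>n. M n / M (Suc n))"
    and x0: "0 \<le> x"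
  shows "d 0 x \<le> 0"
proof -
  define r where "r n = M (Suc n) / M n" for n
  have rpos: "0 < r n" for n unfolding r_def using Mpos by simp
  have r_step: "r n \<le> r (Suc n)" for n
    unfolding r_def using logconv[of n] Mpos[of n] Mpos[of "Suc n"]
    by (simp add: divide_simps power2_eq_square mult.commute)
  have r_mono: "n \<le> m \<Longrightarrow> r n \<le> r m" for n m
    using lift_Suc_mono_le[of r] r_step by blast
  have M_le: "M (n + j) \<le> M n * r m ^ j" if "n + j \<le> Suc m" for n j m
    using that
  proof (induction j)
    case (Suc j)
    have "M (n + Suc j) = M (n + j) * r (n + j)" unfolding r_def using Mpos[of "n + j"] by simp
    also have "\<dots> \<le> (M n * r m ^ j) * r m"
      using Suc rpos[of "n + j"] rpos[of m] Mpos[of n] r_mono[of "n + j" m] by (intro mult_mono) auto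
    finally show ?case by (simp add: mult_ac)
  qed simp
  define S where "S m K = (\<Sum>i<K. 1 / (exp 1 * r (m + i)))" for m K
  have S0: "0 \<le> S m K" for m K unfolding S_def using rpos by (intro sum_nonneg) (auto intro: less_imp_le)
  have step: "d n x \<le> exp (real n - real m) * M n" if "0 \<le> x" "x \<le> S m K" "n < m" for n m K x
    using that
  proof (induction K arbitrary: m x n)
    case 0
    then have "x = 0" by (simp add: S_def)
    then show ?case using flat Mpos[of n] by simp
  next
    case (Suc K)
    have SS: "S m (Suc K) = 1 / (exp 1 * r m) + S (Suc m) K"
      unfolding S_def by (simp add: sum.lessThan_Suc_shift del: sum.lessThan_Suc)
    define y where "y = min x (S (Suc m) K)"
    define h where "h = x - y"
    have y: "0 \<le> y" "y \<le> S (Suc m) K" and h: "0 \<le> h" "h \<le> 1 / (exp 1 * r m)" and xy: "x = y + h"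
      using Suc.prems SS S0[of "Suc m" K] rpos[of m] unfolding y_def h_def by (auto simp: min_def)
    define J where "J = m - n"
    have J: "n + Suc J = Suc m" using Suc.prems unfolding J_def by simp
    define u where "u = exp 1 * r m * h"
    have u: "0 \<le> u" "u \<le> 1" unfolding u_def using h rpos[of m] by (auto simp: field_simps)
    define E where "E = exp (real n - real (Suc m))"
    have E0: "0 < E" unfolding E_def by simp
    have Ej: "exp (real (n + j) - real (Suc m)) = E * exp 1 ^ j" for j
      unfolding E_def exp_of_nat_mult[symmetric] by (simp add: exp_add[symmetric] algebra_simps)
    \<comment> \<open>Logarithmic convexity turns the quotients of the bounds into powers of \<open>r m\<close>, so that the
      Taylor sum becomes a partial sum of the exponential series at \<open>u \<le> 1\<close>.\<close>
    have tm: "d (n + j) y * h ^ j / fact j \<le> E * M n * (u ^ j / fact j)" if "j \<le> J" for j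
    proof -
      have "d (n + j) y \<le> exp (real (n + j) - real (Suc m)) * M (n + j)"
        using Suc.IH[of y "Suc m" "n + j"] y J that by simp
      also have "\<dots> \<le> (E * exp 1 ^ j) * (M n * r m ^ j)"
        unfolding Ej using M_le[of n j m] J that E0 by (intro mult_left_mono) auto
      finally have "d (n + j) y * h ^ j \<le> (E * exp 1 ^ j) * (M n * r m ^ j) * h ^ j"
        using h by (intro mult_right_mono) auto
      also have "\<dots> = E * M n * u ^ j" unfolding u_def by (simp add: power_mult_distrib)
      finally show ?thesis by (simp add: divide_right_mono)
    qed
    have last: "M (n + Suc J) * h ^ Suc J / fact (Suc J) \<le> E * M n * (u ^ Suc J / fact (Suc J))"
    proof -
      have EJ: "E * exp 1 ^ Suc J = 1" using Ej[of "Suc J", unfolded J] by simp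
      have "M (n + Suc J) * h ^ Suc J \<le> (M n * r m ^ Suc J) * h ^ Suc J"
        using M_le[of n "Suc J" m] J h by (intro mult_right_mono) auto
      also have "\<dots> = (E * exp 1 ^ Suc J) * (M n * r m ^ Suc J) * h ^ Suc J" unfolding EJ by simp
      also have "\<dots> = E * M n * u ^ Suc J" unfolding u_def by (simp only: power_mult_distrib mult_ac)
      finally have "M (n + Suc J) * h ^ Suc J / fact (Suc J) \<le> E * M n * u ^ Suc J / fact (Suc J)"
        by (intro divide_right_mono) auto
      then show ?thesis by simp
    qed
    have "d n x \<le> (\<Sum>j\<le>J. d (n + j) y * h ^ j / fact j) + M (n + Suc J) * h ^ Suc J / fact (Suc J)"
      unfolding xy by (rule taylor[OF h(1)])
    also have "\<dots> \<le> (\<Sum>j\<le>J. E * M n * (u ^ j / fact j)) + E * M n * (u ^ Suc J / fact (Suc J))"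
      using tm last by (intro add_mono sum_mono) auto
    also have "\<dots> = E * M n * (\<Sum>j\<le>Suc J. u ^ j / fact j)"
      by (simp add: sum_distrib_left distrib_left del: fact_Suc power_Suc)
    also have "\<dots> \<le> E * M n * exp 1"
    proof (intro mult_left_mono)
      have "(\<Sum>j\<le>Suc J. u ^ j / fact j) \<le> exp u" using u by (intro exp_ge_partial_sum) auto
      then show "(\<Sum>j\<le>Suc J. u ^ j / fact j) \<le> exp 1" using u by (meson exp_le_cancel_iff order_trans)
    qed (use E0 Mpos[of n] in auto)
    also have "\<dots> = exp (real n - real m) * M n"
      unfolding E_def by (simp add: exp_diff exp_add field_simps)
    finally show ?case .
  qed
  have "d 0 x \<le> exp (- real m) * M 0" if "m > 0" for m
  proof -
    have "\<exists>K. x \<le> S m K"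
    proof (rule ccontr)
      assume "\<nexists>K. x \<le> S m K"
      then have "summable (\<lambda>i. 1 / (exp 1 * r (m + i)))"
        using rpos by (intro summableI_nonneg_bounded[where x = x]) (auto simp: S_def less_imp_le not_le)
      then have "summable (\<lambda>i. exp 1 * (1 / (exp 1 * r (i + m))))"
        by (intro summable_mult) (simp add: add.commute)
      then have "summable (\<lambda>i. M (i + m) / M (Suc (i + m)))" unfolding r_def by simp
      then have "summable (\<lambda>i. M i / M (Suc i))"
        by (subst (asm) summable_iff_shift[of "\<lambda>i. M i / M (Suc i)"])
      with diverge show False by simp
    qed
    then show ?thesis using step[of x m _ 0] x0 that by auto
  qed
  then have ev: "\<forall>\<^sub>F m in sequentially. d 0 x \<le> exp (- real m) * M 0"
    by (auto simp: eventually_at_top_dense intro!: exI[of _ 0])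
  have "(\<lambda>m. exp (- real m) * M 0) \<longlonglongrightarrow> 0" by real_asymp
  then show ?thesis using ev by (intro tendsto_lowerbound) auto
qed

text \<open>For a measure with finite moments this is the \<open>n\<close>-th derivative of the characteristic function. It is
given by its integral formula, so that nothing has to be differentiated.\<close>

definition char_deriv :: "real measure \<Rightarrow> nat \<Rightarrow> real \<Rightarrow> complex" where
  "char_deriv \<nu> n t = (CLINT y|\<nu>. (\<i> * of_real y) ^ n * iexp (t * y))"

lemma (in real_distribution) integrable_abs_moment:
  assumes "integrable M (\<lambda>y. y ^ n)"
  shows "integrable M (\<lambda>y. \<bar>y\<bar> ^ n)"
  using integrable_norm[OF assms] by (simp add: power_abs)

lemma (in real_distribution) integrable_char_deriv:
  assumes "integrable M (\<lambda>y. y ^ n)"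
  shows "integrable M (\<lambda>y. (\<i> * of_real y) ^ n * iexp (t * y))"
  by (rule Bochner_Integration.integrable_bound[OF integrable_abs_moment[OF assms]])
     (auto simp: norm_mult norm_power)

lemma (in real_distribution) norm_char_deriv_le:
  assumes "integrable M (\<lambda>y. y ^ n)"
  shows "cmod (char_deriv M n t) \<le> (LINT y|M. \<bar>y\<bar> ^ n)"
proof -
  have "cmod (char_deriv M n t) \<le> (LINT y|M. cmod ((\<i> * of_real y) ^ n * iexp (t * y)))"
    unfolding char_deriv_def by (rule integral_norm_bound)
  also have "\<dots> = (LINT y|M. \<bar>y\<bar> ^ n)"
    by (intro Bochner_Integration.integral_cong) (auto simp: norm_mult norm_power)
  finally show ?thesis .
qed

text \<open>The Taylor formula with remainder for the exponential is integrated against the measure.\<close>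

lemma (in real_distribution) char_deriv_taylor:
  assumes int: "\<And>k. integrable M (\<lambda>y. y ^ k)"
  shows "cmod (char_deriv M n (t + h) - (\<Sum>j\<le>J. char_deriv M (n + j) t * of_real (h ^ j / fact j)))
    \<le> (LINT y|M. \<bar>y\<bar> ^ (n + Suc J)) * \<bar>h\<bar> ^ Suc J / fact (Suc J)"
proof -
  let ?f = "\<lambda>y. (\<i> * of_real y) ^ n * iexp (t * y) *
      (iexp (h * y) - (\<Sum>j\<le>J. (\<i> * of_real (h * y)) ^ j / fact j))"
  have fe: "?f y = (\<i> * of_real y) ^ n * iexp ((t + h) * y) -
      (\<Sum>j\<le>J. (\<i> * of_real y) ^ (n + j) * iexp (t * y) * of_real (h ^ j / fact j))" for y
    by (simp add: right_diff_distrib sum_distrib_left power_add power_mult_distrib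
        exp_add[symmetric] algebra_simps)
  have i2: "integrable M (\<lambda>y. (\<i> * of_real y) ^ (n + j) * iexp (t * y) * of_real (h ^ j / fact j))" for j
    using integrable_char_deriv[OF int] by (rule integrable_mult_left)
  have isum: "(CLINT y|M. (\<Sum>j\<le>J. (\<i> * of_real y) ^ (n + j) * iexp (t * y) * of_real (h ^ j / fact j)))
      = (\<Sum>j\<le>J. char_deriv M (n + j) t * of_real (h ^ j / fact j))"
    unfolding char_deriv_def
    by (subst Bochner_Integration.integral_sum[OF i2], rule sum.cong[OF refl], rule integral_mult_left_zero)
  have "char_deriv M n (t + h) - (\<Sum>j\<le>J. char_deriv M (n + j) t * of_real (h ^ j / fact j))
     = (CLINT y|M. ?f y)"
    unfolding fe isum[symmetric] unfolding char_deriv_def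
    by (rule Bochner_Integration.integral_diff[symmetric, OF integrable_char_deriv[OF int]
        Bochner_Integration.integrable_sum[OF i2]])
  then have "cmod (char_deriv M n (t + h) - (\<Sum>j\<le>J. char_deriv M (n + j) t * of_real (h ^ j / fact j)))
     \<le> (LINT y|M. cmod (?f y))"
    using integral_norm_bound[of M ?f] by simp
  also have "\<dots> \<le> (LINT y|M. \<bar>y\<bar> ^ (n + Suc J) * (\<bar>h\<bar> ^ Suc J / fact (Suc J)))"
  proof (rule integral_mono)
    show "integrable M (\<lambda>y. cmod (?f y))"
      unfolding fe
      by (intro integrable_norm Bochner_Integration.integrable_diff Bochner_Integration.integrable_sum
          integrable_char_deriv int i2)
    show "integrable M (\<lambda>y. \<bar>y\<bar> ^ (n + Suc J) * (\<bar>h\<bar> ^ Suc J / fact (Suc J)))"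
      using integrable_abs_moment[OF int] by (rule integrable_mult_left)
    show "cmod (?f y) \<le> \<bar>y\<bar> ^ (n + Suc J) * (\<bar>h\<bar> ^ Suc J / fact (Suc J))" for y
    proof -
      have "cmod (?f y) = \<bar>y\<bar> ^ n * cmod (iexp (h * y) - (\<Sum>j\<le>J. (\<i> * of_real (h * y)) ^ j / fact j))"
        by (simp add: norm_mult norm_power)
      also have "\<dots> \<le> \<bar>y\<bar> ^ n * (\<bar>h * y\<bar> ^ Suc J / fact (Suc J))"
        using iexp_approx1[of "h * y" J] by (intro mult_left_mono) auto
      also have "\<dots> = \<bar>y\<bar> ^ (n + Suc J) * (\<bar>h\<bar> ^ Suc J / fact (Suc J))"
        by (simp only: abs_mult power_mult_distrib power_add times_divide_eq_right mult_ac)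
      finally show ?thesis .
    qed
  qed
  also have "\<dots> = (LINT y|M. \<bar>y\<bar> ^ (n + Suc J)) * \<bar>h\<bar> ^ Suc J / fact (Suc J)"
    by simp
  finally show ?thesis .
qed

text \<open>The integral of \<open>\<bar>y\<bar> ^ n * (1 - c * \<bar>y\<bar>)\<^sup>2\<close>. In this form, unlike in that of the
Cauchy-Schwarz inequality, the log-convexity of moments passes to sums of measures.\<close>

lemma (in real_distribution) abs_moment_log_convex:
  assumes int: "\<And>k. integrable M (\<lambda>y. y ^ k)"
  shows "0 \<le> (LINT y|M. \<bar>y\<bar> ^ n) - 2 * c * (LINT y|M. \<bar>y\<bar> ^ Suc n) + c\<^sup>2 * (LINT y|M. \<bar>y\<bar> ^ Suc (Suc n))"
proof -
  have "0 \<le> (LINT y|M. \<bar>y\<bar> ^ n * (1 - c * \<bar>y\<bar>)\<^sup>2)"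
    by (intro Bochner_Integration.integral_nonneg) auto
  also have "\<dots> = (LINT y|M. \<bar>y\<bar> ^ n - (2 * c) * \<bar>y\<bar> ^ Suc n + c\<^sup>2 * \<bar>y\<bar> ^ Suc (Suc n))"
    by (intro Bochner_Integration.integral_cong) (auto simp: power2_eq_square algebra_simps)
  also have "\<dots> = (LINT y|M. \<bar>y\<bar> ^ n) - 2 * c * (LINT y|M. \<bar>y\<bar> ^ Suc n) + c\<^sup>2 * (LINT y|M. \<bar>y\<bar> ^ Suc (Suc n))"
    using integrable_abs_moment[OF int]
    by (subst Bochner_Integration.integral_add Bochner_Integration.integral_diff;
        (intro Bochner_Integration.integrable_diff integrable_mult_right)?; simp del: power_Suc)+
  finally show ?thesis .
qed

lemma (in real_distribution) AE_zero_of_moment_zero: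
  assumes "integrable M (\<lambda>y. y ^ (2 * k))" "(LINT y|M. y ^ (2 * k)) = 0" "k \<ge> 1"
  shows "AE y in M. y = 0"
proof -
  have "AE y in M. y ^ (2 * k) = 0"
    using assms by (subst (asm) integral_nonneg_eq_0_iff_AE) (auto simp: power_mult)
  then show ?thesis using assms by auto
qed

text \<open>Carleman's theorem on the Hamburger moment problem. The difference of the two characteristic functions is
flat at \<open>0\<close>, and its derivatives are bounded by the sums \<open>B n\<close> of the absolute moments. If the series of
\<open>B n / B (n + 1)\<close> converged, then by Carleman's inequality so would that of the \<open>n\<close>-th roots of
\<open>B 0 / B n\<close>, whose terms with even \<open>n\<close> are exactly those of Carleman's condition. Hence the
difference vanishes identically. If an even moment is zero, then both measures are concentrated at the origin.\<close>

theorem carleman_uniqueness: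
  assumes \<mu>: "real_distribution \<mu>" "has_moments \<mu> m"
    and \<nu>: "real_distribution \<nu>" "has_moments \<nu> m"
    and carl: "carleman m"
  shows "\<mu> = \<nu>"
proof (rule Levy_uniqueness[OF \<mu>(1) \<nu>(1)])
  interpret \<mu>: real_distribution \<mu> by fact
  interpret \<nu>: real_distribution \<nu> by fact
  have int\<mu>: "\<And>k. integrable \<mu> (\<lambda>y. y ^ k)" and int\<nu>: "\<And>k. integrable \<nu> (\<lambda>y. y ^ k)"
    and m\<mu>: "\<And>k. (LINT y|\<mu>. y ^ k) = m k" and m\<nu>: "\<And>k. (LINT y|\<nu>. y ^ k) = m k"
    using \<mu>(2) \<nu>(2) by (auto simp: has_moments_def)
  show "char \<mu> = char \<nu>"
  proof (cases "\<exists>k\<ge>1. m (2 * k) = 0")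
    case True
    then obtain k where k: "k \<ge> 1" "m (2 * k) = 0" by auto
    have "AE y in \<mu>. y = 0" "AE y in \<nu>. y = 0"
      using \<mu>.AE_zero_of_moment_zero[OF int\<mu>, of k] \<nu>.AE_zero_of_moment_zero[OF int\<nu>, of k] k m\<mu> m\<nu> by auto
    then have "(CLINT x|\<mu>. iexp (t * x)) = (CLINT x|\<mu>. 1)" "(CLINT x|\<nu>. iexp (t * x)) = (CLINT x|\<nu>. 1)" for t
      by (intro integral_cong_AE; auto)+
    then show ?thesis
      unfolding char_def using \<mu>.prob_space \<nu>.prob_space by auto
  next
    case False
    have even_pos: "0 < m (2 * k)" if "k \<ge> 1" for k
    proof -
      have "0 \<le> (LINT y|\<mu>. y ^ (2 * k))" by (intro Bochner_Integration.integral_nonneg) (auto simp: power_mult)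
      then show ?thesis using False that m\<mu>[of "2 * k"] by (auto simp: less_le)
    qed
    define B where "B n = (LINT y|\<mu>. \<bar>y\<bar> ^ n) + (LINT y|\<nu>. \<bar>y\<bar> ^ n)" for n
    have B0: "0 \<le> B n" for n unfolding B_def by (intro add_nonneg_nonneg Bochner_Integration.integral_nonneg) auto
    have disc: "0 \<le> B n - 2 * c * B (Suc n) + c\<^sup>2 * B (Suc (Suc n))" for n c
      using \<mu>.abs_moment_log_convex[OF int\<mu>, of n c] \<nu>.abs_moment_log_convex[OF int\<nu>, of n c]
      unfolding B_def by (simp add: algebra_simps)
    have Beven: "B (2 * k) = 2 * m (2 * k)" for k
      unfolding B_def using m\<mu>[of "2 * k"] m\<nu>[of "2 * k"] by (simp add: power_even_abs)
    have zero_step: "B (Suc n) = 0" if "B (Suc (Suc n)) = 0" for n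
    proof (rule ccontr)
      assume "B (Suc n) \<noteq> 0"
      then have eq: "2 * ((B n + 1) / B (Suc n)) * B (Suc n) = 2 * (B n + 1)" by simp
      have "0 \<le> B n - 2 * (B n + 1)"
        using disc[of n "(B n + 1) / B (Suc n)"] unfolding eq that mult_zero_right add_0_right .
      with B0[of n] have "2 \<le> - B n" "0 \<le> B n" by auto
      then show False by auto
    qed
    have logconv: "(B (Suc n))\<^sup>2 \<le> B n * B (Suc (Suc n))" for n
    proof (cases "B (Suc (Suc n)) = 0")
      case False
      then have p: "0 < B (Suc (Suc n))" using B0[of "Suc (Suc n)"] by simp
      show ?thesis using disc[of n "B (Suc n) / B (Suc (Suc n))"] p
        by (simp add: field_simps power2_eq_square)
    qed (simp add: zero_step)
    have m0: "m 0 = 1" using m\<mu>[of 0] by (simp add: \<mu>.prob_space del: \<mu>.space_eq_univ)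
    have up: "B (n + i) = 0" if "B n = 0" for n i
    proof (induction i)
      case (Suc i)
      then show ?case using logconv[of "n + i"] by simp
    qed (use that in simp)
    have Bpos: "0 < B n" for n
    proof (rule ccontr)
      assume "\<not> 0 < B n"
      then have "B n = 0" using B0[of n] by simp
      moreover have "2 * (n + 1) = n + (n + 2)" by simp
      ultimately have "B (2 * (n + 1)) = 0" using up[of n "n + 2"] by presburger
      then show False using even_pos[of "n + 1"] Beven[of "n + 1"] by simp
    qed
    have diverge: "\<not> summable (\<lambda>n. B n / B (Suc n))"
    proof
      assume "summable (\<lambda>n. B n / B (Suc n))"
      then have "summable (\<lambda>n. (\<Prod>j\<le>n. B j / B (Suc j)) powr (1 / real (Suc n)))"
        using Bpos by (intro summable_geometric_mean) auto
      moreover have "(\<Prod>j\<le>n. B j / B (Suc j)) = B 0 / B (Suc n)" for n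
        using Bpos by (induction n) (auto simp: less_imp_neq[symmetric])
      ultimately have "summable (\<lambda>n. (B 0 / B (Suc n)) powr (1 / real (Suc n)))" by simp
      then have "summable ((\<lambda>n. (B 0 / B (Suc n)) powr (1 / real (Suc n))) \<circ> (\<lambda>j. 2 * j + 1))"
        by (rule summable_reindex) (auto simp: inj_def)
      moreover have "(B 0 / B (Suc (2 * j + 1))) powr (1 / real (Suc (2 * j + 1)))
          = m (2 * Suc j) powr (- 1 / real (2 * Suc j))" for j
        using Beven[of 0] Beven[of "Suc j"] m0 even_pos[of "Suc j"]
        by (simp add: powr_minus powr_divide divide_inverse[of "-1"] inverse_powr field_simps)
      ultimately have s: "summable (\<lambda>j. m (2 * Suc j) powr (- 1 / real (2 * Suc j)))"
        by (simp add: o_def)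
      have "(\<Sum>j. let k = Suc j in
          if m (2 * k) = 0 then \<infinity> else ennreal (m (2 * k) powr (- 1 / real (2 * k))))
        = (\<Sum>j. ennreal (m (2 * Suc j) powr (- 1 / real (2 * Suc j))))"
        using even_pos[of "Suc _"] by (intro arg_cong[where f = suminf] ext) (simp add: Let_def less_imp_neq[symmetric])
      also have "\<dots> = ennreal (\<Sum>j. m (2 * Suc j) powr (- 1 / real (2 * Suc j)))"
        using s by (intro suminf_ennreal2) auto
      finally show False using carl unfolding carleman_def by simp
    qed
    define D where "D n x = char_deriv \<mu> n x - char_deriv \<nu> n x" for n x
    have D_bound: "cmod (D n x) \<le> B n" for n x
      unfolding D_def B_def
      using norm_triangle_ineq4[of "char_deriv \<mu> n x" "char_deriv \<nu> n x"]
        \<mu>.norm_char_deriv_le[OF int\<mu>, of n x] \<nu>.norm_char_deriv_le[OF int\<nu>, of n x] by linarith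
    have D_taylor: "cmod (D n (x + h)) \<le> (\<Sum>j\<le>J. cmod (D (n + j) x) * \<bar>h\<bar> ^ j / fact j)
        + B (n + Suc J) * \<bar>h\<bar> ^ Suc J / fact (Suc J)" for n x h J
    proof -
      let ?P = "\<lambda>\<rho>. char_deriv \<rho> n (x + h) - (\<Sum>j\<le>J. char_deriv \<rho> (n + j) x * of_real (h ^ j / fact j))"
      have "D n (x + h) = (\<Sum>j\<le>J. D (n + j) x * of_real (h ^ j / fact j)) + (?P \<mu> - ?P \<nu>)"
        unfolding D_def left_diff_distrib sum_subtractf by simp
      then have "cmod (D n (x + h)) \<le> cmod (\<Sum>j\<le>J. D (n + j) x * of_real (h ^ j / fact j))
          + (cmod (?P \<mu>) + cmod (?P \<nu>))"
        by (simp only:) (intro order_trans[OF norm_triangle_ineq] add_left_mono norm_triangle_ineq4)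
      also have "cmod (\<Sum>j\<le>J. D (n + j) x * of_real (h ^ j / fact j))
          \<le> (\<Sum>j\<le>J. cmod (D (n + j) x) * \<bar>h\<bar> ^ j / fact j)"
        by (rule sum_norm_le) (simp add: norm_mult norm_divide norm_power power_abs)
      also have "cmod (?P \<mu>) + cmod (?P \<nu>) \<le> B (n + Suc J) * \<bar>h\<bar> ^ Suc J / fact (Suc J)"
        using \<mu>.char_deriv_taylor[OF int\<mu>, of n x h J] \<nu>.char_deriv_taylor[OF int\<nu>, of n x h J]
        unfolding B_def by (simp add: add_divide_distrib distrib_right del: power_Suc fact_Suc)
      finally show ?thesis by simp
    qed
    have D_flat: "D n 0 = 0" for n
    proof -
      have "(CLINT y|\<rho>. (\<i> * of_real y) ^ n * iexp (0 * y)) = \<i> ^ n * of_real (LINT y|\<rho>. y ^ n)" for \<rho> :: "real measure"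
        by (simp add: power_mult_distrib flip: of_real_power)
      then show ?thesis unfolding D_def char_deriv_def using m\<mu>[of n] m\<nu>[of n] by simp
    qed
    have "cmod (D 0 x) \<le> 0" if "0 \<le> x" for x
    proof (rule quasianalytic_vanishing[of B "\<lambda>n x. cmod (D n x)" x, OF Bpos logconv D_bound _ _ diverge that])
      show "cmod (D n (x + h)) \<le> (\<Sum>j\<le>J. cmod (D (n + j) x) * h ^ j / fact j)
          + B (n + Suc J) * h ^ Suc J / fact (Suc J)" if "0 \<le> h" for n J x h
        using D_taylor[of n x h J] that by (simp only: abs_of_nonneg)
    qed (simp add: D_flat)
    moreover have "cmod (D 0 (- x)) \<le> 0" if "0 \<le> x" for x
    proof (rule quasianalytic_vanishing[of B "\<lambda>n x. cmod (D n (- x))" x, OF Bpos logconv D_bound _ _ diverge that])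
      show "cmod (D n (- (x + h))) \<le> (\<Sum>j\<le>J. cmod (D (n + j) (- x)) * h ^ j / fact j)
          + B (n + Suc J) * h ^ Suc J / fact (Suc J)" if "0 \<le> h" for n J x h
        using D_taylor[of n "- x" "- h" J] that by (simp only: abs_minus_cancel abs_of_nonneg minus_add_distrib)
    qed (simp add: D_flat)
    ultimately have D0: "0 \<le> x \<Longrightarrow> D 0 x = 0" "0 \<le> x \<Longrightarrow> D 0 (- x) = 0" for x by auto
    have "D 0 x = 0" for x
      using D0(1)[of x] D0(2)[of "- x"] by (cases "0 \<le> x") auto
    then show ?thesis
      unfolding D_def char_deriv_def char_def by (auto simp: fun_eq_iff)
  qed
qed

section \<open>The method of moments\<close>

text \<open>A bound on a higher moment makes the cutoff error of the \<open>k\<close>-th moment small uniformly over all measures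
that obey it; for the cutoff power, weak convergence is available.\<close>

lemma uniform_moment_truncation:
  assumes "real_distribution M" "integrable M (\<lambda>x. x ^ (2 * k + 2))" "(LINT x|M. x ^ (2 * k + 2)) \<le> B" "1 \<le> K"
  shows "\<bar>(LINT x|M. x ^ k) - (LINT x|M. (max (- K) (min K x)) ^ k)\<bar> \<le> 2 * B / K"
    and "integrable M (\<lambda>x. x ^ k)"
proof -
  interpret real_distribution M by fact
  have pw: "\<bar>x\<bar> ^ k \<le> 1 + x ^ (2 * k + 2)" for x :: real
  proof (cases "\<bar>x\<bar> \<le> 1")
    case True
    then have "\<bar>x\<bar> ^ k \<le> 1" by (simp add: power_le_one)
    moreover have "0 \<le> x ^ (2 * k + 2)" by (intro zero_le_even_power) auto
    ultimately show ?thesis by linarith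
  next
    case False
    then have "\<bar>x\<bar> ^ k \<le> \<bar>x\<bar> ^ (2 * k + 2)" by (intro power_increasing) auto
    also have "\<dots> = x ^ (2 * k + 2)" by (intro power_even_abs) auto
    finally show ?thesis by linarith
  qed
  show ik: "integrable M (\<lambda>x. x ^ k)"
    by (rule Bochner_Integration.integrable_bound[of _ "\<lambda>x. 1 + x ^ (2 * k + 2)"])
       (use assms pw in \<open>auto simp: power_abs intro!: AE_I2 order_trans[OF _ abs_ge_self]\<close>)
  let ?c = "\<lambda>x. max (- K) (min K x)"
  have ic: "integrable M (\<lambda>x. ?c x ^ k)"
    by (rule integrable_const_bound[of _ "K ^ k"])
       (use assms(4) in \<open>auto simp: power_abs abs_le_iff intro!: AE_I2 power_mono\<close>)
  have diff: "\<bar>x ^ k - ?c x ^ k\<bar> \<le> 2 / K * x ^ (2 * k + 2)" for x :: real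
  proof (cases "\<bar>x\<bar> \<le> K")
    case True
    then have "?c x = x" by auto
    moreover have "0 \<le> x ^ (2 * k + 2)" by (intro zero_le_even_power) auto
    ultimately show ?thesis using assms(4) by simp
  next
    case False
    have c: "\<bar>?c x\<bar> \<le> \<bar>x\<bar>" using False assms(4) by auto
    have "\<bar>x ^ k - ?c x ^ k\<bar> \<le> \<bar>x\<bar> ^ k + \<bar>?c x\<bar> ^ k"
      using abs_triangle_ineq4[of "x ^ k" "?c x ^ k"] by (simp add: power_abs)
    also have "\<dots> \<le> 2 * \<bar>x\<bar> ^ k" using c power_mono[OF c, of k] by simp
    finally have "K * \<bar>x ^ k - ?c x ^ k\<bar> \<le> \<bar>x\<bar> * (2 * \<bar>x\<bar> ^ k)"
      using False assms(4) by (intro mult_mono) auto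
    also have "\<dots> = 2 * \<bar>x\<bar> ^ (k + 1)" by simp
    also have "\<bar>x\<bar> ^ (k + 1) \<le> \<bar>x\<bar> ^ (2 * k + 2)" using False assms(4) by (intro power_increasing) auto
    also have "\<dots> = x ^ (2 * k + 2)" by (intro power_even_abs) auto
    finally show ?thesis using assms(4) by (simp add: field_simps)
  qed
  have "\<bar>(LINT x|M. x ^ k) - (LINT x|M. ?c x ^ k)\<bar> = \<bar>LINT x|M. x ^ k - ?c x ^ k\<bar>"
    using ik ic by (simp add: Bochner_Integration.integral_diff)
  also have "\<dots> \<le> (LINT x|M. \<bar>x ^ k - ?c x ^ k\<bar>)" by (rule integral_abs_bound)
  also have "\<dots> \<le> (LINT x|M. 2 / K * x ^ (2 * k + 2))"
    using ik ic assms(2) diff by (intro integral_mono) auto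
  also have "\<dots> = 2 / K * (LINT x|M. x ^ (2 * k + 2))" by (rule integral_mult_right_zero)
  also have "\<dots> \<le> 2 / K * B" using assms by (intro mult_left_mono) auto
  finally show "\<bar>(LINT x|M. x ^ k) - (LINT x|M. ?c x ^ k)\<bar> \<le> 2 * B / K" by (simp add: field_simps)
qed

text \<open>Fatou's lemma for weak convergence: the bounded cutoffs \<open>min K (x ^ (2 * k))\<close> pass to the limit, and
then \<open>K\<close> tends to infinity.\<close>

lemma weak_limit_even_moment_le:
  assumes \<mu>: "\<And>n. real_distribution (\<mu> n)" "\<And>n k. integrable (\<mu> n) (\<lambda>x. x ^ k)"
    and bd: "\<And>n. (LINT x|\<mu> n. x ^ (2 * k)) \<le> B"
    and \<nu>: "real_distribution \<nu>" "weak_conv_m \<mu> \<nu>"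
  shows "integrable \<nu> (\<lambda>x. x ^ (2 * k)) \<and> (LINT x|\<nu>. x ^ (2 * k)) \<le> B"
proof -
  interpret \<nu>: real_distribution \<nu> by fact
  have B0: "0 \<le> B"
    using bd[of 0] by (rule order_trans[rotated]) (auto intro!: Bochner_Integration.integral_nonneg simp: power_mult)
  let ?f = "\<lambda>(K::nat) (x::real). min (real K) (x ^ (2 * k))"
  have ev0: "0 \<le> x ^ (2 * k)" for x :: real by (simp add: power_mult)
  have fK: "(LINT x|\<nu>. ?f K x) \<le> B" for K
  proof -
    have "(\<lambda>n. LINT x|\<mu> n. ?f K x) \<longlonglongrightarrow> (LINT x|\<nu>. ?f K x)"
    proof (rule weak_conv_imp_integral_bdd_continuous_conv[OF \<mu>(1) \<nu>, where B = "real K"])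
      show "isCont (?f K) x" for x by (intro continuous_intros)
      show "norm (?f K x) \<le> real K" for x using ev0[of x] by auto
    qed
    moreover have "(LINT x|\<mu> n. ?f K x) \<le> B" for n
    proof -
      interpret real_distribution "\<mu> n" by fact
      have "(LINT x|\<mu> n. ?f K x) \<le> (LINT x|\<mu> n. x ^ (2 * k))"
        by (intro integral_mono \<mu>(2) integrable_const_bound[of _ "real K"]) (use ev0 in auto)
      then show ?thesis using bd[of n] by linarith
    qed
    ultimately show ?thesis by (intro LIMSEQ_le_const2) auto
  qed
  have iK: "integrable \<nu> (?f K)" for K
    by (rule \<nu>.integrable_const_bound[of _ "real K"]) (use ev0 in auto)
  have lim: "(\<lambda>K. ?f K x) \<longlonglongrightarrow> x ^ (2 * k)" for x :: real
  proof (rule tendsto_eventually)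
    obtain N :: nat where "x ^ (2 * k) \<le> real N" using real_arch_simple by blast
    then show "\<forall>\<^sub>F K in sequentially. ?f K x = x ^ (2 * k)"
      by (auto simp: eventually_sequentially intro!: exI[of _ N])
  qed
  have "integral\<^sup>N \<nu> (\<lambda>x. ennreal (x ^ (2 * k))) \<le> liminf (\<lambda>K. integral\<^sup>N \<nu> (\<lambda>x. ennreal (?f K x)))"
  proof -
    have "(\<lambda>x. ennreal (x ^ (2 * k))) = (\<lambda>x. liminf (\<lambda>K. ennreal (?f K x)))"
      using lim by (intro ext lim_imp_Liminf[symmetric] tendsto_ennrealI) auto
    then show ?thesis using nn_integral_liminf[of "\<lambda>K x. ennreal (?f K x)" \<nu>] by simp
  qed
  also have "\<dots> \<le> ennreal B"
  proof (rule Liminf_le)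
    show "\<forall>\<^sub>F K in sequentially. integral\<^sup>N \<nu> (\<lambda>x. ennreal (?f K x)) \<le> ennreal B"
    proof (intro always_eventually allI)
      fix K
      have "integral\<^sup>N \<nu> (\<lambda>x. ennreal (?f K x)) = ennreal (LINT x|\<nu>. ?f K x)"
        using iK ev0 by (intro nn_integral_eq_integral) auto
      then show "integral\<^sup>N \<nu> (\<lambda>x. ennreal (?f K x)) \<le> ennreal B" using fK[of K] by (simp add: ennreal_leI)
    qed
  qed auto
  finally have nn: "integral\<^sup>N \<nu> (\<lambda>x. ennreal (x ^ (2 * k))) \<le> ennreal B" .
  have int: "integrable \<nu> (\<lambda>x. x ^ (2 * k))"
    using nn ev0 by (intro integrableI_bounded) (auto simp: top_unique less_top[symmetric])
  then have "ennreal (LINT x|\<nu>. x ^ (2 * k)) \<le> ennreal B"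
    using nn nn_integral_eq_integral[OF int] ev0 by simp
  then show ?thesis using int B0 by simp
qed

lemma weak_limit_moments:
  assumes \<mu>: "\<And>n. real_distribution (\<mu> n)" "\<And>n k. integrable (\<mu> n) (\<lambda>x. x ^ k)"
    and lim: "\<And>k. (\<lambda>n. LINT x|\<mu> n. x ^ k) \<longlonglongrightarrow> \<beta> k"
    and \<nu>: "real_distribution \<nu>" "weak_conv_m \<mu> \<nu>"
  shows "has_moments \<nu> \<beta>"
  unfolding has_moments_def
proof (intro allI conjI)
  interpret \<nu>: real_distribution \<nu> by fact
  fix k
  have "Bseq (\<lambda>n. LINT x|\<mu> n. x ^ (2 * k + 2))" using lim by (intro convergent_imp_Bseq convergentI)
  then obtain B where B: "\<And>n. \<bar>LINT x|\<mu> n. x ^ (2 * k + 2)\<bar> \<le> B" "0 < B" unfolding Bseq_def by auto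
  have B1: "(LINT x|\<mu> n. x ^ (2 * k + 2)) \<le> B" for n using B(1)[of n] by linarith
  have \<nu>B: "integrable \<nu> (\<lambda>x. x ^ (2 * k + 2))" "(LINT x|\<nu>. x ^ (2 * k + 2)) \<le> B"
    using weak_limit_even_moment_le[of \<mu> "k + 1" B \<nu>, OF \<mu> _ \<nu>] B1 by auto
  show "integrable \<nu> (\<lambda>x. x ^ k)" by (rule uniform_moment_truncation(2)[OF \<nu>(1) \<nu>B, of 1]) simp
  show "(LINT x|\<nu>. x ^ k) = \<beta> k"
  proof (rule LIMSEQ_unique[OF _ lim])
    show "(\<lambda>n. LINT x|\<mu> n. x ^ k) \<longlonglongrightarrow> (LINT x|\<nu>. x ^ k)"
    proof (rule LIMSEQ_I)
      fix e :: real assume e: "0 < e"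
      define K where "K = max 1 (6 * B / e)"
      have K: "1 \<le> K" "2 * B / K \<le> e / 3"
      proof -
        show "1 \<le> K" unfolding K_def by simp
        have "6 * B / e \<le> K" unfolding K_def by simp
        then show "2 * B / K \<le> e / 3" using e \<open>1 \<le> K\<close> by (simp add: field_simps)
      qed
      let ?c = "\<lambda>x. (max (- K) (min K x)) ^ k"
      have "(\<lambda>n. LINT x|\<mu> n. ?c x) \<longlonglongrightarrow> (LINT x|\<nu>. ?c x)"
      proof (rule weak_conv_imp_integral_bdd_continuous_conv[OF \<mu>(1) \<nu>, where B = "K ^ k"])
        show "isCont ?c x" for x by (intro continuous_intros)
        show "norm (?c x) \<le> K ^ k" for x using K by (auto simp: power_abs intro!: power_mono)
      qed
      then obtain N where N: "\<And>n. n \<ge> N \<Longrightarrow> \<bar>(LINT x|\<mu> n. ?c x) - (LINT x|\<nu>. ?c x)\<bar> < e / 3"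
        using LIMSEQ_D[of _ _ "e / 3"] e by (metis divide_pos_pos real_norm_def zero_less_numeral)
      have "\<bar>(LINT x|\<mu> n. x ^ k) - (LINT x|\<nu>. x ^ k)\<bar> < e" if "n \<ge> N" for n
        using N[OF that] uniform_moment_truncation(1)[OF \<mu>(1) \<mu>(2) B1 K(1), of n]
          uniform_moment_truncation(1)[OF \<nu>(1) \<nu>B K(1)] K(2) by linarith
      then show "\<exists>N. \<forall>n\<ge>N. norm ((LINT x|\<mu> n. x ^ k) - (LINT x|\<nu>. x ^ k)) < e" by auto
    qed
  qed
qed

lemma tight_of_second_moment:
  assumes \<mu>: "\<And>n. real_distribution (\<mu> n)" "\<And>n k. integrable (\<mu> n) (\<lambda>x. x ^ k)"
    and bd: "\<And>n. (LINT x|\<mu> n. x ^ 2) \<le> B"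
  shows "tight \<mu>"
  unfolding tight_def
proof (intro conjI allI impI)
  fix \<epsilon> :: real assume \<epsilon>: "0 < \<epsilon>"
  define K where "K = max 1 ((\<bar>B\<bar> + 1) / \<epsilon>)"
  have K: "1 \<le> K" "\<bar>B\<bar> + 1 \<le> \<epsilon> * K"
  proof -
    show "1 \<le> K" unfolding K_def by simp
    have "(\<bar>B\<bar> + 1) / \<epsilon> \<le> K" unfolding K_def by simp
    then show "\<bar>B\<bar> + 1 \<le> \<epsilon> * K" using \<epsilon> by (simp add: field_simps)
  qed
  have K2: "\<epsilon> * K \<le> \<epsilon> * K\<^sup>2" using K \<epsilon> by (simp add: power2_eq_square)
  have "1 - \<epsilon> < measure (\<mu> n) {-K<..K}" for n
  proof -
    interpret real_distribution "\<mu> n" by fact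
    have "measure (\<mu> n) {x \<in> space (\<mu> n). x ^ 2 \<ge> K\<^sup>2} \<le> (LINT x|\<mu> n. x ^ 2) / K\<^sup>2"
      using K \<mu>(2) by (intro integral_Markov_inequality_measure[where A = "{}"]) auto
    also have "\<dots> < \<epsilon>"
    proof -
      have "(LINT x|\<mu> n. x ^ 2) < \<epsilon> * K\<^sup>2" using bd[of n] K K2 by linarith
      then show ?thesis using K by (simp add: field_simps)
    qed
    finally have s: "prob {x \<in> space (\<mu> n). x ^ 2 \<ge> K\<^sup>2} < \<epsilon>" .
    have "1 - prob {-K<..K} = prob (space (\<mu> n) - {-K<..K})" by (subst prob_compl) auto
    also have "\<dots> \<le> prob {x \<in> space (\<mu> n). x ^ 2 \<ge> K\<^sup>2}"
      using K by (intro finite_measure_mono) (auto simp: abs_le_square_iff[symmetric])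
    finally show "1 - \<epsilon> < measure (\<mu> n) {-K<..K}" using s by linarith
  qed
  moreover have "- K < K" using K by simp
  ultimately show "\<exists>a b. a < b \<and> (\<forall>n. 1 - \<epsilon> < measure (\<mu> n) {a<..b})" by blast
qed (fact \<mu>)

text \<open>Bounded second moments give tightness, so weak limit points exist; each of them has the limit moments and is
therefore the same measure.\<close>

theorem method_of_moments:
  assumes \<mu>: "\<And>n. real_distribution (\<mu> n)" "\<And>n k. integrable (\<mu> n) (\<lambda>x. x ^ k)"
    and lim: "\<And>k. (\<lambda>n. LINT x|\<mu> n. x ^ k) \<longlonglongrightarrow> \<beta> k"
    and carl: "carleman \<beta>"
  shows "\<exists>\<nu>. real_distribution \<nu> \<and> has_moments \<nu> \<beta> \<and> weak_conv_m \<mu> \<nu>"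
proof -
  have "Bseq (\<lambda>n. LINT x|\<mu> n. x ^ 2)" using lim by (intro convergent_imp_Bseq convergentI)
  then obtain B where B: "\<And>n. \<bar>LINT x|\<mu> n. x ^ 2\<bar> \<le> B" unfolding Bseq_def by auto
  have tight: "tight \<mu>"
    by (rule tight_of_second_moment[where B = B, OF \<mu>]) (use B abs_le_D1 in blast)
  have sub: "has_moments \<nu> \<beta>" if "strict_mono s" "real_distribution \<nu>" "weak_conv_m (\<mu> \<circ> s) \<nu>" for s \<nu>
    using weak_limit_moments[of "\<mu> \<circ> s" \<beta> \<nu>] \<mu> that LIMSEQ_subseq_LIMSEQ[OF lim that(1)] by (auto simp: o_def)
  obtain r \<nu> where r: "strict_mono r" "real_distribution \<nu>" "weak_conv_m (\<mu> \<circ> r) \<nu>"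
    using tight_imp_convergent_subsubsequence[OF tight, of "\<lambda>n. n"] by (auto simp: strict_mono_def o_def)
  have m: "has_moments \<nu> \<beta>" by (rule sub[OF r])
  have "weak_conv_m \<mu> \<nu>"
    using \<mu>(1) r(2) tight
  proof (rule tight_subseq_weak_converge)
    fix s \<rho> assume s: "strict_mono s" "real_distribution \<rho>" "weak_conv_m (\<mu> \<circ> s) \<rho>"
    have "\<rho> = \<nu>" by (rule carleman_uniqueness[OF s(2) sub[OF s] r(2) m carl])
    then show "weak_conv_m (\<mu> \<circ> s) \<nu>" using s by simp
  qed
  then show ?thesis using r m by auto
qed

section \<open>The spectrum of a reverse circulant matrix\<close>

text \<open>The exponent is an integer because signed combinations of indices occur.\<close>

definition unity_root :: "nat \<Rightarrow> int \<Rightarrow> complex" where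
  "unity_root n a = cis (2 * pi * of_int a / of_nat n)"

lemma unity_root_add: "unity_root n (a + b) = unity_root n a * unity_root n b"
  by (simp add: unity_root_def cis_mult add_divide_distrib distrib_left)

lemma unity_root_uminus: "unity_root n (- a) = cnj (unity_root n a)"
  by (simp add: unity_root_def cis_cnj)

lemma norm_unity_root [simp]: "cmod (unity_root n a) = 1"
  by (simp add: unity_root_def)

lemma unity_root_power: "unity_root n (a * int j) = unity_root n a ^ j"
  unfolding unity_root_def Complex.DeMoivre by (rule arg_cong[where f = cis]) simp

lemma unity_root_sum: "unity_root n (\<Sum>i\<in>I. a i) = (\<Prod>i\<in>I. unity_root n (a i))"
  by (induction I rule: infinite_finite_induct) (auto simp: unity_root_add, auto simp: unity_root_def)

lemma unity_root_eq_1_iff: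
  assumes "0 < n"
  shows "unity_root n a = 1 \<longleftrightarrow> int n dvd a"
proof
  assume "unity_root n a = 1"
  then have "cos (2 * pi * of_int a / of_nat n) = 1" by (simp add: unity_root_def complex_eq_iff)
  then obtain k :: int where "2 * pi * of_int a / of_nat n = of_int k * 2 * pi"
    unfolding cos_one_2pi_int by auto
  then have "real_of_int a = of_int (k * int n)" using assms by (simp add: field_simps)
  then have "a = k * int n" by (simp only: of_int_eq_iff)
  then show "int n dvd a" by simp
next
  assume "int n dvd a"
  then obtain k where k: "a = int n * k" by auto
  have "2 * pi * of_int a / of_nat n = 2 * pi * of_int k" unfolding k using assms by simp
  then show "unity_root n a = 1" unfolding unity_root_def by simp
qed

lemma unity_root_cong:
  assumes "0 < n" "int n dvd a - b"
  shows "unity_root n a = unity_root n b"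
  using unity_root_add[of n "a - b" b] unity_root_eq_1_iff[OF assms(1), of "a - b"] assms(2) by simp

lemma sum_unity_root:
  assumes "0 < n"
  shows "(\<Sum>j<n. unity_root n (a * int j)) = (if int n dvd a then of_nat n else 0)"
proof (cases "int n dvd a")
  case True
  then show ?thesis using unity_root_eq_1_iff[OF assms, of a] by (simp add: unity_root_power)
next
  case False
  then have "unity_root n a \<noteq> 1" using unity_root_eq_1_iff[OF assms] by simp
  moreover have "unity_root n a ^ n = 1"
    using unity_root_eq_1_iff[OF assms, of "a * int n"] by (simp add: unity_root_power)
  ultimately show ?thesis using False by (simp add: unity_root_power geometric_sum)
qed

definition dft :: "nat \<Rightarrow> (nat \<Rightarrow> real) \<Rightarrow> nat \<Rightarrow> complex" where
  "dft n x m = (\<Sum>j<n. of_real (x j) * unity_root n (int m * int j))"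

lemma dft_diff: "dft n x m - dft n y m = dft n (\<lambda>j. x j - y j) m"
  by (simp add: dft_def sum_subtractf left_diff_distrib)

lemma dft_reflect:
  assumes "m \<le> n" "0 < n"
  shows "dft n x (n - m) = cnj (dft n x m)"
proof -
  have "unity_root n (int (n - m) * int j) = unity_root n (- (int m * int j))" for j
    using assms by (intro unity_root_cong) (auto simp: of_nat_diff algebra_simps)
  then show ?thesis by (simp add: dft_def unity_root_uminus)
qed

lemma int_dvd_diff_iff:
  fixes m n :: nat
  assumes "m < n" "l < n"
  shows "int n dvd int m - int l \<longleftrightarrow> m = l"
  using assms by (simp add: mod_eq_dvd_iff[symmetric])

lemma dft_parseval:
  assumes "0 < n"
  shows "(\<Sum>m<n. (cmod (dft n x m))\<^sup>2) = real n * (\<Sum>j<n. (x j)\<^sup>2)"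
proof -
  have "complex_of_real (\<Sum>m<n. (cmod (dft n x m))\<^sup>2) = (\<Sum>m<n. dft n x m * cnj (dft n x m))"
    unfolding of_real_sum by (intro sum.cong refl) (simp only: complex_norm_square)
  also have "\<dots> = (\<Sum>m<n. \<Sum>j<n. \<Sum>l<n. of_real (x j * x l) * unity_root n ((int j - int l) * int m))"
  proof (intro sum.cong refl)
    fix m
    have u: "unity_root n ((int j - int l) * int m) = unity_root n (int m * int j) * cnj (unity_root n (int m * int l))" for j l
    proof -
      have "(int j - int l) * int m = int m * int j + - (int m * int l)" by (simp add: algebra_simps)
      then show ?thesis by (simp only: unity_root_add unity_root_uminus)
    qed
    show "dft n x m * cnj (dft n x m) = (\<Sum>j<n. \<Sum>l<n. of_real (x j * x l) * unity_root n ((int j - int l) * int m))"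
      unfolding dft_def cnj_sum sum_product u
      by (intro sum.cong refl) simp
  qed
  also have "\<dots> = (\<Sum>j<n. \<Sum>l<n. of_real (x j * x l) * (\<Sum>m<n. unity_root n ((int j - int l) * int m)))"
    unfolding sum_distrib_left
    by (rule trans[OF sum.swap], rule sum.cong[OF refl], rule sum.swap)
  also have "\<dots> = (\<Sum>j<n. \<Sum>l<n. if l = j then of_real (x j * x l) * of_nat n else 0)"
  proof (intro sum.cong refl)
    fix j l assume "j \<in> {..<n}" "l \<in> {..<n}"
    then have "int n dvd int j - int l \<longleftrightarrow> l = j" using int_dvd_diff_iff[of j n l] by auto
    then show "of_real (x j * x l) * (\<Sum>m<n. unity_root n ((int j - int l) * int m))
        = (if l = j then of_real (x j * x l) * of_nat n else 0)"
      by (simp add: sum_unity_root[OF assms])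
  qed
  also have "\<dots> = of_real (real n * (\<Sum>j<n. (x j)\<^sup>2))"
    by (simp add: sum.delta power2_eq_square sum_distrib_left mult_ac)
  finally show ?thesis by (simp only: of_real_eq_iff)
qed

text \<open>The eigenvalue attached to the frequency \<open>m < n\<close>. The frequencies \<open>m\<close> and \<open>n - m\<close> share the
modulus of the transform and receive opposite signs; at the frequencies \<open>0\<close> and \<open>n / 2\<close> the transform
is real and is itself an eigenvalue. This indexing makes the eigenvalue a Lipschitz function of the
transform at the same frequency.\<close>

definition rc_eig :: "nat \<Rightarrow> (nat \<Rightarrow> real) \<Rightarrow> nat \<Rightarrow> real" where
  "rc_eig n x m = (if n dvd 2 * m then Re (dft n x m)
     else if 2 * m < n then cmod (dft n x m) else - cmod (dft n x m))"

lemma unity_root_real: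
  assumes "0 < n" "n dvd 2 * m"
  shows "Im (unity_root n (int m * int j)) = 0"
proof -
  have "int n dvd int m * int j - (- (int m * int j))"
  proof -
    have "int n dvd int (2 * m)" using assms(2) by (simp only: of_nat_dvd_iff)
    then have "int n dvd int (2 * m) * int j" by (rule dvd_mult2)
    then show ?thesis by (simp add: algebra_simps)
  qed
  from unity_root_cong[OF assms(1) this] have "unity_root n (int m * int j) = cnj (unity_root n (int m * int j))"
    by (simp add: unity_root_uminus)
  then show ?thesis by (simp add: complex_eq_iff)
qed

lemma dft_real:
  assumes "0 < n" "n dvd 2 * m"
  shows "dft n x m = of_real (\<Sum>j<n. x j * Re (unity_root n (int m * int j)))"
  using unity_root_real[OF assms] by (simp add: dft_def complex_eq_iff)

lemma abs_rc_eig: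
  assumes "0 < n"
  shows "\<bar>rc_eig n x m\<bar> = cmod (dft n x m)"
proof (cases "n dvd 2 * m")
  case True
  show ?thesis unfolding rc_eig_def dft_real[OF assms True] norm_of_real using True by simp
qed (simp add: rc_eig_def)

lemma rc_eig_lipschitz: "\<bar>rc_eig n x m - rc_eig n y m\<bar> \<le> cmod (dft n (\<lambda>j. x j - y j) m)"
  using abs_Re_le_cmod[of "dft n x m - dft n y m"] norm_triangle_ineq3[of "dft n x m" "dft n y m"]
  by (auto simp: rc_eig_def dft_diff[symmetric] abs_minus_commute)

lemma half_index_cases:
  fixes m n :: nat
  assumes "m < n" "n dvd 2 * m"
  shows "m = 0 \<or> 2 * m = n"
proof -
  obtain k where k: "2 * m = n * k" using assms by auto
  have "n * k < n * 2" using assms k by linarith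
  then have "k < 2" by simp
  then have "k = 0 \<or> k = 1" by auto
  then show ?thesis using k by auto
qed

lemma not_half_reflect:
  fixes m n :: nat
  assumes "m < n" "\<not> n dvd 2 * m"
  shows "\<not> n dvd 2 * (n - m)" "n - m < n" "2 * (n - m) < n \<longleftrightarrow> \<not> 2 * m < n"
proof -
  have m0: "m \<noteq> 0" "2 * m \<noteq> n" using assms by (auto intro: ccontr)
  then show "n - m < n" "2 * (n - m) < n \<longleftrightarrow> \<not> 2 * m < n" using assms by auto
  show "\<not> n dvd 2 * (n - m)"
    using half_index_cases[of "n - m" n] m0 assms by auto
qed

lemma rc_eig_reflect:
  fixes m n :: nat
  assumes "m < n" "\<not> n dvd 2 * m"
  shows "rc_eig n x (n - m) = - rc_eig n x m"
  using not_half_reflect[OF assms] dft_reflect[of m n x] assms by (auto simp: rc_eig_def)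

text \<open>The phases \<open>\<phi> m\<close> are those for which \<open>cos (2 * pi * m * j / n - \<phi> m)\<close> is an eigenvector. The matrix
conjugates Fourier vectors and thus turns the phase into its negative, hence the factor \<open>2\<close>. The last condition makes the
eigenvectors of the frequencies \<open>m\<close> and \<open>n - m\<close>, a cosine and a sine, orthogonal.\<close>

lemma rc_eig_phase:
  assumes "0 < n"
  shows "\<exists>\<phi>. \<forall>m<n. dft n x m = of_real (rc_eig n x m) * cis (2 * \<phi> m) \<and>
    (n dvd 2 * m \<longrightarrow> \<phi> m = 0) \<and> (\<not> n dvd 2 * m \<longrightarrow> \<phi> m + \<phi> (n - m) = pi / 2)"
proof -
  define \<phi> where "\<phi> m = (if n dvd 2 * m then 0 else if 2 * m < n then Arg (dft n x m) / 2
    else pi / 2 - Arg (dft n x (n - m)) / 2)" for m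
  have pol: "of_real (cmod z) * cis (Arg z) = z" for z
    using rcis_cmod_Arg[of z] by (simp add: rcis_def)
  have "dft n x m = of_real (rc_eig n x m) * cis (2 * \<phi> m)" if "m < n" for m
  proof (cases "n dvd 2 * m")
    case True
    then show ?thesis using dft_real[OF assms True, of x] by (simp add: rc_eig_def \<phi>_def)
  next
    case False
    show ?thesis
    proof (cases "2 * m < n")
      case True
      then show ?thesis using False pol[of "dft n x m"] by (simp add: rc_eig_def \<phi>_def)
    next
      case ge: False
      let ?z = "dft n x (n - m)"
      have r: "dft n x m = cnj ?z" using dft_reflect[of m n x] that by simp
      have c: "cis (2 * \<phi> m) = - cnj (cis (Arg ?z))"
        using False ge by (simp add: \<phi>_def complex_eq_iff cos_diff sin_diff right_diff_distrib)
      have "cnj ?z = of_real (cmod ?z) * cnj (cis (Arg ?z))" using pol[of ?z] by (metis complex_cnj_complex_of_real complex_cnj_mult)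
      moreover have "rc_eig n x m = - cmod ?z" using False ge r by (simp add: rc_eig_def)
      ultimately show ?thesis by (simp only: c r of_real_minus minus_mult_minus)
    qed
  qed
  moreover have "\<phi> m + \<phi> (n - m) = pi / 2" if "m < n" "\<not> n dvd 2 * m" for m
    using not_half_reflect[OF that] that by (auto simp: \<phi>_def)
  ultimately show ?thesis by (intro exI[of _ \<phi>]) (auto simp: \<phi>_def)
qed

lemma bij_betw_add_mod: "bij_betw (\<lambda>j. (i + j) mod n) {..<n} {..<n}" if "0 < n" for n i :: nat
proof -
  have "inj_on (\<lambda>j. (i + j) mod n) {..<n}"
  proof (rule inj_onI)
    fix a b assume ab: "a \<in> {..<n}" "b \<in> {..<n}" "(i + a) mod n = (i + b) mod n"
    then have "[i + a = i + b] (mod n)" by (simp add: cong_def)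
    then have "[a = b] (mod n)" by (simp only: cong_add_lcancel_nat)
    then show "a = b" using ab by (simp add: cong_def)
  qed
  moreover have "(\<lambda>j. (i + j) mod n) ` {..<n} \<subseteq> {..<n}" using that by auto
  ultimately show ?thesis by (simp add: bij_betw_def endo_inj_surj)
qed

text \<open>The substitution \<open>l = (i + j) mod n\<close> turns the sum over a row of the matrix into the transform; the
index reversal reappears as the conjugation of the Fourier vector.\<close>

lemma reverse_circulant_fourier:
  assumes "0 < n"
  shows "(\<Sum>j<n. of_real (x ((i + j) mod n)) * unity_root n (int m * int j))
    = unity_root n (- (int m * int i)) * dft n x m"
proof -
  have r: "unity_root n (int m * int j) = unity_root n (- (int m * int i)) * unity_root n (int m * int ((i + j) mod n))" for j
  proof -
    have "int n dvd int m * (int i + int j - int ((i + j) mod n))"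
      by (metis dvd_minus_mod dvd_mult of_nat_add of_nat_mod)
    then have "int n dvd int m * int j - (- (int m * int i) + int m * int ((i + j) mod n))"
      by (simp add: algebra_simps)
    from unity_root_cong[OF assms this] show ?thesis by (simp only: unity_root_add)
  qed
  have "(\<Sum>j<n. of_real (x ((i + j) mod n)) * unity_root n (int m * int j))
    = unity_root n (- (int m * int i)) * (\<Sum>j<n. of_real (x ((i + j) mod n)) * unity_root n (int m * int ((i + j) mod n)))"
    by (subst r) (simp add: sum_distrib_left mult_ac)
  also have "(\<Sum>j<n. of_real (x ((i + j) mod n)) * unity_root n (int m * int ((i + j) mod n))) = dft n x m"
    unfolding dft_def
    using sum.reindex_bij_betw[OF bij_betw_add_mod[OF assms, of i], of "\<lambda>l. of_real (x l) * unity_root n (int m * int l)"] by simp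
  finally show ?thesis .
qed

text \<open>The real parts \<open>v m\<close> of the Fourier vectors, rotated by the phases of \<open>rc_eig_phase\<close>, are orthogonal
eigenvectors. The matrix is thus similar to a diagonal one, and the characteristic polynomial splits.\<close>

lemma proots_reverse_circulant:
  assumes n: "0 < n"
  shows "proots (char_poly (reverse_circulant n x)) = image_mset (rc_eig n x) (mset [0..<n])"
proof -
  obtain \<phi> where \<phi>: "\<And>m. m < n \<Longrightarrow> dft n x m = of_real (rc_eig n x m) * cis (2 * \<phi> m)"
      "\<And>m. m < n \<Longrightarrow> n dvd 2 * m \<Longrightarrow> \<phi> m = 0"
      "\<And>m. m < n \<Longrightarrow> \<not> n dvd 2 * m \<Longrightarrow> \<phi> m + \<phi> (n - m) = pi / 2"
    using rc_eig_phase[OF n, of x] by blast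
  define v where "v m j = Re (cis (- \<phi> m) * unity_root n (int m * int j))" for m j
  have eig: "(\<Sum>j<n. x ((i + j) mod n) * v m j) = rc_eig n x m * v m i" if "m < n" for m i
  proof -
    have "(\<Sum>j<n. x ((i + j) mod n) * v m j)
      = Re (cis (- \<phi> m) * (\<Sum>j<n. of_real (x ((i + j) mod n)) * unity_root n (int m * int j)))"
      unfolding v_def sum_distrib_left Re_sum by (intro sum.cong refl) (simp add: algebra_simps)
    also have "cis (- \<phi> m) * (\<Sum>j<n. of_real (x ((i + j) mod n)) * unity_root n (int m * int j))
        = of_real (rc_eig n x m) * ((cis (- \<phi> m) * cis (2 * \<phi> m)) * cnj (unity_root n (int m * int i)))"
      unfolding reverse_circulant_fourier[OF n] \<phi>(1)[OF that] unity_root_uminus by (simp add: mult_ac)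
    also have "cis (- \<phi> m) * cis (2 * \<phi> m) = cnj (cis (- \<phi> m))" by (simp add: cis_mult cis_cnj)
    also have "of_real (rc_eig n x m) * (cnj (cis (- \<phi> m)) * cnj (unity_root n (int m * int i)))
        = of_real (rc_eig n x m) * cnj (cis (- \<phi> m) * unity_root n (int m * int i))" by simp
    finally show ?thesis by (simp add: v_def)
  qed
  have prod_Re: "Re a * Re b = (Re (a * b) + Re (a * cnj b)) / 2" for a b
    by (simp add: field_simps)
  \<comment> \<open>A product of two waves is a sum of waves of frequencies \<open>m + l\<close> and \<open>m - l\<close>, and the sum of a wave
    over a period vanishes unless its frequency is a multiple of \<open>n\<close>.\<close>
  have gram: "(\<Sum>j<n. v m j * v l j) = (if m = l then if n dvd 2 * m then real n else real n / 2 else 0)"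
    if ml: "m < n" "l < n" for m l
  proof -
    have vv: "v m j * v l j = (Re (cis (- \<phi> m - \<phi> l) * unity_root n (int (m + l) * int j))
        + Re (cis (\<phi> l - \<phi> m) * unity_root n ((int m - int l) * int j))) / 2" for j
    proof -
      have u1: "unity_root n (int (m + l) * int j) = unity_root n (int m * int j) * unity_root n (int l * int j)"
        by (simp only: of_nat_add distrib_right unity_root_add)
      have "(int m - int l) * int j = int m * int j + - (int l * int j)" by (simp add: algebra_simps)
      then have u2: "unity_root n ((int m - int l) * int j) = unity_root n (int m * int j) * cnj (unity_root n (int l * int j))"
        by (simp only: unity_root_add unity_root_uminus)
      have c1: "cis (- \<phi> m - \<phi> l) = cis (- \<phi> m) * cis (- \<phi> l)" by (simp add: cis_mult)
      have c2: "cis (\<phi> l - \<phi> m) = cis (- \<phi> m) * cnj (cis (- \<phi> l))" by (simp add: cis_mult cis_cnj)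
      have "cis (- \<phi> m) * unity_root n (int m * int j) * (cis (- \<phi> l) * unity_root n (int l * int j))
        = cis (- \<phi> m - \<phi> l) * unity_root n (int (m + l) * int j)"
        unfolding u1 c1 by (simp only: mult_ac)
      moreover have "cis (- \<phi> m) * unity_root n (int m * int j) * cnj (cis (- \<phi> l) * unity_root n (int l * int j))
        = cis (\<phi> l - \<phi> m) * unity_root n ((int m - int l) * int j)"
        unfolding u2 c2 complex_cnj_mult by (simp only: mult_ac)
      ultimately show ?thesis unfolding v_def prod_Re by (simp only:)
    qed
    have "(\<Sum>j<n. v m j * v l j) = (Re (cis (- \<phi> m - \<phi> l) * (\<Sum>j<n. unity_root n (int (m + l) * int j)))
        + Re (cis (\<phi> l - \<phi> m) * (\<Sum>j<n. unity_root n ((int m - int l) * int j)))) / 2"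
      unfolding vv sum_divide_distrib[symmetric] sum.distrib sum_distrib_left Re_sum by simp
    also have "\<dots> = ((if n dvd m + l then n * cos (\<phi> m + \<phi> l) else 0)
        + (if m = l then real n else 0)) / 2"
    proof -
      have "int n dvd int m - int l \<longleftrightarrow> m = l" by (rule int_dvd_diff_iff[OF ml])
      moreover have "int n dvd int (m + l) \<longleftrightarrow> n dvd m + l" by (simp only: of_nat_dvd_iff)
      moreover have "cos (- \<phi> m - \<phi> l) = cos (\<phi> m + \<phi> l)" using cos_minus[of "\<phi> m + \<phi> l"] by simp
      ultimately show ?thesis unfolding sum_unity_root[OF n] by auto
    qed
    also have "\<dots> = (if m = l then if n dvd 2 * m then real n else real n / 2 else 0)"
    proof (cases "m = l")
      case True
      have d: "n dvd m + l \<longleftrightarrow> n dvd 2 * m" unfolding True mult_2 ..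
      have "cos (\<phi> m + \<phi> l) = 1" if "n dvd 2 * m"
        using \<phi>(2)[OF ml(1) that] unfolding True by simp
      then show ?thesis unfolding d using True by (cases "n dvd 2 * m") auto
    next
      case False
      have "cos (\<phi> m + \<phi> l) = 0" if d: "n dvd m + l"
      proof -
        obtain k where k: "m + l = n * k" using d by auto
        have "n * k < n * 2" using ml k by linarith
        then have "k < 2" by simp
        moreover have "k \<noteq> 0" using k False by (intro notI) simp
        ultimately have "k = 1" by auto
        then have l: "l = n - m" using k by auto
        have "\<not> n dvd 2 * m" using half_index_cases[of m n] ml False l by auto
        show ?thesis unfolding l \<phi>(3)[OF ml(1) \<open>\<not> n dvd 2 * m\<close>] by simp
      qed
      then show ?thesis using False by simp
    qed
    finally show ?thesis .
  qed
  define g where "g m = (if n dvd 2 * m then real n else real n / 2)" for m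
  have g0: "g m \<noteq> 0" for m using n by (simp add: g_def)
  define V where "V = mat n n (\<lambda>(j, m). v m j)"
  define W where "W = mat n n (\<lambda>(m, j). v m j / g m)"
  define D where "D = mat_diag n (rc_eig n x)"
  let ?A = "reverse_circulant n x"
  have cV: "V \<in> carrier_mat n n" and cW: "W \<in> carrier_mat n n" and cD: "D \<in> carrier_mat n n"
    and cA: "?A \<in> carrier_mat n n"
    by (auto simp: V_def W_def D_def reverse_circulant_def)
  have WV: "W * V = 1\<^sub>m n"
  proof (rule eq_matI)
    fix i j assume ij: "i < dim_row (1\<^sub>m n :: real mat)" "j < dim_col (1\<^sub>m n :: real mat)"
    then have "(W * V) $$ (i, j) = (\<Sum>k<n. v i k * v j k) / g i"
      by (simp add: W_def V_def scalar_prod_def atLeast0LessThan sum_divide_distrib)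
    also have "\<dots> = (1\<^sub>m n) $$ (i, j)" using ij gram[of i j] g0[of i] by (auto simp: g_def)
    finally show "(W * V) $$ (i, j) = (1\<^sub>m n) $$ (i, j)" .
  qed (use cV cW in auto)
  then have VW: "V * W = 1\<^sub>m n" by (rule mat_mult_left_right_inverse[OF cW cV])
  have AV: "?A * V = V * D"
  proof (rule eq_matI)
    fix i j assume ij: "i < dim_row (V * D)" "j < dim_col (V * D)"
    then have ij': "i < n" "j < n" using cV cD by auto
    have "(?A * V) $$ (i, j) = (\<Sum>k<n. x ((i + k) mod n) * v j k)"
      using ij' by (simp add: V_def reverse_circulant_def scalar_prod_def atLeast0LessThan)
    also have "\<dots> = v j i * rc_eig n x j" using eig[OF ij'(2)] by simp
    also have "\<dots> = (V * D) $$ (i, j)"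
      unfolding D_def mat_diag_mult_right[OF cV] using ij' by (simp add: V_def)
    finally show "(?A * V) $$ (i, j) = (V * D) $$ (i, j)" .
  qed (use cV cD cA in auto)
  have "?A = ?A * (V * W)" using cA by (simp add: VW)
  also have "\<dots> = ?A * V * W" using cA cV cW by (simp add: assoc_mult_mat)
  finally have A: "?A = V * D * W" unfolding AV .
  have "similar_mat ?A D"
    using cV cW cD cA VW WV A by (intro similar_matI[where n = n and P = V and Q = W]) auto
  then have "char_poly ?A = char_poly D" by (rule char_poly_similar)
  also have "\<dots> = (\<Prod>a\<leftarrow>diag_mat D. [:- a, 1:])"
    by (rule char_poly_upper_triangular[OF cD]) (auto simp: D_def mat_diag_def)
  also have "diag_mat D = map (rc_eig n x) [0..<n]"
    using cD by (auto simp: diag_mat_def D_def mat_diag_def)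
  finally have cp: "char_poly ?A = (\<Prod>a\<leftarrow>map (rc_eig n x) [0..<n]. [:- a, 1:])" .
  have "proots (\<Prod>a\<leftarrow>as. [:- a, 1:]) = mset as" for as :: "real list"
  proof (induction as)
    case (Cons a as)
    have "(\<Prod>a\<leftarrow>as. [:- a, 1:]) \<noteq> (0 :: real poly)" by (auto simp: prod_list_zero_iff)
    then show ?case using Cons by (simp add: proots_mult del: mult_pCons_left)
  qed simp
  then show ?thesis unfolding cp by (simp only: mset_map)
qed

section \<open>The expected empirical spectral distribution as a law\<close>

abbreviation rc_eesd :: "'a measure \<Rightarrow> nat \<Rightarrow> (nat \<Rightarrow> 'a \<Rightarrow> real) \<Rightarrow> real measure" where
  "rc_eesd M n X \<equiv> eesd M (\<lambda>\<omega>. reverse_circulant n (\<lambda>i. X i \<omega>))"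

lemma measure_of_borel_eqI:
  fixes D :: "real measure"
  assumes "sets D = sets borel" "\<And>B. B \<in> sets borel \<Longrightarrow> f B = emeasure D B"
  shows "measure_of UNIV (sets borel) f = D"
proof -
  have "sigma_sets UNIV (sets borel) = sets (borel :: real measure)"
    using sets.sigma_sets_eq[of "borel :: real measure"] by simp
  then have "measure_of UNIV (sets borel) f = measure_of UNIV (sets borel) (emeasure D)"
    using assms(2) by (intro measure_of_eq) auto
  also have "\<dots> = measure_of (space D) (sets D) (emeasure D)"
    using assms(1) sets_eq_imp_space_eq[OF assms(1)] by simp
  also have "\<dots> = D" by (rule measure_of_of_measure)
  finally show ?thesis .
qed

text \<open>The ratio of multiset sums in the definition becomes an image measure, so that integration with respect to
the spectral distribution is available.\<close>

lemma esd_reverse_circulant: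
  assumes n: "0 < n"
  shows "esd (reverse_circulant n x) = distr (measure_pmf (pmf_of_set {..<n})) borel (rc_eig n x)"
  unfolding esd_def
proof (rule measure_of_borel_eqI)
  fix B :: "real set" assume B: "B \<in> sets borel"
  have "(\<Sum>r\<in>#proots (char_poly (reverse_circulant n x)). indicator B r) = (\<Sum>m<n. indicator B (rc_eig n x m) :: ennreal)"
    unfolding proots_reverse_circulant[OF n]
    by (simp add: image_mset.compositionality o_def mset_upt sum_unfold_sum_mset atLeast0LessThan)
  moreover have "emeasure (distr (measure_pmf (pmf_of_set {..<n})) borel (rc_eig n x)) B
      = (\<integral>\<^sup>+m. indicator B (rc_eig n x m) \<partial>measure_pmf (pmf_of_set {..<n}))"
    using B by (subst nn_integral_indicator[symmetric], simp, subst nn_integral_distr) auto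
  moreover have "\<dots> = (\<Sum>m<n. indicator B (rc_eig n x m)) / of_nat n"
    using n by (subst nn_integral_pmf_of_set) (auto simp: lessThan_empty_iff)
  moreover have "dim_row (reverse_circulant n x) = n" by (simp add: reverse_circulant_def)
  ultimately show "(\<Sum>r\<in>#proots (char_poly (reverse_circulant n x)). indicator B r) / of_nat (dim_row (reverse_circulant n x))
      = emeasure (distr (measure_pmf (pmf_of_set {..<n})) borel (rc_eig n x)) B" by simp
qed simp

lemma rc_eig_measurable:
  assumes "\<And>i. i < n \<Longrightarrow> X i \<in> borel_measurable M"
  shows "(\<lambda>\<omega>. rc_eig n (\<lambda>i. X i \<omega>) m) \<in> borel_measurable M"
proof -
  have "(\<lambda>\<omega>. dft n (\<lambda>i. X i \<omega>) m) \<in> borel_measurable M"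
    unfolding dft_def using assms by (intro borel_measurable_sum borel_measurable_times) auto
  then show ?thesis unfolding rc_eig_def by auto
qed

context
  fixes M :: "'a measure" and n :: nat and X :: "nat \<Rightarrow> 'a \<Rightarrow> real"
  assumes n: "0 < n" and M: "prob_space M" and X: "\<And>i. i < n \<Longrightarrow> X i \<in> borel_measurable M"
begin

lemma rc_eig_pair_measurable:
  "(\<lambda>(\<omega>, m). rc_eig n (\<lambda>i. X i \<omega>) m) \<in> borel_measurable (M \<Otimes>\<^sub>M measure_pmf (pmf_of_set {..<n}))"
proof -
  let ?P = "M \<Otimes>\<^sub>M measure_pmf (pmf_of_set {..<n})"
  have "(\<lambda>p. rc_eig n (\<lambda>i. X i (fst p)) (snd p)) \<in> borel_measurable ?P"
  proof (rule measurable_compose_countable)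
    show "(\<lambda>p. rc_eig n (\<lambda>i. X i (fst p)) m) \<in> borel_measurable ?P" for m
      using X by (intro rc_eig_measurable measurable_compose[OF measurable_fst]) auto
    have "snd \<in> measurable ?P (measure_pmf (pmf_of_set {..<n}))" by (rule measurable_snd)
    then show "snd \<in> measurable ?P (count_space UNIV)" by simp
  qed
  then show ?thesis by (simp add: case_prod_beta')
qed

text \<open>The explicit eigenvalues are measurable functions of the entries, so that the expectation in the definition
of the EESD is an integral over a product space and countable additivity is inherited from there.\<close>

lemma eesd_reverse_circulant:
  "rc_eesd M n X
    = distr (M \<Otimes>\<^sub>M measure_pmf (pmf_of_set {..<n})) borel (\<lambda>(\<omega>, m). rc_eig n (\<lambda>i. X i \<omega>) m)"
  unfolding eesd_def
proof (rule measure_of_borel_eqI)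
  fix B :: "real set" assume B: "B \<in> sets borel"
  let ?N = "measure_pmf (pmf_of_set {..<n})" and ?f = "\<lambda>(\<omega>, m). rc_eig n (\<lambda>i. X i \<omega>) m"
  have "emeasure (distr (M \<Otimes>\<^sub>M ?N) borel ?f) B = emeasure (M \<Otimes>\<^sub>M ?N) (?f -` B \<inter> space (M \<Otimes>\<^sub>M ?N))"
    by (rule emeasure_distr[OF rc_eig_pair_measurable B])
  also have "\<dots> = (\<integral>\<^sup>+\<omega>. \<integral>\<^sup>+m. indicator (?f -` B \<inter> space (M \<Otimes>\<^sub>M ?N)) (\<omega>, m) \<partial>?N \<partial>M)"
    by (intro measure_pmf.emeasure_pair_measure measurable_sets[OF rc_eig_pair_measurable B])
  also have "\<dots> = (\<integral>\<^sup>+\<omega>. emeasure (esd (reverse_circulant n (\<lambda>i. X i \<omega>))) B \<partial>M)"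
  proof (rule nn_integral_cong)
    fix \<omega> assume \<omega>: "\<omega> \<in> space M"
    have "emeasure (esd (reverse_circulant n (\<lambda>i. X i \<omega>))) B
        = (\<integral>\<^sup>+m. indicator B (rc_eig n (\<lambda>i. X i \<omega>) m) \<partial>?N)"
      unfolding esd_reverse_circulant[OF n]
      using B by (subst nn_integral_indicator[symmetric], simp, subst nn_integral_distr) auto
    also have "\<dots> = (\<integral>\<^sup>+m. indicator (?f -` B \<inter> space (M \<Otimes>\<^sub>M ?N)) (\<omega>, m) \<partial>?N)"
      using \<omega> by (intro nn_integral_cong) (auto simp: space_pair_measure split: split_indicator)
    finally show "(\<integral>\<^sup>+m. indicator (?f -` B \<inter> space (M \<Otimes>\<^sub>M ?N)) (\<omega>, m) \<partial>?N)
      = emeasure (esd (reverse_circulant n (\<lambda>i. X i \<omega>))) B" by simp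
  qed
  finally show "(\<integral>\<^sup>+\<omega>. emeasure (esd (reverse_circulant n (\<lambda>i. X i \<omega>))) B \<partial>M)
    = emeasure (distr (M \<Otimes>\<^sub>M ?N) borel ?f) B" by simp
qed simp

lemma real_distribution_eesd: "real_distribution (rc_eesd M n X)"
proof -
  interpret M: prob_space M by (rule M)
  interpret P: pair_prob_space M "measure_pmf (pmf_of_set {..<n})" ..
  have "prob_space (distr (M \<Otimes>\<^sub>M measure_pmf (pmf_of_set {..<n})) borel (\<lambda>(\<omega>, m). rc_eig n (\<lambda>i. X i \<omega>) m))"
    by (rule P.prob_space_distr[OF rc_eig_pair_measurable])
  then show ?thesis unfolding eesd_reverse_circulant
    by (simp add: real_distribution_def real_distribution_axioms_def)
qed

lemma eesd_integral:
  fixes f :: "real \<Rightarrow> 'b :: {banach, second_countable_topology}"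
  assumes f: "f \<in> borel_measurable borel"
    and int: "\<And>m. m < n \<Longrightarrow> integrable M (\<lambda>\<omega>. f (rc_eig n (\<lambda>i. X i \<omega>) m))"
  shows "integrable (rc_eesd M n X) f"
    and "(\<integral>x. f x \<partial>rc_eesd M n X)
      = (1 / real n) *\<^sub>R (\<Sum>m<n. \<integral>\<omega>. f (rc_eig n (\<lambda>i. X i \<omega>) m) \<partial>M)"
proof -
  let ?N = "measure_pmf (pmf_of_set {..<n})" and ?f = "\<lambda>(\<omega>, m). rc_eig n (\<lambda>i. X i \<omega>) m"
  interpret M: prob_space M by (rule M)
  interpret P: pair_prob_space M ?N ..
  have ne: "{..<n} \<noteq> {}" using n by auto
  have set: "set_pmf (pmf_of_set {..<n}) = {..<n}" using ne by simp
  have fm: "(\<lambda>p. f (?f p)) \<in> borel_measurable (M \<Otimes>\<^sub>M ?N)"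
    using f rc_eig_pair_measurable by (rule measurable_compose_rev)
  have inner: "(\<integral>m. h m \<partial>?N) = (1 / real n) *\<^sub>R (\<Sum>m<n. h m)" for h :: "nat \<Rightarrow> 'c :: {banach, second_countable_topology}"
    using ne by (subst integral_measure_pmf[of "{..<n}"]) (auto simp: scaleR_sum_right)
  have int_pair: "integrable (M \<Otimes>\<^sub>M ?N) (\<lambda>p. f (?f p))"
  proof (rule P.Fubini_integrable[OF fm])
    show "integrable M (\<lambda>\<omega>. \<integral>m. norm (f (?f (\<omega>, m))) \<partial>?N)"
      unfolding inner using int by (intro integrable_scaleR_right Bochner_Integration.integrable_sum) auto
    show "AE \<omega> in M. integrable ?N (\<lambda>m. f (?f (\<omega>, m)))"
      by (intro AE_I2 integrable_measure_pmf_finite) (simp add: set)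
  qed
  show "integrable (rc_eesd M n X) f"
    unfolding eesd_reverse_circulant
    using int_pair by (subst integrable_distr_eq[OF rc_eig_pair_measurable f])
  have "(\<integral>x. f x \<partial>rc_eesd M n X) = (\<integral>p. f (?f p) \<partial>(M \<Otimes>\<^sub>M ?N))"
    unfolding eesd_reverse_circulant by (rule integral_distr[OF rc_eig_pair_measurable f])
  also have "\<dots> = (\<integral>\<omega>. \<integral>m. f (?f (\<omega>, m)) \<partial>?N \<partial>M)"
    using P.integral_fst'[OF int_pair] by simp
  also have "\<dots> = (1 / real n) *\<^sub>R (\<Sum>m<n. \<integral>\<omega>. f (rc_eig n (\<lambda>i. X i \<omega>) m) \<partial>M)"
    unfolding inner using int by (simp add: Bochner_Integration.integral_sum)
  finally show "(\<integral>x. f x \<partial>rc_eesd M n X)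
      = (1 / real n) *\<^sub>R (\<Sum>m<n. \<integral>\<omega>. f (rc_eig n (\<lambda>i. X i \<omega>) m) \<partial>M)" .
qed

end

section \<open>Index tuples sorted by their level sets\<close>

text \<open>The kernel of the tuple \<open>s\<close>, as a partition of the positions \<open>1, \<dots>, k\<close>.\<close>

definition level_sets :: "nat \<Rightarrow> (nat \<Rightarrow> 'b) \<Rightarrow> nat set set" where
  "level_sets k s = (\<lambda>v. {j \<in> {1..k}. s j = v}) ` s ` {1..k}"

text \<open>The tuple that takes the value \<open>u V\<close> on each block \<open>V\<close>; for injective \<open>u\<close> this inverts the
passage to level sets (\<open>bij_betw_block_lift\<close>).\<close>

definition block_lift :: "nat \<Rightarrow> nat set set \<Rightarrow> (nat set \<Rightarrow> 'b) \<Rightarrow> nat \<Rightarrow> 'b" where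
  "block_lift k \<sigma> u = (\<lambda>j\<in>{1..k}. u (THE V. V \<in> \<sigma> \<and> j \<in> V))"

lemma partitionsD:
  assumes "\<sigma> \<in> partitions k"
  shows "\<And>j. j \<in> {1..k} \<longleftrightarrow> (\<exists>V\<in>\<sigma>. j \<in> V)" "\<And>V V' j. V \<in> \<sigma> \<Longrightarrow> V' \<in> \<sigma> \<Longrightarrow> j \<in> V \<Longrightarrow> j \<in> V' \<Longrightarrow> V = V'"
    "\<And>V. V \<in> \<sigma> \<Longrightarrow> V \<subseteq> {1..k}" "\<And>V. V \<in> \<sigma> \<Longrightarrow> V \<noteq> {}" "\<And>V. V \<in> \<sigma> \<Longrightarrow> finite V" "finite \<sigma>"
proof -
  have p: "partition_on {1..k} \<sigma>" using assms by (simp add: partitions_def)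
  then have U: "\<Union>\<sigma> = {1..k}" by (auto simp: partition_on_def)
  show "j \<in> {1..k} \<longleftrightarrow> (\<exists>V\<in>\<sigma>. j \<in> V)" for j unfolding U[symmetric] by blast
  show "V = V'" if "V \<in> \<sigma>" "V' \<in> \<sigma>" "j \<in> V" "j \<in> V'" for V V' j
    using p that by (auto simp: partition_on_def disjoint_def)
  show sub: "V \<subseteq> {1..k}" if "V \<in> \<sigma>" for V using U that by blast
  show "V \<noteq> {}" if "V \<in> \<sigma>" for V using p that by (auto simp: partition_on_def)
  show "finite V" if "V \<in> \<sigma>" for V using sub[OF that] by (rule finite_subset) simp
  show "finite \<sigma>" by (rule finite_elements[OF _ p]) simp
qed

lemma finite_partitions: "finite (partitions k)"
  unfolding partitions_def by (rule finitely_many_partition_on) simp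

lemma card_partition_le:
  assumes "\<sigma> \<in> partitions k"
  shows "card \<sigma> \<le> k"
proof -
  have "(\<Sum>V\<in>\<sigma>. 1) \<le> (\<Sum>V\<in>\<sigma>. card V)"
    using partitionsD[OF assms] by (intro sum_mono) (simp add: Suc_le_eq card_gt_0_iff)
  also have "\<dots> = card {1..k}"
    using assms partitionsD(5)[OF assms] by (subst product_partition[of "{1..k}" \<sigma>]) (auto simp: partitions_def)
  finally show ?thesis by simp
qed

lemma block_lift_eq:
  assumes "\<sigma> \<in> partitions k" "V \<in> \<sigma>" "j \<in> V"
  shows "block_lift k \<sigma> u j = u V"
proof -
  have "(THE V. V \<in> \<sigma> \<and> j \<in> V) = V"
  proof (rule the_equality)
    fix W assume W: "W \<in> \<sigma> \<and> j \<in> W"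
    show "W = V" by (rule partitionsD(2)[OF assms(1) _ assms(2) _ assms(3)]) (use W in auto)
  qed (use assms in simp)
  moreover have "j \<in> {1..k}" using partitionsD(3)[OF assms(1,2)] assms(3) by blast
  ultimately show ?thesis by (simp add: block_lift_def)
qed

lemma block_lift_image:
  assumes "\<sigma> \<in> partitions k"
  shows "block_lift k \<sigma> u ` {1..k} = u ` \<sigma>"
proof (intro subset_antisym subsetI)
  fix v assume "v \<in> block_lift k \<sigma> u ` {1..k}"
  then obtain j where j: "j \<in> {1..k}" "v = block_lift k \<sigma> u j" by auto
  then obtain V where "V \<in> \<sigma>" "j \<in> V" using partitionsD(1)[OF assms] by blast
  then show "v \<in> u ` \<sigma>" using block_lift_eq[OF assms, of V j u] j by auto
next
  fix v assume "v \<in> u ` \<sigma>"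
  then obtain V where V: "V \<in> \<sigma>" "v = u V" by auto
  then obtain j where j: "j \<in> V" using partitionsD(4)[OF assms] by blast
  then have "j \<in> {1..k}" using partitionsD(1)[OF assms] V by blast
  then show "v \<in> block_lift k \<sigma> u ` {1..k}" using block_lift_eq[OF assms V(1) j, of u] V by (metis imageI)
qed

lemma block_lift_fibre:
  assumes "\<sigma> \<in> partitions k" "inj_on u \<sigma>" "V \<in> \<sigma>"
  shows "{j \<in> {1..k}. block_lift k \<sigma> u j = u V} = V"
proof (intro subset_antisym subsetI)
  fix j assume "j \<in> {j \<in> {1..k}. block_lift k \<sigma> u j = u V}"
  then have j: "j \<in> {1..k}" "block_lift k \<sigma> u j = u V" by auto
  then obtain V' where V': "V' \<in> \<sigma>" "j \<in> V'" using partitionsD(1)[OF assms(1)] by blast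
  then have "u V' = u V" using block_lift_eq[OF assms(1) V'(1), of j u] j by simp
  then have "V' = V" using inj_onD[OF assms(2), of V' V] V' assms(3) by simp
  then show "j \<in> V" using V' by simp
next
  fix j assume "j \<in> V"
  then show "j \<in> {j \<in> {1..k}. block_lift k \<sigma> u j = u V}"
    using block_lift_eq[OF assms(1,3)] partitionsD(3)[OF assms(1,3)] by auto
qed

abbreviation level_product :: "(nat \<Rightarrow> nat \<Rightarrow> real) \<Rightarrow> nat \<Rightarrow> (nat \<Rightarrow> nat) \<Rightarrow> real" where
  "level_product \<phi> k s \<equiv> \<Prod>v\<in>s ` {1..k}. \<phi> v (card {j \<in> {1..k}. s j = v})"

abbreviation alternating_sum :: "nat \<Rightarrow> (nat \<Rightarrow> nat) \<Rightarrow> int" where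
  "alternating_sum k s \<equiv> \<Sum>j\<in>{1..k}. (- 1) ^ j * int (s j)"

lemma level_sets_partition: "level_sets k s \<in> partitions k"
  unfolding partitions_def mem_Collect_eq level_sets_def
  by (rule partition_onI) (auto simp: disjnt_def)

lemma bij_betw_block_lift:
  assumes \<sigma>: "\<sigma> \<in> partitions k"
  shows "bij_betw (block_lift k \<sigma>) {u \<in> \<sigma> \<rightarrow>\<^sub>E A. inj_on u \<sigma>} {s \<in> {1..k} \<rightarrow>\<^sub>E A. level_sets k s = \<sigma>}"
  unfolding bij_betw_def
proof
  show "inj_on (block_lift k \<sigma>) {u \<in> \<sigma> \<rightarrow>\<^sub>E A. inj_on u \<sigma>}"
  proof (rule inj_onI)
    fix u u' assume u: "u \<in> {u \<in> \<sigma> \<rightarrow>\<^sub>E A. inj_on u \<sigma>}" "u' \<in> {u \<in> \<sigma> \<rightarrow>\<^sub>E A. inj_on u \<sigma>}"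
      and eq: "block_lift k \<sigma> u = block_lift k \<sigma> u'"
    have "u V = u' V" if V: "V \<in> \<sigma>" for V
    proof -
      obtain j where "j \<in> V" using partitionsD(4)[OF \<sigma> V] by blast
      then show ?thesis using block_lift_eq[OF \<sigma> V] eq by metis
    qed
    then show "u = u'" using u by (intro PiE_ext[of u \<sigma> "\<lambda>_. A" u']) auto
  qed
  show "block_lift k \<sigma> ` {u \<in> \<sigma> \<rightarrow>\<^sub>E A. inj_on u \<sigma>} = {s \<in> {1..k} \<rightarrow>\<^sub>E A. level_sets k s = \<sigma>}"
  proof (intro subset_antisym subsetI)
    fix s assume "s \<in> block_lift k \<sigma> ` {u \<in> \<sigma> \<rightarrow>\<^sub>E A. inj_on u \<sigma>}"
    then obtain u where u: "u \<in> \<sigma> \<rightarrow>\<^sub>E A" "inj_on u \<sigma>" "s = block_lift k \<sigma> u" by auto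
    have "s j \<in> A" if "j \<in> {1..k}" for j
    proof -
      have "s j \<in> u ` \<sigma>" using that u(3) block_lift_image[OF \<sigma>, of u] by blast
      then show ?thesis using u(1) by auto
    qed
    moreover have "s \<in> extensional {1..k}" using u(3) by (simp add: block_lift_def)
    moreover have "level_sets k s = \<sigma>"
    proof -
      have "level_sets k s = (\<lambda>V. {j \<in> {1..k}. s j = u V}) ` \<sigma>"
        unfolding level_sets_def u(3) block_lift_image[OF \<sigma>] image_image ..
      also have "\<dots> = (\<lambda>V. V) ` \<sigma>" using block_lift_fibre[OF \<sigma> u(2)] u(3) by (intro image_cong) auto
      finally show ?thesis by simp
    qed
    ultimately show "s \<in> {s \<in> {1..k} \<rightarrow>\<^sub>E A. level_sets k s = \<sigma>}" by (auto simp: PiE_def)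
  next
    fix s assume "s \<in> {s \<in> {1..k} \<rightarrow>\<^sub>E A. level_sets k s = \<sigma>}"
    then have s: "s \<in> {1..k} \<rightarrow>\<^sub>E A" "level_sets k s = \<sigma>" by auto
    define u where "u = (\<lambda>V\<in>\<sigma>. s (SOME j. j \<in> V))"
    have uV: "u V = s j" if "V \<in> \<sigma>" "j \<in> V" for V j
    proof -
      obtain v where v: "V = {j \<in> {1..k}. s j = v}" using \<open>V \<in> \<sigma>\<close> s(2) by (auto simp: level_sets_def)
      have "(SOME j. j \<in> V) \<in> V" using that(2) by (rule someI)
      then show ?thesis using that v by (simp add: u_def)
    qed
    have "inj_on u \<sigma>"
    proof (rule inj_onI)
      fix V V' assume VV: "V \<in> \<sigma>" "V' \<in> \<sigma>" "u V = u V'"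
      obtain v where v: "V = {j \<in> {1..k}. s j = v}" using VV(1) s(2) by (auto simp: level_sets_def)
      obtain v' where v': "V' = {j \<in> {1..k}. s j = v'}" using VV(2) s(2) by (auto simp: level_sets_def)
      obtain j where j: "j \<in> V" using partitionsD(4)[OF \<sigma> VV(1)] by blast
      obtain j' where j': "j' \<in> V'" using partitionsD(4)[OF \<sigma> VV(2)] by blast
      have "v = v'" using uV[OF VV(1) j] uV[OF VV(2) j'] VV(3) v v' j j' by auto
      then show "V = V'" using v v' by simp
    qed
    moreover have "u \<in> \<sigma> \<rightarrow>\<^sub>E A"
    proof (rule PiE_I)
      fix V assume V: "V \<in> \<sigma>"
      obtain j where j: "j \<in> V" using partitionsD(4)[OF \<sigma> V] by blast
      have "j \<in> {1..k}" using partitionsD(3)[OF \<sigma> V] j by blast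
      then show "u V \<in> A" using uV[OF V j] s(1) by auto
    qed (simp add: u_def)
    moreover have "s = block_lift k \<sigma> u"
    proof
      fix j
      show "s j = block_lift k \<sigma> u j"
      proof (cases "j \<in> {1..k}")
        case True
        then obtain V where "V \<in> \<sigma>" "j \<in> V" using partitionsD(1)[OF \<sigma>] by blast
        then show ?thesis using block_lift_eq[OF \<sigma>, of V j u] uV[of V j] by simp
      next
        case False
        then show ?thesis using PiE_arb[OF s(1) False] by (simp only: block_lift_def restrict_def if_False)
      qed
    qed
    ultimately show "s \<in> block_lift k \<sigma> ` {u \<in> \<sigma> \<rightarrow>\<^sub>E A. inj_on u \<sigma>}" by auto
  qed
qed

lemma sum_over_level_sets:
  assumes "finite A"
  shows "(\<Sum>s\<in>{1..k} \<rightarrow>\<^sub>E A. f s) = (\<Sum>\<sigma>\<in>partitions k. \<Sum>u | u \<in> \<sigma> \<rightarrow>\<^sub>E A \<and> inj_on u \<sigma>. f (block_lift k \<sigma> u))"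
proof -
  have "(\<Sum>s\<in>{1..k} \<rightarrow>\<^sub>E A. f s) = (\<Sum>\<sigma>\<in>partitions k. \<Sum>s | s \<in> {1..k} \<rightarrow>\<^sub>E A \<and> level_sets k s = \<sigma>. f s)"
    using assms level_sets_partition by (intro sum.group[symmetric] finite_PiE finite_partitions) auto
  also have "\<dots> = (\<Sum>\<sigma>\<in>partitions k. \<Sum>u | u \<in> \<sigma> \<rightarrow>\<^sub>E A \<and> inj_on u \<sigma>. f (block_lift k \<sigma> u))"
    by (intro sum.cong refl sum.reindex_bij_betw[symmetric] bij_betw_block_lift)
  finally show ?thesis .
qed

lemma prod_block_lift:
  assumes "\<sigma> \<in> partitions k" "inj_on u \<sigma>"
  shows "(\<Prod>v\<in>block_lift k \<sigma> u ` {1..k}. \<phi> v (card {j \<in> {1..k}. block_lift k \<sigma> u j = v})) = (\<Prod>V\<in>\<sigma>. \<phi> (u V) (card V))"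
  unfolding block_lift_image[OF assms(1)]
  by (subst prod.reindex[OF assms(2)], rule prod.cong[OF refl]) (simp only: o_def block_lift_fibre[OF assms])

lemma sum_block_lift:
  fixes \<epsilon> :: "nat \<Rightarrow> int"
  assumes "\<sigma> \<in> partitions k"
  shows "(\<Sum>j\<in>{1..k}. \<epsilon> j * w (block_lift k \<sigma> u j)) = (\<Sum>V\<in>\<sigma>. (\<Sum>j\<in>V. \<epsilon> j) * w (u V))"
proof -
  have "(\<Sum>j\<in>{1..k}. \<epsilon> j * w (block_lift k \<sigma> u j)) = (\<Sum>V\<in>\<sigma>. \<Sum>j\<in>V. \<epsilon> j * w (block_lift k \<sigma> u j))"
    using assms by (intro sum.partition) (auto simp: partitions_def)
  also have "\<dots> = (\<Sum>V\<in>\<sigma>. (\<Sum>j\<in>V. \<epsilon> j) * w (u V))"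
    by (intro sum.cong refl) (simp add: sum_distrib_right block_lift_eq[OF assms])
  finally show ?thesis .
qed

text \<open>All values except the one at \<open>V\<^sub>0\<close> are chosen freely; a condition that then leaves only boundedly many
choices for the last value costs one power of the number of available values.\<close>

lemma card_PiE_constrained:
  assumes S: "finite S" "V\<^sub>0 \<in> S" and A: "finite A"
    and c: "\<And>u. u \<in> (S - {V\<^sub>0}) \<rightarrow>\<^sub>E A \<Longrightarrow> card {v \<in> A. Q (u(V\<^sub>0 := v))} \<le> c"
  shows "card {u \<in> S \<rightarrow>\<^sub>E A. Q u} \<le> c * card A ^ (card S - 1)"
proof -
  let ?R = "(S - {V\<^sub>0}) \<rightarrow>\<^sub>E A"
  have fR: "finite ?R" using S A by (intro finite_PiE) auto
  have SS: "insert V\<^sub>0 (S - {V\<^sub>0}) = S" using S by auto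
  have "{u \<in> S \<rightarrow>\<^sub>E A. Q u} \<subseteq> (\<lambda>(u, v). u(V\<^sub>0 := v)) ` (SIGMA u:?R. {v \<in> A. Q (u(V\<^sub>0 := v))})"
  proof
    fix w assume w: "w \<in> {u \<in> S \<rightarrow>\<^sub>E A. Q u}"
    then have "w \<in> insert V\<^sub>0 (S - {V\<^sub>0}) \<rightarrow>\<^sub>E A" unfolding SS by simp
    then obtain v u where "v \<in> A" "u \<in> ?R" "w = u(V\<^sub>0 := v)"
      unfolding PiE_insert_eq by auto
    then show "w \<in> (\<lambda>(u, v). u(V\<^sub>0 := v)) ` (SIGMA u:?R. {v \<in> A. Q (u(V\<^sub>0 := v))})"
      using w by (intro image_eqI[of _ _ "(u, v)"]) auto
  qed
  then have "card {u \<in> S \<rightarrow>\<^sub>E A. Q u} \<le> card (SIGMA u:?R. {v \<in> A. Q (u(V\<^sub>0 := v))})"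
    using fR A by (intro surj_card_le) auto
  also have "\<dots> = (\<Sum>u\<in>?R. card {v \<in> A. Q (u(V\<^sub>0 := v))})"
    using fR A by (intro card_SigmaI) auto
  also have "\<dots> \<le> (\<Sum>u\<in>?R. c)" using c by (intro sum_mono) auto
  also have "\<dots> = c * card A ^ (card S - 1)"
    using S by (simp add: card_funcsetE)
  finally show ?thesis .
qed

text \<open>As \<open>v\<close> runs through a full period, \<open>d * v + e\<close> stays in an interval of length less than
\<open>\<bar>d\<bar> * n\<close>, which contains at most \<open>\<bar>d\<bar> + 1\<close> multiples of \<open>n\<close>.\<close>

lemma card_linear_congruence_le:
  fixes d e :: int
  assumes n: "0 < n" and d: "d \<noteq> 0"
  shows "card {v \<in> {..<n}. int n dvd d * int v + e} \<le> nat \<bar>d\<bar> + 1"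
proof -
  have pos: "card {v \<in> {..<n}. int n dvd d * int v + e} \<le> nat d + 1" if d: "0 < d" for d e :: int
  proof -
    let ?S = "{v \<in> {..<n}. int n dvd d * int v + e}"
    have "inj_on (\<lambda>v. (d * int v + e) div int n) ?S"
    proof (rule inj_onI)
      fix v w assume vw: "v \<in> ?S" "w \<in> ?S" and eq: "(d * int v + e) div int n = (d * int w + e) div int n"
      have "d * int v + e = d * int w + e" using vw eq dvd_div_mult_self by (metis (no_types, lifting) mem_Collect_eq)
      then show "v = w" using d by simp
    qed
    moreover have "(\<lambda>v. (d * int v + e) div int n) ` ?S \<subseteq> {e div int n .. e div int n + d}"
    proof clarify
      fix v assume "v < n"
      then have "e \<le> d * int v + e" "d * int v + e \<le> e + d * int n"
        using d by (auto intro: mult_left_mono)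
      then have "e div int n \<le> (d * int v + e) div int n" "(d * int v + e) div int n \<le> (e + d * int n) div int n"
        using n by (intro zdiv_mono1; simp)+
      then show "(d * int v + e) div int n \<in> {e div int n .. e div int n + d}" using n by simp
    qed
    ultimately have "card ?S \<le> card {e div int n .. e div int n + d}"
      by (intro card_inj_on_le) auto
    then show ?thesis using d by simp
  qed
  show ?thesis
  proof (cases "0 < d")
    case False
    have "int n dvd d * int v + e \<longleftrightarrow> int n dvd (- d) * int v + (- e)" for v
      using dvd_minus_iff[of "int n" "d * int v + e"] by simp
    then show ?thesis using pos[of "- d" "- e"] False d by simp
  qed (use pos in simp)
qed

section \<open>Size of the sums over index tuples\<close>

context
  fixes n k :: nat and \<phi> :: "nat \<Rightarrow> nat \<Rightarrow> real" and B :: real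
  assumes n: "0 < n" and k: "0 < k" and B: "1 \<le> B"
    and \<phi>: "\<And>v c. v < n \<Longrightarrow> 1 \<le> c \<Longrightarrow> c \<le> k \<Longrightarrow> \<bar>\<phi> v c\<bar> \<le> B * real n powr (- (1 - 1 / (2 * real k)))"
begin

text \<open>The exponent in the assumption on \<open>\<phi>\<close> falls short of \<open>- 1\<close> by so little that the loss over at most \<open>k\<close>
blocks is no more than \<open>sqrt n\<close>. Each constraint on the block values gains a factor \<open>n\<close>, which outweighs it.\<close>

lemma block_product_bound:
  assumes \<sigma>: "\<sigma> \<in> partitions k" and u: "u \<in> \<sigma> \<rightarrow>\<^sub>E {..<n}"
  shows "\<bar>\<Prod>V\<in>\<sigma>. \<phi> (u V) (card V)\<bar> \<le> B ^ k * sqrt (real n) / real n ^ card \<sigma>"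
proof -
  define a where "a = 1 - 1 / (2 * real k)"
  have bk: "card \<sigma> \<le> k" by (rule card_partition_le[OF \<sigma>])
  have "\<bar>\<Prod>V\<in>\<sigma>. \<phi> (u V) (card V)\<bar> = (\<Prod>V\<in>\<sigma>. \<bar>\<phi> (u V) (card V)\<bar>)" by (rule abs_prod)
  also have "\<dots> \<le> (\<Prod>V\<in>\<sigma>. B * real n powr (- a))"
  proof (intro prod_mono conjI)
    fix V assume V: "V \<in> \<sigma>"
    have "card V \<le> card {1..k}" using partitionsD(3)[OF \<sigma> V] by (intro card_mono) auto
    moreover have "1 \<le> card V" using partitionsD(4,5)[OF \<sigma> V] by (simp add: Suc_le_eq card_gt_0_iff)
    ultimately show "\<bar>\<phi> (u V) (card V)\<bar> \<le> B * real n powr (- a)"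
      unfolding a_def using PiE_mem[OF u V] by (intro \<phi>) auto
  qed auto
  also have "\<dots> = B ^ card \<sigma> * real n powr (- a * card \<sigma>)"
    using n by (simp add: power_mult_distrib powr_realpow[symmetric] powr_powr)
  also have "\<dots> \<le> B ^ k * real n powr (1 / 2 - card \<sigma>)"
  proof (intro mult_mono)
    show "B ^ card \<sigma> \<le> B ^ k" using B bk by (intro power_increasing)
    have "real (card \<sigma>) / (2 * real k) \<le> 1 / 2" using k bk by (simp add: field_simps)
    then have "- a * card \<sigma> \<le> 1 / 2 - card \<sigma>" unfolding a_def by (simp add: algebra_simps)
    then show "real n powr (- a * card \<sigma>) \<le> real n powr (1 / 2 - card \<sigma>)" using n by (intro powr_mono) auto
  qed (use B in auto)
  also have "\<dots> = B ^ k * sqrt (real n) / real n ^ card \<sigma>"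
    using n by (simp add: powr_diff powr_half_sqrt powr_realpow)
  finally show ?thesis .
qed

lemma block_sum_bound:
  assumes \<sigma>: "\<sigma> \<in> partitions k" and P: "P \<subseteq> \<sigma> \<rightarrow>\<^sub>E {..<n}"
  shows "(\<Sum>u\<in>P. \<bar>\<Prod>V\<in>\<sigma>. \<phi> (u V) (card V)\<bar>) \<le> real (card P) * (B ^ k * sqrt (real n) / real n ^ card \<sigma>)"
  using block_product_bound[OF \<sigma>] P by (intro sum_bounded_above) auto

lemma block_sum_small:
  assumes \<sigma>: "\<sigma> \<in> partitions k" and P: "P \<subseteq> \<sigma> \<rightarrow>\<^sub>E {..<n}" and c: "card P \<le> c * n ^ (card \<sigma> - 1)"
  shows "(\<Sum>u\<in>P. \<bar>\<Prod>V\<in>\<sigma>. \<phi> (u V) (card V)\<bar>) \<le> real c * B ^ k / sqrt (real n)"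
proof -
  have "\<sigma> \<noteq> {}" using partitionsD(1)[OF \<sigma>, of 1] k by auto
  then have b: "0 < card \<sigma>" using partitionsD(6)[OF \<sigma>] by (simp add: card_gt_0_iff)
  have "real (card P) \<le> real (c * n ^ (card \<sigma> - 1))" using c by (simp only: of_nat_le_iff)
  then have "real (card P) * (B ^ k * sqrt (real n) / real n ^ card \<sigma>)
      \<le> real (c * n ^ (card \<sigma> - 1)) * (B ^ k * sqrt (real n) / real n ^ card \<sigma>)"
    using B by (intro mult_right_mono) auto
  also have "\<dots> = real c * B ^ k * (sqrt (real n) / real n)"
  proof -
    have "real n ^ card \<sigma> = real n * real n ^ (card \<sigma> - 1)" using b by (simp add: power_eq_if)
    then show ?thesis using n by simp
  qed
  also have "sqrt (real n) / real n = 1 / sqrt (real n)"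
  proof -
    have "sqrt (real n) * sqrt (real n) = real n" by simp
    then show ?thesis using n by (simp add: divide_simps)
  qed
  finally show ?thesis using block_sum_bound[OF \<sigma> P] by simp
qed

text \<open>With no constraint on the block values, a partition into \<open>b\<close> blocks accounts for at most \<open>n ^ b\<close> tuples, and the
loss \<open>sqrt n\<close> of \<open>block_product_bound\<close> remains.\<close>

lemma tuple_sum_bound:
  "(\<Sum>s\<in>{1..k} \<rightarrow>\<^sub>E {..<n}. \<bar>level_product \<phi> k s\<bar>)
    \<le> real (card (partitions k)) * (B ^ k * sqrt (real n))"
proof -
  have "(\<Sum>s\<in>{1..k} \<rightarrow>\<^sub>E {..<n}. \<bar>level_product \<phi> k s\<bar>)
    = (\<Sum>\<sigma>\<in>partitions k. \<Sum>u | u \<in> \<sigma> \<rightarrow>\<^sub>E {..<n} \<and> inj_on u \<sigma>. \<bar>\<Prod>V\<in>\<sigma>. \<phi> (u V) (card V)\<bar>)"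
    by (subst sum_over_level_sets, simp, intro sum.cong refl) (simp only: prod_block_lift mem_Collect_eq)
  also have "\<dots> \<le> (\<Sum>\<sigma>\<in>partitions k. B ^ k * sqrt (real n))"
  proof (rule sum_mono)
    fix \<sigma> assume \<sigma>: "\<sigma> \<in> partitions k"
    let ?P = "{u. u \<in> \<sigma> \<rightarrow>\<^sub>E {..<n} \<and> inj_on u \<sigma>}"
    have "card ?P \<le> card (\<sigma> \<rightarrow>\<^sub>E {..<n})" using partitionsD(6)[OF \<sigma>] by (intro card_mono finite_PiE) auto
    then have "card ?P \<le> n ^ card \<sigma>" using partitionsD(6)[OF \<sigma>] by (simp add: card_funcsetE)
    then have "real (card ?P) \<le> real n ^ card \<sigma>" unfolding of_nat_power[symmetric] of_nat_le_iff .
    then have "real (card ?P) * (B ^ k * sqrt (real n) / real n ^ card \<sigma>)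
        \<le> real n ^ card \<sigma> * (B ^ k * sqrt (real n) / real n ^ card \<sigma>)"
      using B by (intro mult_right_mono) auto
    also have "\<dots> = B ^ k * sqrt (real n)" using n by simp
    finally show "(\<Sum>u\<in>?P. \<bar>\<Prod>V\<in>\<sigma>. \<phi> (u V) (card V)\<bar>) \<le> B ^ k * sqrt (real n)"
      using block_sum_bound[OF \<sigma>, of ?P] by auto
  qed
  finally show ?thesis by simp
qed

lemma card_not_inj_le:
  assumes \<sigma>: "\<sigma> \<in> partitions k"
  shows "card {u \<in> \<sigma> \<rightarrow>\<^sub>E {..<n}. \<not> inj_on u \<sigma>} \<le> k\<^sup>2 * n ^ (card \<sigma> - 1)"
proof -
  have f\<sigma>: "finite \<sigma>" by (rule partitionsD(6)[OF \<sigma>])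
  have fP: "finite (\<sigma> \<rightarrow>\<^sub>E {..<n})" using f\<sigma> by (intro finite_PiE) auto
  let ?D = "{(V, V'). V \<in> \<sigma> \<and> V' \<in> \<sigma> \<and> V \<noteq> V'}"
  have D: "?D \<subseteq> \<sigma> \<times> \<sigma>" by auto
  have fD: "finite ?D" using finite_subset[OF D] f\<sigma> by simp
  have "card ?D \<le> card \<sigma> * card \<sigma>" using card_mono[OF _ D] f\<sigma> by (simp add: card_cartesian_product)
  also have "\<dots> \<le> k\<^sup>2" using card_partition_le[OF \<sigma>] by (simp add: power2_eq_square mult_le_mono)
  finally have cD: "card ?D \<le> k\<^sup>2" .
  have "{u \<in> \<sigma> \<rightarrow>\<^sub>E {..<n}. \<not> inj_on u \<sigma>} \<subseteq> (\<Union>p\<in>?D. {u \<in> \<sigma> \<rightarrow>\<^sub>E {..<n}. u (fst p) = u (snd p)})"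
    by (auto simp: inj_on_def)
  then have "card {u \<in> \<sigma> \<rightarrow>\<^sub>E {..<n}. \<not> inj_on u \<sigma>}
      \<le> card (\<Union>p\<in>?D. {u \<in> \<sigma> \<rightarrow>\<^sub>E {..<n}. u (fst p) = u (snd p)})"
    using fD by (intro card_mono finite_UN_I) (auto intro!: finite_subset[OF _ fP])
  also have "\<dots> \<le> (\<Sum>p\<in>?D. card {u \<in> \<sigma> \<rightarrow>\<^sub>E {..<n}. u (fst p) = u (snd p)})"
    using fD by (rule card_UN_le)
  also have "\<dots> \<le> (\<Sum>p\<in>?D. n ^ (card \<sigma> - 1))"
  proof (rule sum_mono, clarify)
    fix V V' assume V: "V \<in> \<sigma>" "V' \<in> \<sigma>" "V \<noteq> V'"
    have "card {u \<in> \<sigma> \<rightarrow>\<^sub>E {..<n}. u V = u V'} \<le> 1 * card {..<n} ^ (card \<sigma> - 1)"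
    proof (rule card_PiE_constrained[OF f\<sigma> V(1)])
      fix u :: "nat set \<Rightarrow> nat"
      have "{v \<in> {..<n}. (u(V := v)) V = (u(V := v)) V'} \<subseteq> {u V'}" using V by auto
      then show "card {v \<in> {..<n}. (u(V := v)) V = (u(V := v)) V'} \<le> 1"
        using card_mono[of "{u V'}"] by fastforce
    qed simp
    then show "card {u \<in> \<sigma> \<rightarrow>\<^sub>E {..<n}. u (fst (V, V')) = u (snd (V, V'))} \<le> n ^ (card \<sigma> - 1)" by simp
  qed
  also have "\<dots> = card ?D * n ^ (card \<sigma> - 1)" by simp
  also have "\<dots> \<le> k\<^sup>2 * n ^ (card \<sigma> - 1)" using cD by (rule mult_right_mono) simp
  finally show ?thesis .
qed

text \<open>A block \<open>V\<close> with nonzero coefficient supplies the value that the congruence determines up to \<open>k + 1\<close> choices.\<close>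

lemma card_congruence_le:
  fixes d :: "nat set \<Rightarrow> int"
  assumes \<sigma>: "\<sigma> \<in> partitions k" and V: "V \<in> \<sigma>" and d: "d V \<noteq> 0" "\<bar>d V\<bar> \<le> int k"
  shows "card {u \<in> \<sigma> \<rightarrow>\<^sub>E {..<n}. int n dvd (\<Sum>V\<in>\<sigma>. d V * int (u V))} \<le> (k + 1) * n ^ (card \<sigma> - 1)"
proof -
  have f\<sigma>: "finite \<sigma>" by (rule partitionsD(6)[OF \<sigma>])
  have "card {u \<in> \<sigma> \<rightarrow>\<^sub>E {..<n}. int n dvd (\<Sum>V\<in>\<sigma>. d V * int (u V))} \<le> (k + 1) * card {..<n} ^ (card \<sigma> - 1)"
  proof (rule card_PiE_constrained[OF f\<sigma> V])
    fix u :: "nat set \<Rightarrow> nat"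
    let ?e = "\<Sum>W\<in>\<sigma> - {V}. d W * int (u W)"
    have "(\<Sum>W\<in>\<sigma>. d W * int ((u(V := v)) W)) = d V * int v + ?e" for v
      using f\<sigma> V by (simp add: sum.remove[of \<sigma> V])
    then have "card {v \<in> {..<n}. int n dvd (\<Sum>W\<in>\<sigma>. d W * int ((u(V := v)) W))} \<le> nat \<bar>d V\<bar> + 1"
      using card_linear_congruence_le[OF n d(1), of ?e] by simp
    also have "\<dots> \<le> k + 1" using d(2) by simp
    finally show "card {v \<in> {..<n}. int n dvd (\<Sum>W\<in>\<sigma>. d W * int ((u(V := v)) W))} \<le> k + 1" .
  qed simp
  then show ?thesis by simp
qed

lemma alternating_card:
  assumes "finite V"
  shows "(\<Sum>j\<in>V. (- 1) ^ j :: int) = int (card {v \<in> V. even v}) - int (card {v \<in> V. odd v})"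
proof -
  have "(\<Sum>j\<in>V. (- 1) ^ j :: int) = (\<Sum>j\<in>V. (if even j then 1 else 0) - (if odd j then 1 else 0))"
    by (intro sum.cong) auto
  then show ?thesis using assms
    by (simp add: sum_subtractf sum.If_cases Int_def)
qed

text \<open>The alternating sum of the tuple is \<open>\<Sum>V. d V * u V\<close>, where \<open>d V\<close> is the number of even minus the number
of odd elements of \<open>V\<close>. If all \<open>d V\<close> vanish, then the congruence is void, and dropping injectivity of
\<open>u\<close> costs little and lets the sum factorise. Otherwise the congruence makes the whole sum small.\<close>

lemma constrained_tuple_sum:
  "\<bar>(\<Sum>s\<in>{1..k} \<rightarrow>\<^sub>E {..<n}. if int n dvd alternating_sum k s
        then level_product \<phi> k s else 0)
      - (\<Sum>\<sigma>\<in>sym_partitions k. \<Prod>V\<in>\<sigma>. \<Sum>v<n. \<phi> v (card V))\<bar>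
    \<le> real (card (partitions k)) * (real (k\<^sup>2 + k + 1) * B ^ k / sqrt (real n))"
proof -
  define d where "d V = (\<Sum>j\<in>V. (- 1) ^ j :: int)" for V :: "nat set"
  define T where "T \<sigma> = (\<Sum>u | u \<in> \<sigma> \<rightarrow>\<^sub>E {..<n} \<and> inj_on u \<sigma>.
      if int n dvd (\<Sum>V\<in>\<sigma>. d V * int (u V)) then \<Prod>V\<in>\<sigma>. \<phi> (u V) (card V) else 0)" for \<sigma>
  define S where "S \<sigma> = (if \<sigma> \<in> sym_partitions k then \<Prod>V\<in>\<sigma>. \<Sum>v<n. \<phi> v (card V) else 0)" for \<sigma>
  have "(\<Sum>s\<in>{1..k} \<rightarrow>\<^sub>E {..<n}. if int n dvd alternating_sum k s
        then level_product \<phi> k s else 0) = (\<Sum>\<sigma>\<in>partitions k. T \<sigma>)"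
    unfolding T_def d_def
    by (subst sum_over_level_sets, simp, intro sum.cong refl)
       (simp only: prod_block_lift sum_block_lift[where w = int] mem_Collect_eq)
  moreover have "(\<Sum>\<sigma>\<in>sym_partitions k. \<Prod>V\<in>\<sigma>. \<Sum>v<n. \<phi> v (card V)) = (\<Sum>\<sigma>\<in>partitions k. S \<sigma>)"
    unfolding S_def by (intro sum.mono_neutral_cong_left finite_partitions) (auto simp: sym_partitions_def)
  moreover have "\<bar>T \<sigma> - S \<sigma>\<bar> \<le> real (k\<^sup>2 + k + 1) * B ^ k / sqrt (real n)" if \<sigma>: "\<sigma> \<in> partitions k" for \<sigma>
  proof -
    have f\<sigma>: "finite \<sigma>" by (rule partitionsD(6)[OF \<sigma>])
    have fP: "finite (\<sigma> \<rightarrow>\<^sub>E {..<n})" using f\<sigma> by (intro finite_PiE) auto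
    have weaken: "real c * B ^ k / sqrt (real n) \<le> real (k\<^sup>2 + k + 1) * B ^ k / sqrt (real n)" if "c \<le> k\<^sup>2 + k + 1" for c
    proof -
      have "real c \<le> real (k\<^sup>2 + k + 1)" using that by (simp only: of_nat_le_iff)
      then show ?thesis using B by (intro divide_right_mono mult_right_mono) auto
    qed
    have sym_iff: "\<sigma> \<in> sym_partitions k \<longleftrightarrow> (\<forall>V\<in>\<sigma>. d V = 0)"
      using \<sigma> alternating_card[OF partitionsD(5)[OF \<sigma>]] by (auto simp: sym_partitions_def d_def)
    show ?thesis
    proof (cases "\<sigma> \<in> sym_partitions k")
      case True
      let ?P = "{u \<in> \<sigma> \<rightarrow>\<^sub>E {..<n}. \<not> inj_on u \<sigma>}" and ?I = "{u. u \<in> \<sigma> \<rightarrow>\<^sub>E {..<n} \<and> inj_on u \<sigma>}"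
      have "T \<sigma> = (\<Sum>u\<in>?I. \<Prod>V\<in>\<sigma>. \<phi> (u V) (card V))"
        unfolding T_def using True sym_iff by (intro sum.cong) auto
      moreover have "S \<sigma> = (\<Sum>u\<in>\<sigma> \<rightarrow>\<^sub>E {..<n}. \<Prod>V\<in>\<sigma>. \<phi> (u V) (card V))"
        unfolding S_def using True f\<sigma> by (subst prod_sum_PiE[symmetric]) auto
      moreover have "(\<Sum>u\<in>\<sigma> \<rightarrow>\<^sub>E {..<n}. \<Prod>V\<in>\<sigma>. \<phi> (u V) (card V))
          = (\<Sum>u\<in>?I. \<Prod>V\<in>\<sigma>. \<phi> (u V) (card V)) + (\<Sum>u\<in>?P. \<Prod>V\<in>\<sigma>. \<phi> (u V) (card V))"
      proof -
        have "\<sigma> \<rightarrow>\<^sub>E {..<n} = ?I \<union> ?P" by auto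
        then have "(\<Sum>u\<in>\<sigma> \<rightarrow>\<^sub>E {..<n}. \<Prod>V\<in>\<sigma>. \<phi> (u V) (card V)) = (\<Sum>u\<in>?I \<union> ?P. \<Prod>V\<in>\<sigma>. \<phi> (u V) (card V))"
          by (rule sum.cong) (rule refl)
        also have "\<dots> = (\<Sum>u\<in>?I. \<Prod>V\<in>\<sigma>. \<phi> (u V) (card V)) + (\<Sum>u\<in>?P. \<Prod>V\<in>\<sigma>. \<phi> (u V) (card V))"
          using fP by (intro sum.union_disjoint) auto
        finally show ?thesis .
      qed
      ultimately have "\<bar>T \<sigma> - S \<sigma>\<bar> = \<bar>\<Sum>u\<in>?P. \<Prod>V\<in>\<sigma>. \<phi> (u V) (card V)\<bar>" by simp
      also have "\<dots> \<le> (\<Sum>u\<in>?P. \<bar>\<Prod>V\<in>\<sigma>. \<phi> (u V) (card V)\<bar>)" by (rule sum_abs)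
      also have "\<dots> \<le> real (k\<^sup>2) * B ^ k / sqrt (real n)"
        by (rule block_sum_small[OF \<sigma> _ card_not_inj_le[OF \<sigma>]]) auto
      also have "\<dots> \<le> real (k\<^sup>2 + k + 1) * B ^ k / sqrt (real n)" by (rule weaken) simp
      finally show ?thesis .
    next
      case False
      then obtain V where V: "V \<in> \<sigma>" "d V \<noteq> 0" using sym_iff by auto
      have "\<bar>d V\<bar> \<le> (\<Sum>j\<in>V. \<bar>(- 1) ^ j :: int\<bar>)" unfolding d_def by (rule sum_abs)
      also have "\<dots> = int (card V)" by simp
      also have "card V \<le> card {1..k}" using partitionsD(3)[OF \<sigma> V(1)] by (intro card_mono) auto
      finally have dk: "\<bar>d V\<bar> \<le> int k" by simp
      let ?P = "{u \<in> \<sigma> \<rightarrow>\<^sub>E {..<n}. int n dvd (\<Sum>V\<in>\<sigma>. d V * int (u V))}"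
      have "\<bar>T \<sigma> - S \<sigma>\<bar> = \<bar>T \<sigma>\<bar>" using False by (simp add: S_def)
      also have "\<dots> \<le> (\<Sum>u | u \<in> \<sigma> \<rightarrow>\<^sub>E {..<n} \<and> inj_on u \<sigma>.
          \<bar>if int n dvd (\<Sum>V\<in>\<sigma>. d V * int (u V)) then \<Prod>V\<in>\<sigma>. \<phi> (u V) (card V) else 0\<bar>)"
        unfolding T_def by (rule sum_abs)
      also have "\<dots> \<le> (\<Sum>u\<in>\<sigma> \<rightarrow>\<^sub>E {..<n}.
          \<bar>if int n dvd (\<Sum>V\<in>\<sigma>. d V * int (u V)) then \<Prod>V\<in>\<sigma>. \<phi> (u V) (card V) else 0\<bar>)"
        using fP by (intro sum_mono2) auto
      also have "\<dots> = (\<Sum>u\<in>?P. \<bar>\<Prod>V\<in>\<sigma>. \<phi> (u V) (card V)\<bar>)"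
        using fP by (simp add: sum.inter_filter if_distrib[of abs] cong: if_cong)
      also have "\<dots> \<le> real (k + 1) * B ^ k / sqrt (real n)"
        by (rule block_sum_small[where c = "k + 1", OF \<sigma> _ card_congruence_le[where d = d, OF \<sigma> V dk]]) auto
      also have "\<dots> \<le> real (k\<^sup>2 + k + 1) * B ^ k / sqrt (real n)" by (rule weaken) simp
      finally show ?thesis .
    qed
  qed
  then have "\<bar>\<Sum>\<sigma>\<in>partitions k. T \<sigma> - S \<sigma>\<bar> \<le> (\<Sum>\<sigma>\<in>partitions k. real (k\<^sup>2 + k + 1) * B ^ k / sqrt (real n))"
    by (intro order_trans[OF sum_abs] sum_mono) auto
  ultimately show ?thesis by (simp add: sum_subtractf)
qed

end

section \<open>Power sums of the eigenvalues\<close>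

abbreviation tuple_moment :: "'a measure \<Rightarrow> (nat \<Rightarrow> 'a \<Rightarrow> real) \<Rightarrow> nat \<Rightarrow> (nat \<Rightarrow> nat) \<Rightarrow> real" where
  "tuple_moment M y k s \<equiv> \<Prod>v\<in>s ` {1..k}. \<integral>\<omega>. y v \<omega> ^ card {j \<in> {1..k}. s j = v} \<partial>M"

lemma alternating_product:
  "(\<Prod>j\<in>{1..2 * p}. if even j then z else w) = (w * z :: 'a :: comm_monoid_mult) ^ p"
proof (induction p)
  case (Suc p)
  have "{1..2 * Suc p} = insert (2 * p + 2) (insert (2 * p + 1) {1..2 * p})" by auto
  then show ?case using Suc by (simp add: ac_simps)
qed simp

text \<open>An even power of an eigenvalue is \<open>(cnj F * F) ^ p\<close>. The product is expanded with conjugates at the odd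
positions, and the sum over the frequencies detects divisibility of the alternating index sum.\<close>

lemma rc_eig_even_power_sum:
  assumes n: "0 < n"
  shows "(\<Sum>m<n. rc_eig n x m ^ (2 * p)) = real n * (\<Sum>s\<in>{1..2 * p} \<rightarrow>\<^sub>E {..<n}.
    if int n dvd alternating_sum (2 * p) s then \<Prod>j\<in>{1..2 * p}. x (s j) else 0)"
proof -
  let ?e = "\<lambda>s. alternating_sum (2 * p) s"
  have one: "complex_of_real (rc_eig n x m ^ (2 * p))
      = (\<Sum>s\<in>{1..2 * p} \<rightarrow>\<^sub>E {..<n}. of_real (\<Prod>j\<in>{1..2 * p}. x (s j)) * unity_root n (?e s * int m))" for m
  proof -
    have "rc_eig n x m ^ (2 * p) = (cmod (dft n x m))\<^sup>2 ^ p"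
      using abs_rc_eig[OF n, of x m] by (metis power2_abs power_mult)
    then have "complex_of_real (rc_eig n x m ^ (2 * p)) = complex_of_real ((cmod (dft n x m))\<^sup>2) ^ p"
      by (simp only: of_real_power)
    also have "\<dots> = (cnj (dft n x m) * dft n x m) ^ p"
      by (simp only: complex_norm_square mult.commute)
    also have "\<dots> = (\<Prod>j\<in>{1..2 * p}. if even j then dft n x m else cnj (dft n x m))"
      by (rule alternating_product[symmetric])
    also have "\<dots> = (\<Prod>j\<in>{1..2 * p}. \<Sum>l<n. of_real (x l) * unity_root n ((- 1) ^ j * int l * int m))"
    proof (rule prod.cong[OF refl])
      fix j :: nat
      have 1: "dft n x m = (\<Sum>l<n. of_real (x l) * unity_root n (1 * int l * int m))"
        unfolding dft_def by (simp add: mult.commute)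
      have 2: "cnj (dft n x m) = (\<Sum>l<n. of_real (x l) * unity_root n (- 1 * int l * int m))"
        unfolding dft_def cnj_sum by (simp add: unity_root_uminus mult.commute)
      show "(if even j then dft n x m else cnj (dft n x m))
          = (\<Sum>l<n. of_real (x l) * unity_root n ((- 1) ^ j * int l * int m))"
      proof (cases "even j")
        case True
        then show ?thesis using 1 by (simp only: if_True neg_one_even_power)
      next
        case False
        then have "(- 1 :: int) ^ j = - 1" by simp
        then show ?thesis using 2 False by (simp only: if_False)
      qed
    qed
    also have "\<dots> = (\<Sum>s\<in>{1..2 * p} \<rightarrow>\<^sub>E {..<n}.
        \<Prod>j\<in>{1..2 * p}. of_real (x (s j)) * unity_root n ((- 1) ^ j * int (s j) * int m))"
      by (rule prod_sum_PiE) auto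
    also have "\<dots> = (\<Sum>s\<in>{1..2 * p} \<rightarrow>\<^sub>E {..<n}. of_real (\<Prod>j\<in>{1..2 * p}. x (s j)) * unity_root n (?e s * int m))"
      by (intro sum.cong refl) (simp only: prod.distrib of_real_prod unity_root_sum[symmetric] sum_distrib_right)
    finally show ?thesis .
  qed
  have "complex_of_real (\<Sum>m<n. rc_eig n x m ^ (2 * p))
      = (\<Sum>s\<in>{1..2 * p} \<rightarrow>\<^sub>E {..<n}. of_real (\<Prod>j\<in>{1..2 * p}. x (s j)) * (\<Sum>m<n. unity_root n (?e s * int m)))"
    unfolding of_real_sum one sum_distrib_left by (rule sum.swap)
  also have "\<dots> = of_real (real n * (\<Sum>s\<in>{1..2 * p} \<rightarrow>\<^sub>E {..<n}. if int n dvd ?e s then \<Prod>j\<in>{1..2 * p}. x (s j) else 0))"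
    unfolding sum_unity_root[OF n] sum_distrib_left of_real_sum
    by (intro sum.cong refl) (simp add: mult.commute)
  finally show ?thesis by (simp only: of_real_eq_iff)
qed

text \<open>The frequencies \<open>m\<close> and \<open>n - m\<close> cancel each other, unless they coincide modulo \<open>n\<close>.\<close>

lemma rc_eig_odd_power_sum:
  assumes n: "0 < n" and k: "odd k"
  shows "(\<Sum>m<n. rc_eig n x m ^ k)
    = (\<Sum>m | m < n \<and> n dvd 2 * m. (\<Sum>j<n. Re (unity_root n (int m * int j)) * x j) ^ k)"
proof -
  let ?H = "{m. m < n \<and> n dvd 2 * m}" and ?R = "{m. m < n \<and> \<not> n dvd 2 * m}"
  have "(\<Sum>m\<in>?R. rc_eig n x m ^ k) = (\<Sum>m\<in>?R. rc_eig n x (n - m) ^ k)"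
    by (rule sum.reindex_bij_witness[of _ "\<lambda>m. n - m" "\<lambda>m. n - m"])
       (auto simp: not_half_reflect)
  also have "\<dots> = - (\<Sum>m\<in>?R. rc_eig n x m ^ k)"
    unfolding sum_negf[symmetric] using k by (intro sum.cong refl) (auto simp: rc_eig_reflect power_minus_odd)
  finally have R: "(\<Sum>m\<in>?R. rc_eig n x m ^ k) = 0" by simp
  have "{..<n} = ?H \<union> ?R" by auto
  then have "(\<Sum>m<n. rc_eig n x m ^ k) = (\<Sum>m\<in>?H. rc_eig n x m ^ k) + (\<Sum>m\<in>?R. rc_eig n x m ^ k)"
    by (simp only:) (intro sum.union_disjoint; auto)
  also have "(\<Sum>m\<in>?H. rc_eig n x m ^ k) = (\<Sum>m\<in>?H. (\<Sum>j<n. Re (unity_root n (int m * int j)) * x j) ^ k)"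
    using dft_real[OF n] by (intro sum.cong refl) (simp add: rc_eig_def mult.commute)
  finally show ?thesis using R by simp
qed

lemma card_half_indices: "card {m. m < n \<and> n dvd 2 * m} \<le> 2" for n :: nat
proof -
  have "{m. m < n \<and> n dvd 2 * m} \<subseteq> {0, n div 2}" using half_index_cases by fastforce
  then have "card {m. m < n \<and> n dvd 2 * m} \<le> card {0, n div 2}" by (intro card_mono) auto
  also have "\<dots> \<le> 2" by (rule card_insert_le_m1) auto
  finally show ?thesis .
qed

context
  fixes M :: "'a measure" and n :: nat and y :: "nat \<Rightarrow> 'a \<Rightarrow> real"
  assumes n: "0 < n" and M: "prob_space M" and indep: "prob_space.indep_vars M (\<lambda>_. borel) y {..<n}"
    and int: "\<And>i k. i < n \<Longrightarrow> integrable M (\<lambda>\<omega>. y i \<omega> ^ k)"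
begin

text \<open>Positions with equal index are merged into a power of one entry; the entries that remain are independent.\<close>

lemma tuple_product_expectation:
  fixes k :: nat
  assumes s: "s \<in> {1..k} \<rightarrow>\<^sub>E {..<n}"
  shows "integrable M (\<lambda>\<omega>. \<Prod>j\<in>{1..k}. y (s j) \<omega>)"
    and "(\<integral>\<omega>. (\<Prod>j\<in>{1..k}. y (s j) \<omega>) \<partial>M)
      = tuple_moment M y k s"
proof -
  interpret prob_space M by (rule M)
  let ?c = "\<lambda>v. card {j \<in> {1..k}. s j = v}"
  have sub: "s ` {1..k} \<subseteq> {..<n}" using s by auto
  have prod: "(\<Prod>j\<in>{1..k}. y (s j) \<omega>) = (\<Prod>v\<in>s ` {1..k}. y v \<omega> ^ ?c v)" for \<omega>
  proof -
    have "(\<Prod>j\<in>{1..k}. y (s j) \<omega>) = (\<Prod>v\<in>s ` {1..k}. \<Prod>j | j \<in> {1..k} \<and> s j = v. y (s j) \<omega>)"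
      by (rule prod.image_gen) simp
    also have "\<dots> = (\<Prod>v\<in>s ` {1..k}. y v \<omega> ^ ?c v)" by (intro prod.cong refl) simp
    finally show ?thesis .
  qed
  have ind: "indep_vars (\<lambda>_. borel) (\<lambda>v \<omega>. y v \<omega> ^ ?c v) (s ` {1..k})"
    by (rule indep_vars_compose2[OF indep_vars_subset[OF indep sub]]) simp
  show "integrable M (\<lambda>\<omega>. \<Prod>j\<in>{1..k}. y (s j) \<omega>)"
    unfolding prod using sub by (intro indep_vars_integrable ind int finite_imageI finite_atLeastAtMost) auto
  show "(\<integral>\<omega>. (\<Prod>j\<in>{1..k}. y (s j) \<omega>) \<partial>M) = (\<Prod>v\<in>s ` {1..k}. \<integral>\<omega>. y v \<omega> ^ ?c v \<partial>M)"
    unfolding prod using sub by (intro indep_vars_lebesgue_integral ind int finite_imageI finite_atLeastAtMost) auto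
qed

lemma expected_even_power_sum:
  "integrable M (\<lambda>\<omega>. \<Sum>m<n. rc_eig n (\<lambda>i. y i \<omega>) m ^ (2 * p))"
  "(\<integral>\<omega>. (\<Sum>m<n. rc_eig n (\<lambda>i. y i \<omega>) m ^ (2 * p)) \<partial>M)
    = real n * (\<Sum>s\<in>{1..2 * p} \<rightarrow>\<^sub>E {..<n}. if int n dvd alternating_sum (2 * p) s
        then tuple_moment M y (2 * p) s else 0)"
proof -
  let ?f = "\<lambda>s \<omega>. if int n dvd alternating_sum (2 * p) s then \<Prod>j\<in>{1..2 * p}. y (s j) \<omega> else 0"
  have i: "integrable M (?f s)" if "s \<in> {1..2 * p} \<rightarrow>\<^sub>E {..<n}" for s
    by (cases "int n dvd alternating_sum (2 * p) s")
       (simp_all only: if_True if_False tuple_product_expectation(1)[OF that] integrable_zero)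
  show "integrable M (\<lambda>\<omega>. \<Sum>m<n. rc_eig n (\<lambda>i. y i \<omega>) m ^ (2 * p))"
    unfolding rc_eig_even_power_sum[OF n]
    by (intro integrable_mult_right Bochner_Integration.integrable_sum i)
  have "(\<integral>\<omega>. (\<Sum>m<n. rc_eig n (\<lambda>i. y i \<omega>) m ^ (2 * p)) \<partial>M)
      = real n * (\<Sum>s\<in>{1..2 * p} \<rightarrow>\<^sub>E {..<n}. \<integral>\<omega>. ?f s \<omega> \<partial>M)"
    unfolding rc_eig_even_power_sum[OF n] integral_mult_right_zero
    by (subst Bochner_Integration.integral_sum[OF i]) auto
  also have "(\<Sum>s\<in>{1..2 * p} \<rightarrow>\<^sub>E {..<n}. \<integral>\<omega>. ?f s \<omega> \<partial>M)
      = (\<Sum>s\<in>{1..2 * p} \<rightarrow>\<^sub>E {..<n}. if int n dvd alternating_sum (2 * p) s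
        then tuple_moment M y (2 * p) s else 0)"
  proof (rule sum.cong[OF refl])
    fix s assume s: "s \<in> {1..2 * p} \<rightarrow>\<^sub>E {..<n}"
    show "(\<integral>\<omega>. ?f s \<omega> \<partial>M) = (if int n dvd alternating_sum (2 * p) s
        then tuple_moment M y (2 * p) s else 0)"
      by (cases "int n dvd alternating_sum (2 * p) s")
         (simp_all only: if_True if_False tuple_product_expectation(2)[OF s] Bochner_Integration.integral_zero)
  qed
  finally show "(\<integral>\<omega>. (\<Sum>m<n. rc_eig n (\<lambda>i. y i \<omega>) m ^ (2 * p)) \<partial>M)
    = real n * (\<Sum>s\<in>{1..2 * p} \<rightarrow>\<^sub>E {..<n}. if int n dvd alternating_sum (2 * p) s
        then tuple_moment M y (2 * p) s else 0)" .
qed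

text \<open>The weights are cosines in the application. In the expansion into tuples they appear only as factors of
modulus at most one.\<close>

lemma expected_weighted_power:
  fixes k :: nat
  assumes \<epsilon>: "\<And>j. \<bar>\<epsilon> j\<bar> \<le> 1"
  shows "integrable M (\<lambda>\<omega>. (\<Sum>j<n. \<epsilon> j * y j \<omega>) ^ k)"
    and "\<bar>\<integral>\<omega>. (\<Sum>j<n. \<epsilon> j * y j \<omega>) ^ k \<partial>M\<bar>
      \<le> (\<Sum>s\<in>{1..k} \<rightarrow>\<^sub>E {..<n}. \<bar>tuple_moment M y k s\<bar>)"
proof -
  have ex: "(\<Sum>j<n. \<epsilon> j * y j \<omega>) ^ k
      = (\<Sum>s\<in>{1..k} \<rightarrow>\<^sub>E {..<n}. (\<Prod>j\<in>{1..k}. \<epsilon> (s j)) * (\<Prod>j\<in>{1..k}. y (s j) \<omega>))" for \<omega>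
  proof -
    have "(\<Sum>j<n. \<epsilon> j * y j \<omega>) ^ k = (\<Prod>i\<in>{1..k}. \<Sum>j<n. \<epsilon> j * y j \<omega>)" by simp
    also have "\<dots> = (\<Sum>s\<in>{1..k} \<rightarrow>\<^sub>E {..<n}. \<Prod>j\<in>{1..k}. \<epsilon> (s j) * y (s j) \<omega>)" by (rule prod_sum_PiE) auto
    finally show ?thesis by (simp only: prod.distrib)
  qed
  have i: "integrable M (\<lambda>\<omega>. (\<Prod>j\<in>{1..k}. \<epsilon> (s j)) * (\<Prod>j\<in>{1..k}. y (s j) \<omega>))"
    if "s \<in> {1..k} \<rightarrow>\<^sub>E {..<n}" for s
    using tuple_product_expectation(1)[OF that] by (rule integrable_mult_right)
  show "integrable M (\<lambda>\<omega>. (\<Sum>j<n. \<epsilon> j * y j \<omega>) ^ k)"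
    unfolding ex by (intro Bochner_Integration.integrable_sum i)
  have "\<bar>\<integral>\<omega>. (\<Sum>j<n. \<epsilon> j * y j \<omega>) ^ k \<partial>M\<bar>
      = \<bar>\<Sum>s\<in>{1..k} \<rightarrow>\<^sub>E {..<n}. (\<Prod>j\<in>{1..k}. \<epsilon> (s j)) * (\<integral>\<omega>. (\<Prod>j\<in>{1..k}. y (s j) \<omega>) \<partial>M)\<bar>"
    unfolding ex by (subst Bochner_Integration.integral_sum[OF i], assumption, subst integral_mult_right_zero, rule refl)
  also have "\<dots> \<le> (\<Sum>s\<in>{1..k} \<rightarrow>\<^sub>E {..<n}. \<bar>(\<Prod>j\<in>{1..k}. \<epsilon> (s j)) * (\<integral>\<omega>. (\<Prod>j\<in>{1..k}. y (s j) \<omega>) \<partial>M)\<bar>)"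
    by (rule sum_abs)
  also have "\<dots> \<le> (\<Sum>s\<in>{1..k} \<rightarrow>\<^sub>E {..<n}. \<bar>\<integral>\<omega>. (\<Prod>j\<in>{1..k}. y (s j) \<omega>) \<partial>M\<bar>)"
  proof (rule sum_mono)
    fix s :: "nat \<Rightarrow> nat"
    have "\<bar>\<Prod>j\<in>{1..k}. \<epsilon> (s j)\<bar> \<le> 1" unfolding abs_prod using \<epsilon> by (intro prod_le_1) auto
    then show "\<bar>(\<Prod>j\<in>{1..k}. \<epsilon> (s j)) * (\<integral>\<omega>. (\<Prod>j\<in>{1..k}. y (s j) \<omega>) \<partial>M)\<bar> \<le> \<bar>\<integral>\<omega>. (\<Prod>j\<in>{1..k}. y (s j) \<omega>) \<partial>M\<bar>"
      unfolding abs_mult by (intro mult_left_le_one_le) auto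
  qed
  also have "\<dots> = (\<Sum>s\<in>{1..k} \<rightarrow>\<^sub>E {..<n}. \<bar>tuple_moment M y k s\<bar>)"
    by (rule sum.cong[OF refl]) (simp only: tuple_product_expectation(2))
  finally show "\<bar>\<integral>\<omega>. (\<Sum>j<n. \<epsilon> j * y j \<omega>) ^ k \<partial>M\<bar>
      \<le> (\<Sum>s\<in>{1..k} \<rightarrow>\<^sub>E {..<n}. \<bar>tuple_moment M y k s\<bar>)" .
qed

end

section \<open>Riemann sums of a uniformly convergent sequence\<close>

lemma uniform_partition_tagged_division:
  assumes n: "0 < n"
  shows "(\<lambda>v. (real v / real n, {real v / real n .. real (Suc v) / real n})) ` {..<n} tagged_division_of {0..1::real}"
    (is "?p tagged_division_of _")
proof (rule tagged_division_ofI)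
  let ?I = "\<lambda>v. {real v / real n .. real (Suc v) / real n}"
  show "finite ?p" by simp
  fix x K assume "(x, K) \<in> ?p"
  then obtain v where v: "v < n" "x = real v / real n" "K = ?I v" by auto
  show "x \<in> K" using v n by (auto simp: divide_simps)
  show "K \<subseteq> {0..1}"
  proof
    fix z assume z: "z \<in> K"
    have "real (Suc v) / real n \<le> 1" using v(1) n by (simp add: divide_simps)
    moreover have "0 \<le> real v / real n" by simp
    ultimately show "z \<in> {0..1}" using z v(3) by (auto intro: order_trans[of 0 "real v / real n"])
  qed
  show "\<exists>a b. K = cbox a b" using v(3) by (metis box_real(2))
next
  let ?I = "\<lambda>v. {real v / real n .. real (Suc v) / real n}"
  fix x1 K1 x2 K2 assume 1: "(x1, K1) \<in> ?p" and 2: "(x2, K2) \<in> ?p" and ne: "(x1, K1) \<noteq> (x2, K2)"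
  obtain v where v: "x1 = real v / real n" "K1 = ?I v" using 1 by auto
  obtain w where w: "x2 = real w / real n" "K2 = ?I w" using 2 by auto
  have "v \<noteq> w" using ne v w by auto
  then have "real (Suc v) / real n \<le> real w / real n \<or> real (Suc w) / real n \<le> real v / real n"
    by (cases "v < w") (auto intro!: divide_right_mono simp del: of_nat_Suc)
  then show "interior K1 \<inter> interior K2 = {}"
    unfolding v w interior_atLeastAtMost_real by auto
next
  let ?I = "\<lambda>v. {real v / real n .. real (Suc v) / real n}"
  have U: "\<Union>{K. \<exists>x. (x, K) \<in> ?p} = (\<Union>v<n. ?I v)" by auto
  have "{0..1} \<subseteq> (\<Union>v<n. ?I v)"
  proof
    fix z :: real assume z: "z \<in> {0..1}"
    show "z \<in> (\<Union>v<n. ?I v)"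
    proof (cases "z = 1")
      case True
      then have "z \<in> ?I (n - 1)" using n by (auto simp: divide_simps)
      then show ?thesis using n by (intro UN_I[of "n - 1"]) auto
    next
      case False
      define v where "v = nat \<lfloor>z * real n\<rfloor>"
      have zn: "0 \<le> z * real n" "z * real n < real n" using z False n by auto
      have "real v = of_int \<lfloor>z * real n\<rfloor>" unfolding v_def using zn(1) by simp
      then have v: "real v \<le> z * real n" "z * real n < real v + 1" by linarith+
      then have "v < n" using zn(2) by linarith
      moreover have "z \<in> ?I v" using v n by (auto simp: divide_simps)
      ultimately show ?thesis by blast
    qed
  qed
  moreover have "(\<Union>v<n. ?I v) \<subseteq> {0..1}"
  proof clarsimp
    fix v z assume "v < n" "real v / real n \<le> z" "z \<le> (1 + real v) / real n"
    moreover have "(1 + real v) / real n \<le> 1" using \<open>v < n\<close> n by (simp add: divide_simps)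
    moreover have "0 \<le> real v / real n" by simp
    ultimately show "0 \<le> z \<and> z \<le> 1" by linarith
  qed
  ultimately show "\<Union>{K. \<exists>x. (x, K) \<in> ?p} = {0..1}" unfolding U by blast
qed

text \<open>Divisions whose tags control the intervals through a gauge of constant radius have small mesh, so the
integral in the sense of Riemann is one in the sense of Henstock and Kurzweil. The equidistant divisions with left endpoints as tags give
the sequence of Riemann sums.\<close>

lemma riemann_integrable_has_integral:
  assumes "riemann_integrable_on f 0 1"
  obtains I where "(f has_integral I) {0..1}" "(\<lambda>n. (\<Sum>v<n. f (real v / real n)) / real n) \<longlonglongrightarrow> I"
proof -
  obtain I where I: "\<And>e. e > 0 \<Longrightarrow> \<exists>d>0. \<forall>p. p tagged_division_of {0..1} \<and> (\<forall>(x, K)\<in>p. measure lborel K < d) \<longrightarrow>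
        \<bar>(\<Sum>(x, K)\<in>p. measure lborel K * f x) - I\<bar> < e"
    using assms unfolding riemann_integrable_on_def by blast
  have "(f has_integral I) (cbox 0 1)"
    unfolding has_integral
  proof (intro allI impI)
    fix e :: real assume "e > 0"
    then obtain d where d: "d > 0" and D: "\<And>p. p tagged_division_of {0..1} \<Longrightarrow> (\<forall>(x, K)\<in>p. measure lborel K < d) \<Longrightarrow>
        \<bar>(\<Sum>(x, K)\<in>p. measure lborel K * f x) - I\<bar> < e" using I by meson
    show "\<exists>\<gamma>. gauge \<gamma> \<and> (\<forall>\<D>. \<D> tagged_division_of cbox 0 1 \<and> \<gamma> fine \<D> \<longrightarrow>
        norm ((\<Sum>(x, k)\<in>\<D>. measure lborel k *\<^sub>R f x) - I) < e)"
    proof (intro exI[of _ "\<lambda>x. ball x (d / 2)"] conjI allI impI)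
      show "gauge (\<lambda>x::real. ball x (d / 2))" using d by (simp add: gauge_ball)
      fix p assume p: "p tagged_division_of cbox 0 (1::real) \<and> (\<lambda>x. ball x (d / 2)) fine p"
      have "measure lborel K < d" if xK: "(x, K) \<in> p" for x K
      proof -
        have sub: "K \<subseteq> ball x (d / 2)" using p xK by (auto simp: fine_def)
        obtain a b where ab: "K = cbox a b" using p xK by (meson tagged_division_ofD(4))
        have "x \<in> K" using p xK by (meson tagged_division_ofD(2))
        then have le: "a \<le> b" using ab by auto
        then have "a \<in> ball x (d / 2)" "b \<in> ball x (d / 2)" using sub ab by auto
        then have "b - a < d" unfolding mem_ball dist_real_def by linarith
        then show ?thesis using le ab by simp
      qed
      then show "norm ((\<Sum>(x, k)\<in>p. measure lborel k *\<^sub>R f x) - I) < e" using D[of p] p by auto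
    qed
  qed
  moreover have "(\<lambda>n. (\<Sum>v<n. f (real v / real n)) / real n) \<longlonglongrightarrow> I"
  proof (rule LIMSEQ_I)
    fix e :: real assume "e > 0"
    then obtain d where d: "d > 0" and D: "\<And>p. p tagged_division_of {0..1} \<Longrightarrow> (\<forall>(x, K)\<in>p. measure lborel K < d) \<Longrightarrow>
        \<bar>(\<Sum>(x, K)\<in>p. measure lborel K * f x) - I\<bar> < e" using I by meson
    obtain N :: nat where N: "1 / d < real N" using reals_Archimedean2 by blast
    have "norm ((\<Sum>v<n. f (real v / real n)) / real n - I) < e" if nN: "n \<ge> N" for n
    proof -
      have "0 < 1 / d" using d by simp
      then have n: "0 < n" "1 / d < real n" using N nN by linarith+
      let ?g = "\<lambda>v. (real v / real n, {real v / real n .. real (Suc v) / real n})"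
      have m: "measure lborel {real v / real n .. real (Suc v) / real n} = 1 / real n" for v
      proof -
        have "real v / real n \<le> real (Suc v) / real n" by (intro divide_right_mono) auto
        then show ?thesis by (simp add: diff_divide_distrib[symmetric])
      qed
      have "1 / real n < d" using n d by (simp add: field_simps)
      then have "\<bar>(\<Sum>(x, K)\<in>?g ` {..<n}. measure lborel K * f x) - I\<bar> < e"
        using m by (intro D uniform_partition_tagged_division[OF n(1)]) auto
      moreover have "(\<Sum>(x, K)\<in>?g ` {..<n}. measure lborel K * f x) = (\<Sum>v<n. f (real v / real n)) / real n"
      proof -
        have "inj_on ?g {..<n}" using n by (auto simp: inj_on_def)
        then have "(\<Sum>(x, K)\<in>?g ` {..<n}. measure lborel K * f x) = (\<Sum>v<n. 1 / real n * f (real v / real n))"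
          by (simp only: sum.reindex o_def case_prod_conv m)
        then show ?thesis by (simp add: sum_divide_distrib)
      qed
      ultimately show ?thesis by simp
    qed
    then show "\<exists>N. \<forall>n\<ge>N. norm ((\<Sum>v<n. f (real v / real n)) / real n - I) < e" by blast
  qed
  ultimately show thesis by (intro that[of I]) auto
qed

text \<open>The function may be frozen at a late index \<open>N\<close>, at a uniformly small cost both in the sums and in the integral.\<close>

lemma uniform_limit_riemann_sums:
  assumes f: "\<And>n. n \<ge> 1 \<Longrightarrow> riemann_integrable_on (f n) 0 1"
    and lim: "uniform_limit {0..1} f h sequentially"
  shows "h integrable_on {0..1}"
    and "(\<lambda>n. (\<Sum>v<n. f n (real v / real n)) / real n) \<longlonglongrightarrow> integral {0..1} h"
proof -
  have ev: "\<exists>N\<ge>1. \<forall>n\<ge>N. \<forall>s\<in>{0..1}. \<bar>f n s - h s\<bar> < e" if epos: "e > 0" for e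
  proof -
    obtain N where N: "\<forall>n\<ge>N. \<forall>s\<in>{0..1}. dist (f n s) (h s) < e"
      using uniform_limitD[OF lim epos] by (auto simp: eventually_sequentially)
    then show ?thesis by (intro exI[of _ "max 1 N"]) (auto simp: dist_real_def)
  qed
  have int: "f n integrable_on {0..1}" if "n \<ge> 1" for n
    using riemann_integrable_has_integral[OF f[OF that]] by (metis has_integral_integrable)
  have "h integrable_on cbox 0 1"
  proof (rule integrable_uniform_limit)
    fix e :: real assume "e > 0"
    then obtain N where N: "N \<ge> 1" "\<forall>s\<in>{0..1}. \<bar>f N s - h s\<bar> < e" using ev by blast
    then show "\<exists>g. (\<forall>x\<in>cbox 0 1. norm (h x - g x) \<le> e) \<and> g integrable_on cbox 0 1"
      using int[of N] by (intro exI[of _ "f N"]) (auto simp: abs_minus_commute less_imp_le)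
  qed
  then show hint: "h integrable_on {0..1}" by simp
  show "(\<lambda>n. (\<Sum>v<n. f n (real v / real n)) / real n) \<longlonglongrightarrow> integral {0..1} h"
  proof (rule LIMSEQ_I)
    fix e :: real assume e: "e > 0"
    then obtain N where N: "N \<ge> 1" "\<And>n s. n \<ge> N \<Longrightarrow> s \<in> {0..1} \<Longrightarrow> \<bar>f n s - h s\<bar> < e / 5"
      using ev[of "e / 5"] by auto
    obtain I where I: "(f N has_integral I) {0..1}" "(\<lambda>n. (\<Sum>v<n. f N (real v / real n)) / real n) \<longlonglongrightarrow> I"
      using riemann_integrable_has_integral[OF f[OF N(1)]] by blast
    obtain N' where N': "\<And>n. n \<ge> N' \<Longrightarrow> \<bar>(\<Sum>v<n. f N (real v / real n)) / real n - I\<bar> < e / 5"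
      using LIMSEQ_D[OF I(2), of "e / 5"] e by auto
    have limit: "\<bar>I - integral {0..1} h\<bar> \<le> e / 5"
    proof -
      have "((\<lambda>x. f N x - h x) has_integral (I - integral {0..1} h)) {0..1}"
        using I(1) hint by (intro has_integral_diff integrable_integral)
      then have "((\<lambda>x. f N x - h x) has_integral (I - integral {0..1} h)) (cbox 0 1)" by simp
      from has_integral_bound[OF _ this, of "e / 5"] show ?thesis
        using N(2)[of N] e by (auto intro: less_imp_le)
    qed
    have sums: "\<bar>(\<Sum>v<n. f n (real v / real n)) / real n - (\<Sum>v<n. f N (real v / real n)) / real n\<bar> \<le> 2 * e / 5"
      if n: "n \<ge> N" for n
    proof -
      have n0: "0 < n" using n N(1) by simp
      have "\<bar>(\<Sum>v<n. f n (real v / real n)) - (\<Sum>v<n. f N (real v / real n))\<bar>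
          \<le> (\<Sum>v<n. \<bar>f n (real v / real n) - f N (real v / real n)\<bar>)"
        unfolding sum_subtractf[symmetric] by (rule sum_abs)
      also have "\<dots> \<le> (\<Sum>v<n. 2 * e / 5)"
      proof (rule sum_mono)
        fix v assume "v \<in> {..<n}"
        then have "real v / real n \<in> {0..1}" using n0 by (auto simp: divide_simps)
        then show "\<bar>f n (real v / real n) - f N (real v / real n)\<bar> \<le> 2 * e / 5"
          using N(2)[OF n, of "real v / real n"] N(2)[OF order_refl, of "real v / real n"] by linarith
      qed
      finally show ?thesis using n0 by (simp add: diff_divide_distrib[symmetric] abs_divide field_simps)
    qed
    have "norm ((\<Sum>v<n. f n (real v / real n)) / real n - integral {0..1} h) < e" if "n \<ge> max N N'" for n
    proof -
      have n: "n \<ge> N" "n \<ge> N'" using that by auto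
      show ?thesis using N'[OF n(2)] sums[OF n(1)] limit e unfolding real_norm_def by linarith
    qed
    then show "\<exists>N. \<forall>n\<ge>N. norm ((\<Sum>v<n. f n (real v / real n)) / real n - integral {0..1} h) < e" by blast
  qed
qed

section \<open>Convergence of the moments\<close>

context
  fixes M :: "'a measure" and n :: nat and y :: "nat \<Rightarrow> 'a \<Rightarrow> real"
  assumes n: "0 < n" and M: "prob_space M" and indep: "prob_space.indep_vars M (\<lambda>_. borel) y {..<n}"
    and int: "\<And>i k. i < n \<Longrightarrow> integrable M (\<lambda>\<omega>. y i \<omega> ^ k)"
begin

lemma indep_measurable: "i < n \<Longrightarrow> y i \<in> borel_measurable M"
  using indep unfolding prob_space.indep_vars_def[OF M] by auto

lemma rc_eig_power_integrable:
  assumes "m < n"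
  shows "integrable M (\<lambda>\<omega>. rc_eig n (\<lambda>i. y i \<omega>) m ^ k)"
proof (rule Bochner_Integration.integrable_bound)
  interpret prob_space M by (rule M)
  let ?ev = "\<lambda>m \<omega>. rc_eig n (\<lambda>i. y i \<omega>) m"
  show "integrable M (\<lambda>\<omega>. 1 + (\<Sum>m<n. ?ev m \<omega> ^ (2 * k)))"
    by (intro Bochner_Integration.integrable_add integrable_const expected_even_power_sum[OF n M indep int])
  show "(\<lambda>\<omega>. ?ev m \<omega> ^ k) \<in> borel_measurable M"
    using indep_measurable by (intro borel_measurable_power rc_eig_measurable)
  show "AE \<omega> in M. norm (?ev m \<omega> ^ k) \<le> norm (1 + (\<Sum>m<n. ?ev m \<omega> ^ (2 * k)))"
  proof (intro AE_I2)
    fix \<omega>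
    have "\<bar>?ev m \<omega> ^ k\<bar> \<le> 1 + (?ev m \<omega> ^ k)\<^sup>2"
      using zero_le_power2[of "\<bar>?ev m \<omega> ^ k\<bar> - 1"] by (simp add: power2_diff)
    also have "(?ev m \<omega> ^ k)\<^sup>2 = ?ev m \<omega> ^ (2 * k)" by (simp add: power_mult[symmetric] mult.commute)
    also have "\<dots> \<le> (\<Sum>m<n. ?ev m \<omega> ^ (2 * k))"
      using assms by (intro member_le_sum) (auto simp: power_mult)
    finally show "norm (?ev m \<omega> ^ k) \<le> norm (1 + (\<Sum>m<n. ?ev m \<omega> ^ (2 * k)))" by simp
  qed
qed

lemma eesd_moment:
  "integrable (rc_eesd M n y) (\<lambda>x. x ^ k)"
  "(\<integral>x. x ^ k \<partial>rc_eesd M n y)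
    = (\<integral>\<omega>. (\<Sum>m<n. rc_eig n (\<lambda>i. y i \<omega>) m ^ k) \<partial>M) / real n"
proof -
  note I = eesd_integral[where f = "\<lambda>x. x ^ k", OF n M indep_measurable _ rc_eig_power_integrable]
  show "integrable (rc_eesd M n y) (\<lambda>x. x ^ k)"
    by (rule I(1)) auto
  have "(\<integral>x. x ^ k \<partial>rc_eesd M n y)
      = (1 / real n) *\<^sub>R (\<Sum>m<n. \<integral>\<omega>. rc_eig n (\<lambda>i. y i \<omega>) m ^ k \<partial>M)"
    by (rule I(2)) auto
  also have "(\<Sum>m<n. \<integral>\<omega>. rc_eig n (\<lambda>i. y i \<omega>) m ^ k \<partial>M) = (\<integral>\<omega>. (\<Sum>m<n. rc_eig n (\<lambda>i. y i \<omega>) m ^ k) \<partial>M)"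
    by (rule Bochner_Integration.integral_sum[symmetric]) (use rc_eig_power_integrable in auto)
  finally show "(\<integral>x. x ^ k \<partial>rc_eesd M n y)
      = (\<integral>\<omega>. (\<Sum>m<n. rc_eig n (\<lambda>i. y i \<omega>) m ^ k) \<partial>M) / real n" by simp
qed

lemma eesd_even_moment_approx:
  assumes p: "0 < p" and B: "1 \<le> B"
    and bd: "\<And>v c. v < n \<Longrightarrow> 1 \<le> c \<Longrightarrow> c \<le> 2 * p \<Longrightarrow>
      \<bar>\<integral>\<omega>. y v \<omega> ^ c \<partial>M\<bar> \<le> B * real n powr (- (1 - 1 / (2 * real (2 * p))))"
  shows "\<bar>(\<integral>x. x ^ (2 * p) \<partial>rc_eesd M n y)
      - (\<Sum>\<sigma>\<in>sym_partitions (2 * p). \<Prod>V\<in>\<sigma>. \<Sum>v<n. \<integral>\<omega>. y v \<omega> ^ card V \<partial>M)\<bar>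
    \<le> real (card (partitions (2 * p))) * (real ((2 * p)\<^sup>2 + 2 * p + 1) * B ^ (2 * p) / sqrt (real n))"
proof -
  have "(\<integral>x. x ^ (2 * p) \<partial>rc_eesd M n y)
    = (\<Sum>s\<in>{1..2 * p} \<rightarrow>\<^sub>E {..<n}. if int n dvd alternating_sum (2 * p) s
        then tuple_moment M y (2 * p) s else 0)"
  proof -
    have "(\<integral>\<omega>. (\<Sum>m<n. rc_eig n (\<lambda>i. y i \<omega>) m ^ (2 * p)) \<partial>M) = real n *
        (\<Sum>s\<in>{1..2 * p} \<rightarrow>\<^sub>E {..<n}. if int n dvd alternating_sum (2 * p) s
        then tuple_moment M y (2 * p) s else 0)"
      by (rule expected_even_power_sum(2)[OF n M indep int])
    then show ?thesis unfolding eesd_moment(2) using n by simp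
  qed
  then show ?thesis
    using constrained_tuple_sum[OF n _ B, of "2 * p" "\<lambda>v c. \<integral>\<omega>. y v \<omega> ^ c \<partial>M"] p bd by simp
qed

text \<open>Only the at most two self-conjugate frequencies contribute; no congruence is available for them, but the
bound \<open>sqrt n\<close> for an unconstrained tuple sum is beaten by the normalisation \<open>1 / n\<close>.\<close>

lemma eesd_odd_moment_bound:
  assumes k: "odd k" and B: "1 \<le> B"
    and bd: "\<And>v c. v < n \<Longrightarrow> 1 \<le> c \<Longrightarrow> c \<le> k \<Longrightarrow>
      \<bar>\<integral>\<omega>. y v \<omega> ^ c \<partial>M\<bar> \<le> B * real n powr (- (1 - 1 / (2 * real k)))"
  shows "\<bar>\<integral>x. x ^ k \<partial>rc_eesd M n y\<bar>
    \<le> 2 * real (card (partitions k)) * B ^ k / sqrt (real n)"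
proof -
  let ?H = "{m. m < n \<and> n dvd 2 * m}" and ?K = "real (card (partitions k)) * (B ^ k * sqrt (real n))"
  let ?w = "\<lambda>m \<omega>. (\<Sum>j<n. Re (unity_root n (int m * int j)) * y j \<omega>) ^ k"
  have k0: "0 < k" using k by (cases k) auto
  have w1: "\<bar>Re (unity_root n (int m * int j))\<bar> \<le> 1" for m j
    using abs_Re_le_cmod[of "unity_root n (int m * int j)"] by simp
  have w_int: "integrable M (?w m)" for m
    by (rule expected_weighted_power(1)[OF n M indep int]) (simp_all add: w1)
  have w_bd: "\<bar>\<integral>\<omega>. ?w m \<omega> \<partial>M\<bar>
      \<le> (\<Sum>s\<in>{1..k} \<rightarrow>\<^sub>E {..<n}. \<bar>tuple_moment M y k s\<bar>)" for m
    by (rule expected_weighted_power(2)[OF n M indep int]) (simp_all add: w1)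
  have split: "(\<integral>\<omega>. (\<Sum>m<n. rc_eig n (\<lambda>i. y i \<omega>) m ^ k) \<partial>M) = (\<Sum>m\<in>?H. \<integral>\<omega>. ?w m \<omega> \<partial>M)"
    unfolding rc_eig_odd_power_sum[OF n k] by (rule Bochner_Integration.integral_sum) (rule w_int)
  have "\<bar>\<integral>\<omega>. (\<Sum>m<n. rc_eig n (\<lambda>i. y i \<omega>) m ^ k) \<partial>M\<bar> \<le> (\<Sum>m\<in>?H. \<bar>\<integral>\<omega>. ?w m \<omega> \<partial>M\<bar>)"
    unfolding split by (rule sum_abs)
  also have "\<dots> \<le> (\<Sum>m\<in>?H. ?K)"
    using tuple_sum_bound[OF n k0 B, of "\<lambda>v c. \<integral>\<omega>. y v \<omega> ^ c \<partial>M"] bd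
    by (intro sum_mono order_trans[OF w_bd]) auto
  also have "\<dots> \<le> 2 * ?K"
    using card_half_indices[of n] B by (simp add: mult_right_mono)
  finally have "\<bar>\<integral>\<omega>. (\<Sum>m<n. rc_eig n (\<lambda>i. y i \<omega>) m ^ k) \<partial>M\<bar> \<le> 2 * ?K" .
  then have "\<bar>\<integral>x. x ^ k \<partial>rc_eesd M n y\<bar> \<le> 2 * ?K / real n"
    unfolding eesd_moment(2) abs_divide using n by (simp add: divide_right_mono)
  also have "\<dots> = 2 * real (card (partitions k)) * B ^ k / sqrt (real n)"
  proof -
    have "sqrt (real n) * sqrt (real n) = real n" by simp
    then show ?thesis using n by (simp add: divide_simps)
  qed
  finally show ?thesis .
qed

end

lemma sym_partition_block:
  assumes "\<sigma> \<in> sym_partitions k" "V \<in> \<sigma>"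
  obtains m where "1 \<le> m" "card V = 2 * m"
proof -
  have \<sigma>: "\<sigma> \<in> partitions k" and c: "card {v \<in> V. odd v} = card {v \<in> V. even v}"
    using assms by (auto simp: sym_partitions_def)
  have "V = {v \<in> V. odd v} \<union> {v \<in> V. even v}" by auto
  then have "card V = card ({v \<in> V. odd v} \<union> {v \<in> V. even v})" by simp
  also have "\<dots> = card {v \<in> V. odd v} + card {v \<in> V. even v}"
    using partitionsD(5)[OF \<sigma> assms(2)] by (intro card_Un_disjoint) auto
  finally have "card V = 2 * card {v \<in> V. odd v}" using c by simp
  moreover have "card V \<noteq> 0" using partitionsD(4,5)[OF \<sigma> assms(2)] by simp
  ultimately show thesis by (intro that[of "card {v \<in> V. odd v}"]) auto
qed

lemma limit_moment_0: "limit_moment C 0 = 1"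
proof -
  have "partitions 0 = {{}}" by (auto simp: partitions_def partition_on_empty)
  then have "sym_partitions 0 = {{}}" by (auto simp: sym_partitions_def)
  then show ?thesis by (simp add: limit_moment_def mult_ext_def)
qed

text \<open>The array enters only through the order of magnitude of its moments and through the limits of the sums of
the even ones. Dividing \<open>sqrt n\<close> by \<open>n\<close> leaves an error of order \<open>1 / sqrt n\<close> in every moment.\<close>

theorem eesd_moments_converge:
  fixes M :: "nat \<Rightarrow> 'a measure" and y :: "nat \<Rightarrow> nat \<Rightarrow> 'a \<Rightarrow> real"
  assumes M: "\<And>n. 1 \<le> n \<Longrightarrow> prob_space (M n)"
    and indep: "\<And>n. 1 \<le> n \<Longrightarrow> prob_space.indep_vars (M n) (\<lambda>_. borel) (y n) {..<n}"
    and int: "\<And>n i k. 1 \<le> n \<Longrightarrow> i < n \<Longrightarrow> integrable (M n) (\<lambda>\<omega>. y n i \<omega> ^ k)"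
    and bd: "\<And>k. 1 \<le> k \<Longrightarrow> \<exists>B\<ge>1. \<forall>n\<ge>1. \<forall>v<n. \<forall>c. 1 \<le> c \<longrightarrow> c \<le> k \<longrightarrow>
      \<bar>\<integral>\<omega>. y n v \<omega> ^ c \<partial>M n\<bar> \<le> B * real n powr (- (1 - 1 / (2 * real k)))"
    and C: "\<And>m. 1 \<le> m \<Longrightarrow> (\<lambda>n. \<Sum>v<n. \<integral>\<omega>. y n v \<omega> ^ (2 * m) \<partial>M n) \<longlonglongrightarrow> C (2 * m)"
  shows "(\<lambda>n. \<integral>x. x ^ k \<partial>rc_eesd (M n) n (y n)) \<longlonglongrightarrow> limit_moment C k"
proof -
  let ?E = "\<lambda>n. \<integral>x. x ^ k \<partial>rc_eesd (M n) n (y n)"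
  have inv_sqrt: "(\<lambda>n. K / sqrt (real n)) \<longlonglongrightarrow> 0" for K :: real by real_asymp
  consider "k = 0" | "odd k" | p where "k = 2 * p" "0 < p" by (metis evenE neq0_conv mult_0_right)
  then show ?thesis
  proof cases
    case 1
    have "\<forall>\<^sub>F n in sequentially. ?E n = 1"
      using eventually_ge_at_top[of 1]
    proof eventually_elim
      case (elim n)
      interpret real_distribution "rc_eesd (M n) n (y n)"
        using elim indep_measurable[OF _ M indep int] by (intro real_distribution_eesd M) auto
      show ?case unfolding 1 using prob_space by simp
    qed
    then show ?thesis unfolding 1 limit_moment_0 by (rule tendsto_eventually)
  next
    case 2
    then have k: "1 \<le> k" by (cases k) auto
    then obtain B where B: "1 \<le> B" "\<And>n v c. 1 \<le> n \<Longrightarrow> v < n \<Longrightarrow> 1 \<le> c \<Longrightarrow> c \<le> k \<Longrightarrow>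
      \<bar>\<integral>\<omega>. y n v \<omega> ^ c \<partial>M n\<bar> \<le> B * real n powr (- (1 - 1 / (2 * real k)))" using bd[OF k] by blast
    have "?E \<longlonglongrightarrow> 0"
    proof (rule Lim_null_comparison[OF _ inv_sqrt])
      show "\<forall>\<^sub>F n in sequentially. norm (?E n) \<le> (2 * real (card (partitions k)) * B ^ k) / sqrt (real n)"
        using eventually_ge_at_top[of 1]
      proof eventually_elim
        case (elim n)
        have "\<bar>?E n\<bar> \<le> 2 * real (card (partitions k)) * B ^ k / sqrt (real n)"
          by (rule eesd_odd_moment_bound[OF _ M indep int 2 B(1)]) (use elim B(2) in auto)
        then show ?case by simp
      qed
    qed
    then show ?thesis using 2 by (simp add: limit_moment_def)
  next
    case (3 p)
    have k: "1 \<le> k" using 3 by simp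
    obtain B where B: "1 \<le> B" "\<And>n v c. 1 \<le> n \<Longrightarrow> v < n \<Longrightarrow> 1 \<le> c \<Longrightarrow> c \<le> k \<Longrightarrow>
      \<bar>\<integral>\<omega>. y n v \<omega> ^ c \<partial>M n\<bar> \<le> B * real n powr (- (1 - 1 / (2 * real k)))" using bd[OF k] by blast
    let ?S = "\<lambda>n. \<Sum>\<sigma>\<in>sym_partitions k. \<Prod>V\<in>\<sigma>. \<Sum>v<n. \<integral>\<omega>. y n v \<omega> ^ card V \<partial>M n"
    have "(\<lambda>n. ?E n - ?S n) \<longlonglongrightarrow> 0"
    proof (rule Lim_null_comparison[OF _ inv_sqrt])
      show "\<forall>\<^sub>F n in sequentially. norm (?E n - ?S n)
          \<le> (real (card (partitions k)) * (real (k\<^sup>2 + k + 1) * B ^ k)) / sqrt (real n)"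
        using eventually_ge_at_top[of 1]
      proof eventually_elim
        case (elim n)
        have "\<bar>?E n - ?S n\<bar> \<le> real (card (partitions k)) * (real (k\<^sup>2 + k + 1) * B ^ k / sqrt (real n))"
          unfolding 3(1)
          by (rule eesd_even_moment_approx[OF _ M indep int 3(2) B(1)]) (use elim B(2)[unfolded 3(1)] in auto)
        then show ?case by simp
      qed
    qed
    moreover have "?S \<longlonglongrightarrow> (\<Sum>\<sigma>\<in>sym_partitions k. \<Prod>V\<in>\<sigma>. C (card V))"
    proof (intro tendsto_sum tendsto_prod)
      fix \<sigma> V assume "\<sigma> \<in> sym_partitions k" "V \<in> \<sigma>"
      then obtain m where "1 \<le> m" "card V = 2 * m" by (rule sym_partition_block)
      then show "(\<lambda>n. \<Sum>v<n. \<integral>\<omega>. y n v \<omega> ^ card V \<partial>M n) \<longlonglongrightarrow> C (card V)" using C by simp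
    qed
    ultimately have "(\<lambda>n. ?E n - ?S n + ?S n) \<longlonglongrightarrow> 0 + (\<Sum>\<sigma>\<in>sym_partitions k. \<Prod>V\<in>\<sigma>. C (card V))"
      by (rule tendsto_add)
    then show ?thesis using 3 by (simp add: limit_moment_def mult_ext_def)
  qed
qed

section \<open>Comparison of two reverse circulant ensembles\<close>

lemma norm_iexp_diff_le: "cmod (iexp a - iexp b) \<le> \<bar>a - b\<bar>"
proof -
  have "iexp a - iexp b = iexp b * (iexp (a - b) - 1)"
    by (simp add: right_diff_distrib exp_add[symmetric] algebra_simps)
  then have "cmod (iexp a - iexp b) = cmod (iexp (a - b) - 1)" by (simp add: norm_mult)
  also have "\<dots> \<le> \<bar>a - b\<bar>" using iexp_approx1[of "a - b" 0] by simp
  finally show ?thesis .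
qed

text \<open>The eigenvalues at the same frequency are coupled: they differ by at most the modulus of the transform of
the difference of the rows. The free parameter \<open>\<delta>\<close> replaces an application of the Cauchy-Schwarz inequality, and
Parseval's identity evaluates the mean square.\<close>

lemma eesd_char_perturbation:
  fixes X Y :: "nat \<Rightarrow> 'a \<Rightarrow> real"
  assumes n: "0 < n" and M: "prob_space M"
    and X: "\<And>i. i < n \<Longrightarrow> X i \<in> borel_measurable M" and Y: "\<And>i. i < n \<Longrightarrow> Y i \<in> borel_measurable M"
    and sq: "\<And>i. i < n \<Longrightarrow> integrable M (\<lambda>\<omega>. (X i \<omega> - Y i \<omega>)\<^sup>2)" and \<delta>: "0 < \<delta>"
  shows "cmod (char (rc_eesd M n X) t
      - char (rc_eesd M n Y) t)
    \<le> \<bar>t\<bar> / 2 * (\<delta> + (\<Sum>i<n. \<integral>\<omega>. (X i \<omega> - Y i \<omega>)\<^sup>2 \<partial>M) / \<delta>)"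
proof -
  interpret prob_space M by (rule M)
  let ?D = "\<lambda>\<omega> m. (cmod (dft n (\<lambda>i. X i \<omega> - Y i \<omega>) m))\<^sup>2"
  let ?lx = "\<lambda>\<omega> m. rc_eig n (\<lambda>i. X i \<omega>) m" and ?ly = "\<lambda>\<omega> m. rc_eig n (\<lambda>i. Y i \<omega>) m"
  let ?S = "\<Sum>i<n. \<integral>\<omega>. (X i \<omega> - Y i \<omega>)\<^sup>2 \<partial>M"
  have sum_int: "integrable M (\<lambda>\<omega>. \<Sum>i<n. (X i \<omega> - Y i \<omega>)\<^sup>2)"
    using sq by (intro Bochner_Integration.integrable_sum) auto
  have D_int: "integrable M (\<lambda>\<omega>. ?D \<omega> m)" if m: "m < n" for m
  proof (rule Bochner_Integration.integrable_bound)
    show "integrable M (\<lambda>\<omega>. real n * (\<Sum>i<n. (X i \<omega> - Y i \<omega>)\<^sup>2))" using sum_int by (rule integrable_mult_right)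
    show "(\<lambda>\<omega>. ?D \<omega> m) \<in> borel_measurable M"
      unfolding dft_def using X Y
      by (intro borel_measurable_power borel_measurable_norm borel_measurable_sum borel_measurable_times) auto
    show "AE \<omega> in M. norm (?D \<omega> m) \<le> norm (real n * (\<Sum>i<n. (X i \<omega> - Y i \<omega>)\<^sup>2))"
      using member_le_sum[of m "{..<n}" "?D _"] m by (auto intro!: AE_I2 simp: dft_parseval[OF n, symmetric] sum_nonneg)
  qed
  have x_int: "integrable M (\<lambda>\<omega>. iexp (t * ?lx \<omega> m))" for m
    using rc_eig_measurable[where n = n and m = m, OF X] by (intro integrable_iexp) auto
  have y_int: "integrable M (\<lambda>\<omega>. iexp (t * ?ly \<omega> m))" for m
    using rc_eig_measurable[where n = n and m = m, OF Y] by (intro integrable_iexp) auto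
  have "char (rc_eesd M n X) t = (1 / real n) *\<^sub>R (\<Sum>m<n. \<integral>\<omega>. iexp (t * ?lx \<omega> m) \<partial>M)"
    unfolding char_def using x_int by (intro eesd_integral(2) n M X) auto
  moreover have "char (rc_eesd M n Y) t = (1 / real n) *\<^sub>R (\<Sum>m<n. \<integral>\<omega>. iexp (t * ?ly \<omega> m) \<partial>M)"
    unfolding char_def using y_int by (intro eesd_integral(2) n M Y) auto
  ultimately have "char (rc_eesd M n X) t
      - char (rc_eesd M n Y) t
      = (1 / real n) *\<^sub>R (\<Sum>m<n. \<integral>\<omega>. (iexp (t * ?lx \<omega> m) - iexp (t * ?ly \<omega> m)) \<partial>M)"
    using x_int y_int by (simp only: scaleR_diff_right[symmetric] sum_subtractf[symmetric] Bochner_Integration.integral_diff)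
  then have "cmod (char (rc_eesd M n X) t
      - char (rc_eesd M n Y) t)
      \<le> 1 / real n * (\<Sum>m<n. cmod (\<integral>\<omega>. (iexp (t * ?lx \<omega> m) - iexp (t * ?ly \<omega> m)) \<partial>M))"
    by (simp add: divide_right_mono norm_sum)
  also have "\<dots> \<le> 1 / real n * (\<Sum>m<n. \<integral>\<omega>. \<bar>t\<bar> / 2 * (\<delta> + ?D \<omega> m / \<delta>) \<partial>M)"
  proof (intro mult_left_mono sum_mono)
    fix m assume "m \<in> {..<n}"
    then have m: "m < n" by simp
    have "cmod (\<integral>\<omega>. (iexp (t * ?lx \<omega> m) - iexp (t * ?ly \<omega> m)) \<partial>M)
        \<le> (\<integral>\<omega>. cmod (iexp (t * ?lx \<omega> m) - iexp (t * ?ly \<omega> m)) \<partial>M)" by (rule integral_norm_bound)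
    also have "\<dots> \<le> (\<integral>\<omega>. \<bar>t\<bar> / 2 * (\<delta> + ?D \<omega> m / \<delta>) \<partial>M)"
    proof (rule integral_mono)
      show "integrable M (\<lambda>\<omega>. cmod (iexp (t * ?lx \<omega> m) - iexp (t * ?ly \<omega> m)))"
        using x_int y_int by (intro integrable_norm Bochner_Integration.integrable_diff)
      show "integrable M (\<lambda>\<omega>. \<bar>t\<bar> / 2 * (\<delta> + ?D \<omega> m / \<delta>))"
        using D_int[OF m] by (intro integrable_mult_right Bochner_Integration.integrable_add integrable_const integrable_divide)
      fix \<omega>
      let ?d = "cmod (dft n (\<lambda>i. X i \<omega> - Y i \<omega>) m)"
      have "cmod (iexp (t * ?lx \<omega> m) - iexp (t * ?ly \<omega> m)) \<le> \<bar>t * ?lx \<omega> m - t * ?ly \<omega> m\<bar>"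
        by (rule norm_iexp_diff_le)
      also have "\<dots> = \<bar>t\<bar> * \<bar>?lx \<omega> m - ?ly \<omega> m\<bar>" by (simp add: abs_mult[symmetric] right_diff_distrib)
      also have "\<dots> \<le> \<bar>t\<bar> * ?d" using rc_eig_lipschitz by (intro mult_left_mono) auto
      also have "\<dots> \<le> \<bar>t\<bar> * ((\<delta> + ?d\<^sup>2 / \<delta>) / 2)"
      proof (intro mult_left_mono)
        have "0 \<le> (\<delta> - ?d)\<^sup>2" by simp
        then have "2 * ?d * \<delta> \<le> \<delta> * \<delta> + ?d\<^sup>2" by (simp add: power2_eq_square algebra_simps)
        then show "?d \<le> (\<delta> + ?d\<^sup>2 / \<delta>) / 2" using \<delta> by (simp add: field_simps)
      qed simp
      finally show "cmod (iexp (t * ?lx \<omega> m) - iexp (t * ?ly \<omega> m)) \<le> \<bar>t\<bar> / 2 * (\<delta> + ?D \<omega> m / \<delta>)" by simp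
    qed
    finally show "cmod (\<integral>\<omega>. (iexp (t * ?lx \<omega> m) - iexp (t * ?ly \<omega> m)) \<partial>M)
        \<le> (\<integral>\<omega>. \<bar>t\<bar> / 2 * (\<delta> + ?D \<omega> m / \<delta>) \<partial>M)" .
  qed simp
  also have "(\<Sum>m<n. \<integral>\<omega>. \<bar>t\<bar> / 2 * (\<delta> + ?D \<omega> m / \<delta>) \<partial>M)
      = (\<Sum>m<n. \<bar>t\<bar> / 2 * (\<delta> + (\<integral>\<omega>. ?D \<omega> m \<partial>M) / \<delta>))"
  proof (rule sum.cong[OF refl])
    fix m assume "m \<in> {..<n}"
    then have i: "integrable M (\<lambda>\<omega>. ?D \<omega> m / \<delta>)" using D_int by (intro integrable_divide) auto
    have "(\<integral>\<omega>. \<bar>t\<bar> / 2 * (\<delta> + ?D \<omega> m / \<delta>) \<partial>M) = \<bar>t\<bar> / 2 * (\<integral>\<omega>. \<delta> + ?D \<omega> m / \<delta> \<partial>M)"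
      by (rule integral_mult_right_zero)
    also have "(\<integral>\<omega>. \<delta> + ?D \<omega> m / \<delta> \<partial>M) = \<delta> + (\<integral>\<omega>. ?D \<omega> m \<partial>M) / \<delta>"
      using i by (subst Bochner_Integration.integral_add) (auto simp: prob_space)
    finally show "(\<integral>\<omega>. \<bar>t\<bar> / 2 * (\<delta> + ?D \<omega> m / \<delta>) \<partial>M) = \<bar>t\<bar> / 2 * (\<delta> + (\<integral>\<omega>. ?D \<omega> m \<partial>M) / \<delta>)" .
  qed
  also have "\<dots> = \<bar>t\<bar> / 2 * (real n * \<delta> + (\<Sum>m<n. \<integral>\<omega>. ?D \<omega> m \<partial>M) / \<delta>)"
    by (simp add: sum_distrib_left[symmetric] sum.distrib sum_divide_distrib[symmetric])
  also have "(\<Sum>m<n. \<integral>\<omega>. ?D \<omega> m \<partial>M) = real n * ?S"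
  proof -
    have "(\<Sum>m<n. \<integral>\<omega>. ?D \<omega> m \<partial>M) = (\<integral>\<omega>. (\<Sum>m<n. ?D \<omega> m) \<partial>M)"
      using D_int by (intro Bochner_Integration.integral_sum[symmetric]) auto
    also have "\<dots> = real n * (\<integral>\<omega>. (\<Sum>i<n. (X i \<omega> - Y i \<omega>)\<^sup>2) \<partial>M)" unfolding dft_parseval[OF n] by simp
    also have "(\<integral>\<omega>. (\<Sum>i<n. (X i \<omega> - Y i \<omega>)\<^sup>2) \<partial>M) = ?S"
      using sq by (intro Bochner_Integration.integral_sum) auto
    finally show ?thesis .
  qed
  also have "1 / real n * (\<bar>t\<bar> / 2 * (real n * \<delta> + real n * ?S / \<delta>)) = \<bar>t\<bar> / 2 * (\<delta> + ?S / \<delta>)"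
    using n \<delta> by (simp add: field_simps)
  finally show ?thesis .
qed

section \<open>The truncated and the full ensemble\<close>

lemma bounded_by_uniform_limit:
  fixes f :: "nat \<Rightarrow> real \<Rightarrow> real"
  assumes b: "\<And>n. 1 \<le> n \<Longrightarrow> bounded (f n ` S)" and lim: "uniform_limit S f h sequentially"
  shows "\<exists>K. (\<forall>n\<ge>1. \<forall>s\<in>S. \<bar>f n s\<bar> \<le> K) \<and> (\<forall>s\<in>S. \<bar>h s\<bar> \<le> K)"
proof -
  obtain N0 where N0: "\<forall>n\<ge>N0. \<forall>s\<in>S. dist (f n s) (h s) < 1"
    using uniform_limitD[OF lim, of 1] by (auto simp: eventually_sequentially)
  define N where "N = max 1 N0"
  have N: "1 \<le> N" "\<And>n s. N \<le> n \<Longrightarrow> s \<in> S \<Longrightarrow> \<bar>f n s - h s\<bar> < 1"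
    using N0 by (auto simp: N_def dist_real_def)
  have "\<forall>n. \<exists>K. 1 \<le> n \<longrightarrow> (\<forall>s\<in>S. \<bar>f n s\<bar> \<le> K)"
    using b by (auto simp: bounded_iff)
  then obtain K where K: "\<And>n s. 1 \<le> n \<Longrightarrow> s \<in> S \<Longrightarrow> \<bar>f n s\<bar> \<le> K n" by metis
  define L where "L = (\<Sum>n\<in>{1..N}. \<bar>K n\<bar>)"
  have L: "\<bar>f n s\<bar> \<le> L" if "1 \<le> n" "n \<le> N" "s \<in> S" for n s
  proof -
    have "\<bar>K n\<bar> \<le> L" unfolding L_def using that by (intro member_le_sum) auto
    then show ?thesis using K[OF that(1,3)] by linarith
  qed
  have h: "\<bar>h s\<bar> \<le> L + 1" if "s \<in> S" for s
    using L[OF N(1) order_refl that] N(2)[OF order_refl that] by linarith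
  have "\<bar>f n s\<bar> \<le> L + 2" if "1 \<le> n" "s \<in> S" for n s
  proof (cases "n \<le> N")
    case True
    then show ?thesis using L[OF that(1) True that(2)] by linarith
  next
    case False
    then show ?thesis using N(2)[of n s] h[OF that(2)] that by linarith
  qed
  moreover have "\<bar>h s\<bar> \<le> L + 2" if "s \<in> S" for s using h[OF that] by linarith
  ultimately show ?thesis by blast
qed

lemma trunc_power: "1 \<le> c \<Longrightarrow> trunc t a ^ c = a ^ c * indicator {a. ennreal \<bar>a\<bar> \<le> t} a"
  by (auto simp: trunc_def indicator_def power_0_left)

lemma trunc_measurable: "trunc t \<in> borel_measurable borel"
proof -
  have "{a \<in> space borel. ennreal \<bar>a\<bar> \<le> t} \<in> sets (borel :: real measure)" by measurable
  then have "{a. ennreal \<bar>a\<bar> \<le> t} \<in> sets (borel :: real measure)" by simp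
  then show ?thesis unfolding trunc_def[abs_def] by (intro borel_measurable_times borel_measurable_indicator) auto
qed

lemma assumption_A_D:
  assumes "assumption_A M x t g h"
  shows "\<And>k n. 1 \<le> k \<Longrightarrow> 1 \<le> n \<Longrightarrow> bounded (g (2 * k) n ` {0..1})"
    and "\<And>k n. 1 \<le> k \<Longrightarrow> 1 \<le> n \<Longrightarrow> riemann_integrable_on (g (2 * k) n) 0 1"
    and "\<And>k n i. 1 \<le> k \<Longrightarrow> 1 \<le> n \<Longrightarrow> i < n \<Longrightarrow> integrable (M n) (\<lambda>\<omega>. trunc (t n) (x n i \<omega>) ^ (2 * k))"
    and "\<And>k n i. 1 \<le> k \<Longrightarrow> 1 \<le> n \<Longrightarrow> i < n \<Longrightarrow>
      real n * (\<integral>\<omega>. trunc (t n) (x n i \<omega>) ^ (2 * k) \<partial>M n) = g (2 * k) n (real i / real n)"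
    and "\<And>k \<alpha>. 1 \<le> k \<Longrightarrow> \<alpha> < 1 \<Longrightarrow> (\<lambda>n. real n powr \<alpha> *
        (SUP i\<in>{..<n}. \<bar>\<integral>\<omega>. trunc (t n) (x n i \<omega>) ^ (2 * k - 1) \<partial>M n\<bar>)) \<longlonglongrightarrow> 0"
    and "\<And>k. 1 \<le> k \<Longrightarrow> uniform_limit {0..1} (g (2 * k)) (h (2 * k)) sequentially"
    and "carleman (\<lambda>m. \<Sum>\<sigma>\<in>partitions m. mult_ext (sup_seq h) \<sigma>)"
proof -
  have e: "1 \<le> k \<Longrightarrow> trunc s a ^ (2 * k) = a ^ (2 * k) * indicator {a. ennreal \<bar>a\<bar> \<le> s} a"
    and o: "1 \<le> k \<Longrightarrow> trunc s a ^ (2 * k - 1) = a ^ (2 * k - 1) * indicator {a. ennreal \<bar>a\<bar> \<le> s} a"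
    for k :: nat and s a by (rule trunc_power; simp)+
  note A = assms[unfolded assumption_A_def]
  show "1 \<le> k \<Longrightarrow> 1 \<le> n \<Longrightarrow> bounded (g (2 * k) n ` {0..1})" for k n using A by blast
  show "1 \<le> k \<Longrightarrow> 1 \<le> n \<Longrightarrow> riemann_integrable_on (g (2 * k) n) 0 1" for k n using A by blast
  show "integrable (M n) (\<lambda>\<omega>. trunc (t n) (x n i \<omega>) ^ (2 * k))" if "1 \<le> k" "1 \<le> n" "i < n" for k n i
    unfolding e[OF that(1)] using A that by blast
  show "real n * (\<integral>\<omega>. trunc (t n) (x n i \<omega>) ^ (2 * k) \<partial>M n) = g (2 * k) n (real i / real n)"
    if "1 \<le> k" "1 \<le> n" "i < n" for k n i
    unfolding e[OF that(1)] using A that by blast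
  show "(\<lambda>n. real n powr \<alpha> * (SUP i\<in>{..<n}. \<bar>\<integral>\<omega>. trunc (t n) (x n i \<omega>) ^ (2 * k - 1) \<partial>M n\<bar>)) \<longlonglongrightarrow> 0"
    if "1 \<le> k" "\<alpha> < 1" for k \<alpha>
    unfolding o[OF that(1)] using A that by blast
  show "1 \<le> k \<Longrightarrow> uniform_limit {0..1} (g (2 * k)) (h (2 * k)) sequentially" for k using A by blast
  show "carleman (\<lambda>m. \<Sum>\<sigma>\<in>partitions m. mult_ext (sup_seq h) \<sigma>)" using A by blast
qed

text \<open>Even moments are of order \<open>1 / n\<close> by the uniform boundedness of the \<open>g\<close>, and odd moments are
of smaller order than every power \<open>n powr - \<alpha>\<close> with \<open>\<alpha> < 1\<close>. The stated exponent is a common one; the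
quantifier over \<open>c \<le> k\<close> collects all block sizes that occur in a moment of order \<open>k\<close>.\<close>

lemma truncated_moment_bound:
  assumes A: "assumption_A M x t g h" and k: "1 \<le> k"
  shows "\<exists>B\<ge>1. \<forall>n\<ge>1. \<forall>v<n. \<forall>c. 1 \<le> c \<longrightarrow> c \<le> k \<longrightarrow>
      \<bar>\<integral>\<omega>. trunc (t n) (x n v \<omega>) ^ c \<partial>M n\<bar> \<le> B * real n powr (- (1 - 1 / (2 * real k)))"
proof -
  define a where "a = 1 - 1 / (2 * real k)"
  have a1: "a < 1" using k by (simp add: a_def)
  note A = assumption_A_D[OF A]
  have "\<forall>c. \<exists>K. 1 \<le> c \<longrightarrow> (\<forall>n\<ge>1. \<forall>v<n. \<bar>\<integral>\<omega>. trunc (t n) (x n v \<omega>) ^ c \<partial>M n\<bar> \<le> K * real n powr (- a))"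
  proof
    fix c :: nat
    show "\<exists>K. 1 \<le> c \<longrightarrow> (\<forall>n\<ge>1. \<forall>v<n. \<bar>\<integral>\<omega>. trunc (t n) (x n v \<omega>) ^ c \<partial>M n\<bar> \<le> K * real n powr (- a))"
    proof (cases "c = 0")
      case False
      show ?thesis
      proof (cases "even c")
        case True
        then obtain m where m: "c = 2 * m" "1 \<le> m" using False by (auto elim!: evenE)
        obtain K where K: "\<And>n s. 1 \<le> n \<Longrightarrow> s \<in> {0..1} \<Longrightarrow> \<bar>g (2 * m) n s\<bar> \<le> K"
          using bounded_by_uniform_limit[OF A(1)[OF m(2)] A(6)[OF m(2)]] by blast
        have "\<bar>\<integral>\<omega>. trunc (t n) (x n v \<omega>) ^ c \<partial>M n\<bar> \<le> K * real n powr (- a)" if nv: "1 \<le> n" "v < n" for n v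
        proof -
          have s: "real v / real n \<in> {0..1}" using nv by (auto simp: divide_simps)
          have "real n * \<bar>\<integral>\<omega>. trunc (t n) (x n v \<omega>) ^ c \<partial>M n\<bar> = \<bar>g (2 * m) n (real v / real n)\<bar>"
            unfolding A(4)[OF m(2) nv, symmetric] m(1) by (simp add: abs_mult)
          also have "\<dots> \<le> K" by (rule K[OF nv(1) s])
          finally have "\<bar>\<integral>\<omega>. trunc (t n) (x n v \<omega>) ^ c \<partial>M n\<bar> \<le> K * real n powr (- 1)"
            using nv by (simp add: powr_minus_divide field_simps)
          also have "\<dots> \<le> K * real n powr (- a)"
            using K[OF nv(1) s] nv a1 by (intro mult_left_mono powr_mono) auto
          finally show ?thesis .
        qed
        then show ?thesis by blast
      next
        case odd: False
        define m where "m = (c + 1) div 2"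
        have m: "1 \<le> m" "c = 2 * m - 1" using odd by (auto simp: m_def elim!: oddE)
        let ?F = "\<lambda>n. real n powr a * (SUP i\<in>{..<n}. \<bar>\<integral>\<omega>. trunc (t n) (x n i \<omega>) ^ c \<partial>M n\<bar>)"
        have "?F \<longlonglongrightarrow> 0" using A(5)[OF m(1) a1] unfolding m(2) .
        then have "Bseq ?F" by (intro convergent_imp_Bseq convergentI)
        then obtain K where K: "\<And>n. \<bar>?F n\<bar> \<le> K" unfolding Bseq_def by auto
        have "\<bar>\<integral>\<omega>. trunc (t n) (x n v \<omega>) ^ c \<partial>M n\<bar> \<le> K * real n powr (- a)" if nv: "1 \<le> n" "v < n" for n v
        proof -
          have "\<bar>\<integral>\<omega>. trunc (t n) (x n v \<omega>) ^ c \<partial>M n\<bar> \<le> (SUP i\<in>{..<n}. \<bar>\<integral>\<omega>. trunc (t n) (x n i \<omega>) ^ c \<partial>M n\<bar>)"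
            using nv by (intro cSUP_upper bdd_above_finite) auto
          then have "real n powr a * \<bar>\<integral>\<omega>. trunc (t n) (x n v \<omega>) ^ c \<partial>M n\<bar> \<le> ?F n"
            by (intro mult_left_mono) auto
          also have "\<dots> \<le> K" using K[of n] by linarith
          finally show ?thesis using nv by (simp add: powr_minus_divide field_simps)
        qed
        then show ?thesis by blast
      qed
    qed simp
  qed
  then obtain K where K: "\<And>c n v. 1 \<le> c \<Longrightarrow> 1 \<le> n \<Longrightarrow> v < n \<Longrightarrow>
      \<bar>\<integral>\<omega>. trunc (t n) (x n v \<omega>) ^ c \<partial>M n\<bar> \<le> K c * real n powr (- a)" by metis
  define B where "B = 1 + (\<Sum>c\<in>{1..k}. \<bar>K c\<bar>)"
  have "\<bar>\<integral>\<omega>. trunc (t n) (x n v \<omega>) ^ c \<partial>M n\<bar> \<le> B * real n powr (- a)"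
    if "1 \<le> n" "v < n" "1 \<le> c" "c \<le> k" for n v c
  proof -
    have "\<bar>K c\<bar> \<le> (\<Sum>c\<in>{1..k}. \<bar>K c\<bar>)" using that by (intro member_le_sum) auto
    then have "K c * real n powr (- a) \<le> B * real n powr (- a)" unfolding B_def by (intro mult_right_mono) auto
    then show ?thesis using K[OF that(3,1,2)] by linarith
  qed
  moreover have "1 \<le> B" unfolding B_def by (simp add: sum_nonneg)
  ultimately show ?thesis unfolding a_def by blast
qed

lemma carleman_antimono:
  assumes a: "carleman a" and b: "\<And>k. 1 \<le> k \<Longrightarrow> 0 \<le> b (2 * k)" "\<And>k. 1 \<le> k \<Longrightarrow> b (2 * k) \<le> a (2 * k)"
  shows "carleman b"
proof -
  let ?f = "\<lambda>c j. let k = Suc j in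
        if c (2 * k) = 0 then \<infinity> else ennreal (c (2 * k) powr (- 1 / real (2 * k)))"
  have "?f a j \<le> ?f b j" for j
  proof (cases "b (2 * Suc j) = 0")
    case False
    then have "0 < b (2 * Suc j)" "b (2 * Suc j) \<le> a (2 * Suc j)" using b[of "Suc j"] by auto
    then show ?thesis by (auto simp: Let_def intro!: ennreal_leI powr_mono2')
  qed (simp add: Let_def)
  then have "(\<Sum>j. ?f a j) \<le> (\<Sum>j. ?f b j)" by (intro suminf_le) auto
  then show ?thesis using a unfolding carleman_def by (simp add: top_unique)
qed

text \<open>A matrix of size zero has no spectral distribution, so sequences of laws start at \<open>n = 1\<close>.\<close>

lemma weak_conv_m_Suc:
  assumes "weak_conv_m (\<lambda>n. \<mu> (Suc n)) \<nu>"
  shows "weak_conv_m \<mu> \<nu>"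
  unfolding weak_conv_m_def weak_conv_def
proof (intro allI impI)
  fix z assume "isCont (cdf \<nu>) z"
  then have "(\<lambda>n. cdf (\<mu> (Suc n)) z) \<longlonglongrightarrow> cdf \<nu> z"
    by (rule assms[unfolded weak_conv_m_def weak_conv_def, rule_format])
  then show "(\<lambda>n. cdf (\<mu> n) z) \<longlonglongrightarrow> cdf \<nu> z" by (rule LIMSEQ_imp_Suc)
qed

text \<open>Reflection preserves the even moments, and the odd ones vanish, so determinacy identifies the measure with its
reflection.\<close>

lemma symmetric_of_moments:
  assumes \<mu>: "real_distribution \<mu>" "has_moments \<mu> \<beta>" and odd: "\<And>k. odd k \<Longrightarrow> \<beta> k = 0" and carl: "carleman \<beta>"
  shows "symmetric_measure \<mu>"
  unfolding symmetric_measure_def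
proof (rule carleman_uniqueness[OF _ _ \<mu> carl])
  interpret real_distribution \<mu> by (rule \<mu>(1))
  show "real_distribution (distr \<mu> borel uminus)"
    by (intro real_distribution_distr) simp
  have m: "uminus \<in> measurable \<mu> borel" by simp
  show "has_moments (distr \<mu> borel uminus) \<beta>"
    unfolding has_moments_def
  proof (intro allI conjI)
    fix k
    have i: "integrable \<mu> (\<lambda>x. x ^ k)" "(\<integral>x. x ^ k \<partial>\<mu>) = \<beta> k" using \<mu>(2) by (auto simp: has_moments_def)
    have e: "(\<lambda>x :: real. (- x) ^ k) = (\<lambda>x. (- 1) ^ k * x ^ k)" by (intro ext) (rule power_minus)
    show "integrable (distr \<mu> borel uminus) (\<lambda>x. x ^ k)"
    proof (subst integrable_distr_eq[OF m])
      show "integrable \<mu> (\<lambda>x. (- x) ^ k)" unfolding e using i(1) by (rule integrable_mult_right)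
    qed simp
    have "(\<integral>x. x ^ k \<partial>distr \<mu> borel uminus) = (\<integral>x. (- x) ^ k \<partial>\<mu>)" by (rule integral_distr[OF m]) simp
    also have "\<dots> = (- 1) ^ k * \<beta> k" unfolding e i(2)[symmetric] by (rule integral_mult_right_zero)
    also have "\<dots> = \<beta> k" using odd[of k] by (cases "even k") auto
    finally show "(\<integral>x. x ^ k \<partial>distr \<mu> borel uminus) = \<beta> k" .
  qed
qed

text \<open>For the limit functions and their sup norms this compares the limit moments with the numbers in Carleman's condition.\<close>

lemma sum_sym_partitions_le:
  assumes "\<And>m. 1 \<le> m \<Longrightarrow> 0 \<le> C (2 * m)" "\<And>m. 1 \<le> m \<Longrightarrow> C (2 * m) \<le> D (2 * m)" "\<And>m. 1 \<le> m \<Longrightarrow> 0 \<le> D m"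
  shows "0 \<le> (\<Sum>\<sigma>\<in>sym_partitions k. mult_ext C \<sigma>)"
    "(\<Sum>\<sigma>\<in>sym_partitions k. mult_ext C \<sigma>) \<le> (\<Sum>\<sigma>\<in>partitions k. mult_ext D \<sigma>)"
proof -
  have C: "0 \<le> C (card V)" "C (card V) \<le> D (card V)" if V: "\<sigma> \<in> sym_partitions k" "V \<in> \<sigma>" for \<sigma> V
  proof -
    obtain m where "1 \<le> m" "card V = 2 * m" by (rule sym_partition_block[OF V])
    then show "0 \<le> C (card V)" "C (card V) \<le> D (card V)" using assms by auto
  qed
  show "0 \<le> (\<Sum>\<sigma>\<in>sym_partitions k. mult_ext C \<sigma>)"
    unfolding mult_ext_def using C by (intro sum_nonneg prod_nonneg) blast
  have "(\<Sum>\<sigma>\<in>sym_partitions k. mult_ext C \<sigma>) \<le> (\<Sum>\<sigma>\<in>sym_partitions k. mult_ext D \<sigma>)"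
    unfolding mult_ext_def using C by (intro sum_mono prod_mono) blast
  also have "\<dots> \<le> (\<Sum>\<sigma>\<in>partitions k. mult_ext D \<sigma>)"
  proof (intro sum_mono2 finite_partitions)
    fix \<sigma> assume "\<sigma> \<in> partitions k - sym_partitions k"
    then have \<sigma>: "\<sigma> \<in> partitions k" by simp
    have "0 \<le> D (card V)" if "V \<in> \<sigma>" for V
      using partitionsD(4,5)[OF \<sigma> that] by (intro assms(3)) (simp add: Suc_le_eq card_gt_0_iff)
    then show "0 \<le> mult_ext D \<sigma>" unfolding mult_ext_def by (intro prod_nonneg) auto
  qed (auto simp: sym_partitions_def)
  finally show "(\<Sum>\<sigma>\<in>sym_partitions k. mult_ext C \<sigma>) \<le> (\<Sum>\<sigma>\<in>partitions k. mult_ext D \<sigma>)" .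
qed

theorem theorem3p1:
  fixes M :: "nat \<Rightarrow> 'a measure"
    and x :: "nat \<Rightarrow> nat \<Rightarrow> 'a \<Rightarrow> real"
    and t :: "nat \<Rightarrow> ennreal"
    and g :: "nat \<Rightarrow> nat \<Rightarrow> real \<Rightarrow> real"
    and h :: "nat \<Rightarrow> real \<Rightarrow> real"
  assumes "\<And>n. n \<ge> 1 \<Longrightarrow> prob_space (M n)"
    and "\<And>n. n \<ge> 1 \<Longrightarrow> prob_space.indep_vars (M n) (\<lambda>_. borel) (x n) {..<n}"
    and "assumption_A M x t g h"
  shows "\<exists>\<mu>. real_distribution \<mu> \<and> symmetric_measure \<mu> \<and>
    weak_conv_m (\<lambda>n. eesd (M n) (\<lambda>\<omega>. reverse_circulant n (\<lambda>i. trunc (t n) (x n i \<omega>)))) \<mu> \<and>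
    has_moments \<mu> (limit_moment (\<lambda>m. integral {0..1} (h m))) \<and>
    ((\<forall>n\<ge>1. identically_distributed (M n) n (x n)) \<longrightarrow>
      (\<forall>m\<ge>1. \<forall>n\<ge>1. \<forall>i<n. g (2 * m) n (real i / real n) = g (2 * m) n 0) \<and>
      (\<exists>C. (\<forall>m\<ge>1. (\<lambda>n. g (2 * m) n 0) \<longlonglongrightarrow> C (2 * m)) \<and> has_moments \<mu> (limit_moment C))) \<and>
    ((\<lambda>n. \<Sum>i<n. \<integral>\<^sup>+\<omega>. ennreal ((x n i \<omega>)\<^sup>2) * indicator {a. ennreal \<bar>a\<bar> > t n} (x n i \<omega>) \<partial>M n)
        \<longlonglongrightarrow> 0 \<longrightarrow>
      weak_conv_m (\<lambda>n. eesd (M n) (\<lambda>\<omega>. reverse_circulant n (\<lambda>i. x n i \<omega>))) \<mu>)"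
proof -
  note A = assumption_A_D[OF assms(3)]
  define y where "y n i \<omega> = trunc (t n) (x n i \<omega>)" for n i \<omega>
  define C where "C m = integral {0..1} (h m)" for m
  let ?RC = "\<lambda>n. rc_eesd (M n) n (x n)"
  let ?Z = "\<lambda>n. rc_eesd (M n) n (y n)"
  have x_meas: "x n i \<in> borel_measurable (M n)" if "1 \<le> n" "i < n" for n i
    using assms(2)[OF that(1)] that(2) unfolding prob_space.indep_vars_def[OF assms(1)[OF that(1)]] by auto
  have y_meas: "y n i \<in> borel_measurable (M n)" if "1 \<le> n" "i < n" for n i
    unfolding y_def[abs_def] by (rule measurable_compose[OF x_meas[OF that] trunc_measurable])
  have y_indep: "prob_space.indep_vars (M n) (\<lambda>_. borel) (y n) {..<n}" if "1 \<le> n" for n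
    unfolding y_def[abs_def]
    by (rule prob_space.indep_vars_compose2[OF assms(1)[OF that] assms(2)[OF that] trunc_measurable])
  have y_int: "integrable (M n) (\<lambda>\<omega>. y n i \<omega> ^ k)" if ni: "1 \<le> n" "i < n" for n i k
  proof (cases "k = 0")
    case True
    interpret prob_space "M n" by (rule assms(1)[OF ni(1)])
    show ?thesis unfolding True by simp
  next
    case False
    interpret prob_space "M n" by (rule assms(1)[OF ni(1)])
    have "integrable (M n) (\<lambda>\<omega>. (y n i \<omega> ^ k)\<^sup>2)"
      using A(3)[of k n i] False ni unfolding y_def by (simp add: power_mult[symmetric] mult.commute)
    then show ?thesis
      by (rule square_integrable_imp_integrable[rotated]) (use y_meas[OF ni] in simp)
  qed
  have C_lim: "(\<lambda>n. (\<Sum>v<n. g (2 * m) n (real v / real n)) / real n) \<longlonglongrightarrow> C (2 * m)" if "1 \<le> m" for m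
    unfolding C_def by (rule uniform_limit_riemann_sums(2)[OF A(2)[OF that] A(6)[OF that]])
  have C_sum: "(\<lambda>n. \<Sum>v<n. \<integral>\<omega>. y n v \<omega> ^ (2 * m) \<partial>M n) \<longlonglongrightarrow> C (2 * m)" if m: "1 \<le> m" for m
  proof (rule Lim_transform_eventually[OF C_lim[OF m]])
    show "\<forall>\<^sub>F n in sequentially. (\<Sum>v<n. g (2 * m) n (real v / real n)) / real n = (\<Sum>v<n. \<integral>\<omega>. y n v \<omega> ^ (2 * m) \<partial>M n)"
      using eventually_ge_at_top[of 1]
    proof eventually_elim
      case (elim n)
      have "(\<Sum>v<n. g (2 * m) n (real v / real n)) = (\<Sum>v<n. real n * (\<integral>\<omega>. y n v \<omega> ^ (2 * m) \<partial>M n))"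
        unfolding y_def using A(4)[OF m elim] by (intro sum.cong) auto
      then show ?case using elim by (simp add: sum_distrib_left[symmetric])
    qed
  qed
  have C_nonneg: "0 \<le> C (2 * m)" if "1 \<le> m" for m
    by (rule LIMSEQ_le_const[OF C_sum[OF that]])
       (auto intro!: exI[of _ 0] sum_nonneg Bochner_Integration.integral_nonneg simp: power_mult)
  have h_bdd: "\<exists>K. \<forall>s\<in>{0..1}. \<bar>h (2 * m) s\<bar> \<le> K" if "1 \<le> m" for m
    using bounded_by_uniform_limit[OF A(1)[OF that] A(6)[OF that]] by blast
  have h_sup: "\<bar>h (2 * m) s\<bar> \<le> sup_seq h (2 * m)" if "1 \<le> m" "s \<in> {0..1}" for m s
    unfolding sup_seq_def using h_bdd[OF that(1)] that(2)
    by (auto intro!: cSUP_upper simp: bdd_above_def)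
  have sup_nonneg: "0 \<le> sup_seq h m" if m: "1 \<le> m" for m
  proof (cases "even m")
    case True
    then obtain k where k: "m = 2 * k" by (elim evenE)
    then have "\<bar>h (2 * k) 0\<bar> \<le> sup_seq h (2 * k)" using m by (intro h_sup) auto
    then show ?thesis unfolding k by linarith
  qed (simp add: sup_seq_def)
  have C_le: "C (2 * m) \<le> sup_seq h (2 * m)" if m: "1 \<le> m" for m
  proof -
    have "C (2 * m) \<le> integral {0..1::real} (\<lambda>_. sup_seq h (2 * m))"
      unfolding C_def using h_sup[OF m] uniform_limit_riemann_sums(1)[OF A(2)[OF m] A(6)[OF m]]
      by (intro integral_le) (auto simp: abs_le_iff)
    then show ?thesis by simp
  qed
  \<comment> \<open>The limit moments are bounded by the sums over all partitions that Assumption A controls.\<close>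
  have carl: "carleman (limit_moment C)"
    by (rule carleman_antimono[OF A(7)])
       (use sum_sym_partitions_le[of C "sup_seq h", OF C_nonneg C_le sup_nonneg] in \<open>auto simp: limit_moment_def\<close>)
  have Z_dist: "real_distribution (?Z n)" if "1 \<le> n" for n
    using that y_meas by (intro real_distribution_eesd assms(1)) auto
  have RC_dist: "real_distribution (?RC n)" if "1 \<le> n" for n
    using that x_meas by (intro real_distribution_eesd assms(1)) auto
  have mom: "(\<lambda>n. \<integral>z. z ^ k \<partial>?Z n) \<longlonglongrightarrow> limit_moment C k" for k
    by (rule eesd_moments_converge[OF assms(1) y_indep y_int _ C_sum])
       (use truncated_moment_bound[OF assms(3)] in \<open>simp_all add: y_def\<close>)
  have "\<exists>\<nu>. real_distribution \<nu> \<and> has_moments \<nu> (limit_moment C) \<and> weak_conv_m (\<lambda>n. ?Z (Suc n)) \<nu>"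
  proof (rule method_of_moments[OF _ _ _ carl])
    show "integrable (?Z (Suc n)) (\<lambda>z. z ^ k)" for n k
      by (rule eesd_moment(1)[OF _ assms(1) y_indep y_int]) auto
    show "(\<lambda>n. \<integral>z. z ^ k \<partial>?Z (Suc n)) \<longlonglongrightarrow> limit_moment C k" for k
      using mom by (rule LIMSEQ_Suc)
  qed (simp add: Z_dist)
  then obtain \<mu> where \<mu>: "real_distribution \<mu>" "has_moments \<mu> (limit_moment C)" "weak_conv_m (\<lambda>n. ?Z (Suc n)) \<mu>"
    by blast
  have sym: "symmetric_measure \<mu>"
    by (rule symmetric_of_moments[OF \<mu>(1,2) _ carl]) (simp add: limit_moment_def)
  have iid: "(\<forall>m\<ge>1. \<forall>n\<ge>1. \<forall>i<n. g (2 * m) n (real i / real n) = g (2 * m) n 0) \<and>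
      (\<forall>m\<ge>1. (\<lambda>n. g (2 * m) n 0) \<longlonglongrightarrow> C (2 * m))"
    if iid: "\<forall>n\<ge>1. identically_distributed (M n) n (x n)"
  proof -
    have const: "g (2 * m) n (real i / real n) = g (2 * m) n 0" if m: "1 \<le> m" and ni: "1 \<le> n" "i < n" for m n i
    proof -
      have E: "(\<integral>\<omega>. trunc (t n) (x n j \<omega>) ^ (2 * m) \<partial>M n) = (\<integral>a. trunc (t n) a ^ (2 * m) \<partial>distr (M n) borel (x n j))"
        if "j < n" for j
        using trunc_measurable by (intro integral_distr[symmetric] x_meas ni that) auto
      have "distr (M n) borel (x n i) = distr (M n) borel (x n 0)"
      proof -
        have "0 < n" using ni by simp
        then show ?thesis by (rule iid[unfolded identically_distributed_def, rule_format, OF ni])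
      qed
      then have "(\<integral>\<omega>. trunc (t n) (x n i \<omega>) ^ (2 * m) \<partial>M n) = (\<integral>\<omega>. trunc (t n) (x n 0 \<omega>) ^ (2 * m) \<partial>M n)"
        using E[of i] E[of 0] ni by simp
      then show ?thesis using A(4)[OF m ni] A(4)[OF m ni(1), of 0] ni by simp
    qed
    moreover have "(\<lambda>n. g (2 * m) n 0) \<longlonglongrightarrow> C (2 * m)" if m: "1 \<le> m" for m
    proof (rule Lim_transform_eventually[OF C_lim[OF m]])
      show "\<forall>\<^sub>F n in sequentially. (\<Sum>v<n. g (2 * m) n (real v / real n)) / real n = g (2 * m) n 0"
        using eventually_ge_at_top[of 1]
      proof eventually_elim
        case (elim n)
        have "(\<Sum>v<n. g (2 * m) n (real v / real n)) = (\<Sum>v<n. g (2 * m) n 0)"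
          using const[OF m elim] by (intro sum.cong) auto
        then show ?case using elim by simp
      qed
    qed
    ultimately show ?thesis by blast
  qed
  have untrunc: "weak_conv_m ?RC \<mu>"
    if lim: "(\<lambda>n. \<Sum>i<n. \<integral>\<^sup>+\<omega>. ennreal ((x n i \<omega>)\<^sup>2) * indicator {a. ennreal \<bar>a\<bar> > t n} (x n i \<omega>) \<partial>M n) \<longlonglongrightarrow> 0"
  proof -
    let ?T = "\<lambda>n. \<Sum>i<n. \<integral>\<^sup>+\<omega>. ennreal ((x n i \<omega> - y n i \<omega>)\<^sup>2) \<partial>M n"
    \<comment> \<open>The tail second moments in the hypothesis are the squared distances between full and truncated entries.\<close>
    have tail: "ennreal ((x n i \<omega>)\<^sup>2) * indicator {a. ennreal \<bar>a\<bar> > t n} (x n i \<omega>) = ennreal ((x n i \<omega> - y n i \<omega>)\<^sup>2)" for n i \<omega>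
      by (auto simp: y_def trunc_def indicator_def not_le)
    have T: "?T \<longlonglongrightarrow> 0" using lim unfolding tail .
    have "weak_conv_m (\<lambda>n. ?RC (Suc n)) \<mu>"
    proof (rule levy_continuity[OF _ \<mu>(1)])
      fix s
      have Z_char: "(\<lambda>n. char (?Z (Suc n)) s) \<longlonglongrightarrow> char \<mu> s"
        by (rule levy_continuity1[OF _ \<mu>(1,3)]) (simp add: Z_dist)
      have "(\<lambda>n. char (?RC (Suc n)) s - char (?Z (Suc n)) s) \<longlonglongrightarrow> 0"
      proof (rule LIMSEQ_I)
        fix e :: real assume e: "0 < e"
        define \<delta> where "\<delta> = e / (\<bar>s\<bar> + 1)"
        have \<delta>: "0 < \<delta>" "\<bar>s\<bar> * \<delta> < e" using e by (auto simp: \<delta>_def field_simps)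
        have "\<forall>\<^sub>F n in sequentially. ?T n < ennreal (\<delta>\<^sup>2)"
          using \<delta> by (intro order_tendstoD(2)[OF T]) auto
        then obtain N where N: "\<And>n. N \<le> n \<Longrightarrow> ?T n < ennreal (\<delta>\<^sup>2)" by (auto simp: eventually_sequentially)
        have "cmod (char (?RC n) s - char (?Z n) s) < e" if n: "1 \<le> n" "N \<le> n" for n
        proof -
          have fin: "(\<integral>\<^sup>+\<omega>. ennreal ((x n i \<omega> - y n i \<omega>)\<^sup>2) \<partial>M n) < \<infinity>" if "i < n" for i
          proof -
            have "(\<integral>\<^sup>+\<omega>. ennreal ((x n i \<omega> - y n i \<omega>)\<^sup>2) \<partial>M n) \<le> ?T n"
              using that by (intro member_le_sum) auto
            also have "\<dots> < \<infinity>" using less_trans[OF N[OF n(2)] ennreal_less_top] by simp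
            finally show ?thesis .
          qed
          have int: "integrable (M n) (\<lambda>\<omega>. (x n i \<omega> - y n i \<omega>)\<^sup>2)" if "i < n" for i
            using fin[OF that] x_meas[OF n(1) that] y_meas[OF n(1) that] by (intro integrableI_bounded) auto
          let ?S = "\<Sum>i<n. \<integral>\<omega>. (x n i \<omega> - y n i \<omega>)\<^sup>2 \<partial>M n"
          have "?T n = (\<Sum>i<n. ennreal (\<integral>\<omega>. (x n i \<omega> - y n i \<omega>)\<^sup>2 \<partial>M n))"
            using int by (intro sum.cong refl nn_integral_eq_integral) auto
          also have "\<dots> = ennreal ?S" by (intro sum_ennreal Bochner_Integration.integral_nonneg) auto
          finally have "ennreal ?S < ennreal (\<delta>\<^sup>2)" using N[OF n(2)] by simp
          then have S: "?S < \<delta>\<^sup>2" using ennreal_less_iff[of ?S "\<delta>\<^sup>2"] by (simp add: sum_nonneg)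
          have "cmod (char (?RC n) s - char (?Z n) s) \<le> \<bar>s\<bar> / 2 * (\<delta> + ?S / \<delta>)"
            using n x_meas y_meas int \<delta>(1) by (intro eesd_char_perturbation assms(1)) auto
          also have "\<dots> \<le> \<bar>s\<bar> / 2 * (\<delta> + \<delta>)"
          proof (intro mult_left_mono add_left_mono)
            show "?S / \<delta> \<le> \<delta>" using S \<delta>(1) by (simp add: field_simps power2_eq_square)
          qed auto
          also have "\<dots> < e" using \<delta>(2) by simp
          finally show ?thesis .
        qed
        then have "\<forall>n\<ge>N. norm (char (?RC (Suc n)) s - char (?Z (Suc n)) s - 0) < e" by simp
        then show "\<exists>N. \<forall>n\<ge>N. norm (char (?RC (Suc n)) s - char (?Z (Suc n)) s - 0) < e" by blast
      qed
      from tendsto_add[OF this Z_char] show "(\<lambda>n. char (?RC (Suc n)) s) \<longlonglongrightarrow> char \<mu> s" by simp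
    qed (simp add: RC_dist)
    then show ?thesis by (rule weak_conv_m_Suc)
  qed
  show ?thesis
    using \<mu>(1) sym weak_conv_m_Suc[OF \<mu>(3)] \<mu>(2) iid untrunc
    unfolding y_def C_def[abs_def, symmetric] by blast
qed

end
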